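(* Let $D$ be a smoothly bounded domain in $\mathbb{R}^n$. Let $a$ be any point in $D$ and let $w$ be a convex function on $\bar D$ such that $w(x)=|x-a|^m$ on the boundary of $D$. If $T$ is a minimal supercurrent in $D$ of bidimension $(m,m)$, then its mass satisfies $$\int_D T\wedge\beta^m/m!\ \ge\ w(a)\,\gamma_T(a),$$ where $\gamma_T(a)$ is the density of $T$ at $a$.
   Context: Superforms: let $x=(x_1,\dots,x_n)$ be orthonormal coordinates on $\mathbb{R}^n$ and $\xi=(\xi_1,\dots,\xi_n)$ coordinates on a second copy of $\mathbb{R}^n$. A superform is a differential form $a=\sum a_{I,J}(x)\,dx_I\wedge d\xi_J$ on $\mathbb{R}^n_s=\mathbb{R}^n\oplus\mathbb{R}^n$ whose coefficients do not depend on $\xi$; it has bidegree $(p,q)$ if $|I|=p$, $|J|=q$. $J$ is the multiplicative operator on forms with $J(dx_i)=d\xi_i$, $J(d\xi_i)=-dx_i$; for $a$ of bidegree $(p,0)$ write $a^{\#}=J(a)$. Put $da=\sum \frac{\partial a_{I,J}}{\partial x_k}dx_k\wedge dx_I\wedge d\xi_J$. The superintegral of an $(n,n)$-form is $\int_{\mathbb{R}^n_s}a_0\,dx_1\wedge d\xi_1\wedge\dots\wedge dx_n\wedge d\xi_n=\int_{\mathbb{R}^n}a_0\,d\lambda$ ($\lambda$ Lebesgue measure). Supercurrents of bidegree $(p,q)$ (bidimension $(n-p,n-q)$) on an open set are the continuous linear functionals on smooth superforms of bidegree $(n-p,n-q)$ with compact support in $x$; equivalently superforms with distribution coefficients, acting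 by $T.\alpha=\int T\wedge\alpha$. In this setting the coefficients are at worst measures. A supercurrent of bidegree $(n,n)$ and order zero is identified with a measure on $\mathbb{R}^n$. The operator $d$ extends to supercurrents coefficientwise. $\beta=\sum_j dx_j\wedge d\xi_j$. A supercurrent $T$ of bidimension $(m,m)$ is (weakly) positive if $T.\alpha_1\wedge\alpha_1^{\#}\wedge\dots\wedge\alpha_m\wedge\alpha_m^{\#}\ge0$ for all compactly supported smooth $(1,0)$-forms $\alpha_j$; it is symmetric if $J(T)=T$. A positive symmetric supercurrent $T$ of bidimension $(m,m)$, $m\ge1$, is called minimal if $dT\wedge\beta^{m-1}=0$. The density of a minimal supercurrent $T$ at $a$ is $\gamma_T(a)=\lim_{r\to0}r^{-m}\int_{|x-a|<r}T\wedge\beta^m/m!$ (the limit exists because the quantity is nondecreasing in $r$); no division by the volume of the unit ball is made. *)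

theory Defs
  imports "HOL-Analysis.Analysis"
begin

section \<open>Smooth functions\<close>

definition pd :: "'n::finite \<Rightarrow> (real^'n \<Rightarrow> real) \<Rightarrow> real^'n \<Rightarrow> real" where
  "pd k f = (\<lambda>x. frechet_derivative f (at x) (axis k 1))"

definition iterated_pd :: "'n::finite list \<Rightarrow> (real^'n \<Rightarrow> real) \<Rightarrow> real^'n \<Rightarrow> real" where
  "iterated_pd ks f = foldr pd ks f"

text \<open>For open \<open>U\<close> the following is \<open>f \<in> C\<^sup>\<infinity>(U)\<close>: all partial derivatives of
  all orders exist in \<open>U\<close> and are (Frechet) differentiable there.\<close>

definition smooth_on :: "(real^'n::finite) set \<Rightarrow> (real^'n \<Rightarrow> real) \<Rightarrow> bool" where
  "smooth_on U f \<longleftrightarrow> (\<forall>ks. \<forall>x\<in>U. iterated_pd ks f differentiable (at x))"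

text \<open>A bounded domain which near each boundary point is the sublevel set of a smooth function
  with nonvanishing gradient at that point.\<close>

definition smoothly_bounded_domain :: "(real^'n::finite) set \<Rightarrow> bool" where
  "smoothly_bounded_domain D \<longleftrightarrow>
     open D \<and> connected D \<and> D \<noteq> {} \<and> bounded D \<and>
     (\<forall>p\<in>frontier D. \<exists>U \<rho>. open U \<and> p \<in> U \<and> smooth_on U \<rho> \<and>
        \<rho> p = 0 \<and> (\<exists>k. pd k \<rho> p \<noteq> 0) \<and> D \<inter> U = {x\<in>U. \<rho> x < 0})"

text \<open>The library predicate \<^const>\<open>convex_on\<close> presupposes a convex domain of definition. On a set
  that need not be convex, a function is called convex if it is convex on every line segment
  contained in the set. On convex sets this agrees with \<^const>\<open>convex_on\<close>.\<close>

definition convex_fun_on :: "'a::real_vector set \<Rightarrow> ('a \<Rightarrow> real) \<Rightarrow> bool" where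
  "convex_fun_on S f \<longleftrightarrow>
     (\<forall>x y. closed_segment x y \<subseteq> S \<longrightarrow> convex_on (closed_segment x y) f)"

lemma convex_fun_on_iff_convex_on:
  assumes "convex S"
  shows "convex_fun_on S f \<longleftrightarrow> convex_on S f"
proof
  assume *: "convex_fun_on S f"
  show "convex_on S f"
  proof (rule convex_onI)
    fix t :: real and x y
    assume t: "0 < t" "t < 1" and xy: "x \<in> S" "y \<in> S"
    have "closed_segment x y \<subseteq> S"
      using assms xy by (simp add: closed_segment_subset)
    then have "convex_on (closed_segment x y) f"
      using * by (simp add: convex_fun_on_def)
    then show "f ((1 - t) *\<^sub>R x + t *\<^sub>R y) \<le> (1 - t) * f x + t * f y"
      using t by (intro convex_onD) auto
  qed (fact assms)
next
  assume "convex_on S f"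
  then show "convex_fun_on S f"
    by (auto simp: convex_fun_on_def intro: convex_on_subset)
qed

section \<open>Superforms\<close>

text \<open>A superform \<open>\<Sum> a\<^bsub>I,J\<^esub>(x) dx\<^sub>I \<and> d\<xi>\<^sub>J\<close> is the family of its coefficients, indexed by sets
  \<open>I\<close>, \<open>J\<close> of indices; \<open>dx\<^sub>I\<close> and \<open>d\<xi>\<^sub>J\<close> are the wedge products in increasing order.\<close>

type_synonym 'n superform = "'n set \<Rightarrow> 'n set \<Rightarrow> real^'n \<Rightarrow> real"

definition has_bidegree :: "nat \<Rightarrow> nat \<Rightarrow> 'n::{finite,linorder} superform \<Rightarrow> bool" where
  "has_bidegree p q a \<longleftrightarrow> (\<forall>I J x. a I J x \<noteq> 0 \<longrightarrow> card I = p \<and> card J = q)"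

definition fun_form :: "(real^'n::{finite,linorder} \<Rightarrow> real) \<Rightarrow> 'n superform" where
  "fun_form f = (\<lambda>I J x. if I = {} \<and> J = {} then f x else 0)"

definition dx :: "'n::{finite,linorder} \<Rightarrow> 'n superform" where
  "dx k = (\<lambda>I J x. if I = {k} \<and> J = {} then 1 else 0)"

definition dxi :: "'n::{finite,linorder} \<Rightarrow> 'n superform" where
  "dxi k = (\<lambda>I J x. if I = {} \<and> J = {k} then 1 else 0)"

text \<open>For disjoint \<open>I\<close>, \<open>I'\<close> one has \<open>dx\<^sub>I \<and> dx\<^bsub>I'\<^esub> = shuffle_sign I I' dx\<^bsub>I \<union> I'\<^esub>\<close>. Moving \<open>dx\<^bsub>I'\<^esub>\<close> past
  \<open>d\<xi>\<^sub>J\<close> costs \<open>(-1)\<close> to the power \<open>|J| |I'|\<close>.\<close>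

definition shuffle_sign :: "'n::{finite,linorder} set \<Rightarrow> 'n set \<Rightarrow> real" where
  "shuffle_sign I I' = (-1) ^ card {(i, i'). i \<in> I \<and> i' \<in> I' \<and> i' < i}"

definition wedge ::
  "'n::{finite,linorder} superform \<Rightarrow> 'n superform \<Rightarrow> 'n superform" (infixr "\<and>\<^sub>s" 70) where
  "a \<and>\<^sub>s b = (\<lambda>K L x. \<Sum>I\<in>Pow K. \<Sum>J\<in>Pow L.
     (-1) ^ (card J * card (K - I)) * shuffle_sign I (K - I) * shuffle_sign J (L - J)
       * a I J x * b (K - I) (L - J) x)"

definition wedge_list :: "'n::{finite,linorder} superform list \<Rightarrow> 'n superform" where
  "wedge_list as = foldr (\<and>\<^sub>s) as (fun_form (\<lambda>x. 1))"

definition wedge_power :: "'n::{finite,linorder} superform \<Rightarrow> nat \<Rightarrow> 'n superform" where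
  "wedge_power a m = wedge_list (replicate m a)"

definition beta :: "'n::{finite,linorder} superform" where
  "beta = (\<lambda>I J x. \<Sum>j\<in>UNIV. (dx j \<and>\<^sub>s dxi j) I J x)"

text \<open>\<open>J(dx\<^sub>L \<and> d\<xi>\<^sub>K) = (-1)\<^bsup>|K|\<^esup> d\<xi>\<^sub>L \<and> dx\<^sub>K = (-1)\<^bsup>|K| + |K| |L|\<^esup> dx\<^sub>K \<and> d\<xi>\<^sub>L\<close>. The lemmas below
  show that this is the multiplicative operator with \<open>dx\<^sub>i \<mapsto> d\<xi>\<^sub>i\<close> and \<open>d\<xi>\<^sub>i \<mapsto> - dx\<^sub>i\<close>.\<close>

definition Jop :: "'n::{finite,linorder} superform \<Rightarrow> 'n superform" where
  "Jop a = (\<lambda>K L x. (-1) ^ (card K + card K * card L) * a L K x)"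

lemma Jop_dx: "Jop (dx k) = dxi k"
  by (auto simp: Jop_def dx_def dxi_def fun_eq_iff)

lemma Jop_dxi: "Jop (dxi k) = (\<lambda>I J x. - dx k I J x)"
  by (auto simp: Jop_def dx_def dxi_def fun_eq_iff)

lemma Jop_fun_form: "Jop (fun_form f) = fun_form f"
  by (auto simp: Jop_def fun_form_def fun_eq_iff)

lemma Jop_wedge: "Jop (a \<and>\<^sub>s b) = Jop a \<and>\<^sub>s Jop b"
proof (intro ext)
  fix K L :: "'a set" and x
  have sgn: "(-1::real) ^ (card K + card K * card L) * (-1) ^ (card I * card (L - J))
      = (-1) ^ (card J * card (K - I)) * (-1) ^ (card I + card I * card J)
        * (-1) ^ (card (K - I) + card (K - I) * card (L - J))"
    if "I \<in> Pow K" "J \<in> Pow L" for I J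
  proof -
    have K: "card K = card I + card (K - I)" and L: "card L = card J + card (L - J)"
      using that by (auto simp: card_Diff_subset card_mono)
    show ?thesis
      unfolding K L power_add[symmetric] by (rule minus_one_power_iff[THEN trans])
        (auto simp: minus_one_power_iff algebra_simps)
  qed
  have "Jop (a \<and>\<^sub>s b) K L x = (\<Sum>J\<in>Pow L. \<Sum>I\<in>Pow K.
      ((-1) ^ (card K + card K * card L) * (-1) ^ (card I * card (L - J)))
      * shuffle_sign J (L - J) * shuffle_sign I (K - I) * a J I x * b (L - J) (K - I) x)"
    by (simp add: Jop_def wedge_def sum_distrib_left mult.assoc)
  also have "\<dots> = (\<Sum>J\<in>Pow L. \<Sum>I\<in>Pow K.
      (-1) ^ (card J * card (K - I)) * shuffle_sign I (K - I) * shuffle_sign J (L - J)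
      * Jop a I J x * Jop b (K - I) (L - J) x)"
    by (intro sum.cong refl) (simp add: sgn Jop_def)
  also have "\<dots> = (Jop a \<and>\<^sub>s Jop b) K L x"
    unfolding wedge_def by (rule sum.swap)
  finally show "Jop (a \<and>\<^sub>s b) K L x = (Jop a \<and>\<^sub>s Jop b) K L x" .
qed

lemma Jop_four: "Jop (Jop (Jop (Jop a))) = a"
  by (auto simp: Jop_def fun_eq_iff minus_one_power_iff)

definition ext_d :: "'n::{finite,linorder} superform \<Rightarrow> 'n superform" where
  "ext_d a = (\<lambda>I J x. \<Sum>k\<in>UNIV. (dx k \<and>\<^sub>s (\<lambda>I' J'. pd k (a I' J'))) I J x)"

text \<open>\<open>dx\<^sub>1 \<and> d\<xi>\<^sub>1 \<and> \<dots> \<and> dx\<^sub>n \<and> d\<xi>\<^sub>n\<close> equals \<open>dx\<^bsub>{1..n}\<^esub> \<and> d\<xi>\<^bsub>{1..n}\<^esub>\<close> times \<open>(-1)\<close> to the power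
  \<open>n (n - 1) / 2\<close>.\<close>

definition superintegral :: "'n::{finite,linorder} superform \<Rightarrow> real" where
  "superintegral a = (-1) ^ (CARD('n) * (CARD('n) - 1) div 2) * (LINT x|lborel. a UNIV UNIV x)"

lemma superintegral_Jop: "superintegral (Jop a) = superintegral a"
  by (simp add: superintegral_def Jop_def minus_one_power_iff)

lemma superintegral_Jop_wedge:
  "superintegral (Jop a \<and>\<^sub>s b) = superintegral (a \<and>\<^sub>s Jop (Jop (Jop b)))"
  by (metis Jop_four Jop_wedge superintegral_Jop)


section \<open>Supercurrents\<close>

definition supported_in :: "(real^'n::{finite,linorder}) set \<Rightarrow> 'n superform \<Rightarrow> bool" where
  "supported_in K a \<longleftrightarrow> (\<forall>I J x. x \<notin> K \<longrightarrow> a I J x = 0)"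

definition test_forms :: "(real^'n::{finite,linorder}) set \<Rightarrow> nat \<Rightarrow> nat \<Rightarrow> 'n superform set" where
  "test_forms D p q = {a. has_bidegree p q a \<and> (\<forall>I J. smooth_on UNIV (a I J)) \<and>
     (\<exists>K. compact K \<and> K \<subseteq> D \<and> supported_in K a)}"

type_synonym 'n supercurrent = "'n superform \<Rightarrow> real"

text \<open>Supercurrents of bidimension \<open>(p,q)\<close> on the open set \<open>D\<close>, as continuous linear functionals on the
  test forms of bidegree \<open>(p,q)\<close>; only the values on such forms are meaningful. Continuity
  is expressed by the usual estimates by \<open>C\<^sup>N\<close>-norms on each compact subset.\<close>

definition supercurrent ::
  "(real^'n::{finite,linorder}) set \<Rightarrow> nat \<Rightarrow> nat \<Rightarrow> 'n supercurrent \<Rightarrow> bool" where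
  "supercurrent D p q T \<longleftrightarrow>
     (\<forall>a\<in>test_forms D p q. \<forall>b\<in>test_forms D p q.
        T (\<lambda>I J x. a I J x + b I J x) = T a + T b) \<and>
     (\<forall>c. \<forall>a\<in>test_forms D p q. T (\<lambda>I J x. c * a I J x) = c * T a) \<and>
     (\<forall>K. compact K \<and> K \<subseteq> D \<longrightarrow>
        (\<exists>C N. \<forall>a\<in>test_forms D p q. \<forall>B. supported_in K a \<and>
           (\<forall>ks I J x. length ks \<le> N \<longrightarrow> \<bar>iterated_pd ks (a I J) x\<bar> \<le> B) \<longrightarrow>
           \<bar>T a\<bar> \<le> C * B))"

definition zero_current ::
  "(real^'n::{finite,linorder}) set \<Rightarrow> nat \<Rightarrow> nat \<Rightarrow> 'n supercurrent \<Rightarrow> bool" where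
  "zero_current D p q T \<longleftrightarrow> (\<forall>a\<in>test_forms D p q. T a = 0)"

text \<open>The operations on superforms are extended to supercurrents, viewed as superforms with
  distribution coefficients acting by \<open>T.\<alpha> = \<integral> T \<and> \<alpha>\<close>:
  \<open>(T \<and> b).\<alpha> = \<integral> T \<and> b \<and> \<alpha> = T.(b \<and> \<alpha>)\<close>;
  \<open>J(T).\<alpha> = \<integral> J(T) \<and> \<alpha> = \<integral> T \<and> J\<^sup>-\<^sup>1 \<alpha>\<close> as in lemma \<open>superintegral_Jop_wedge\<close>;
  and since distributional derivatives satisfy \<open>(\<partial>\<^sub>k u)(\<phi>) = - u(\<partial>\<^sub>k \<phi>)\<close>, the coefficientwise \<open>d\<close>
  satisfies \<open>dT.\<alpha> = - (-1)\<^bsup>s\<^esup> T.d\<alpha>\<close>, where \<open>s\<close> is the total degree of \<open>T\<close>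
  (\<open>dx\<^sub>k\<close> has to be moved past the basis form). For bidimension \<open>(p,q)\<close>, \<open>s = 2 n - p - q\<close>, which has
  the parity of \<open>p + q\<close>.\<close>

definition current_wedge ::
  "'n::{finite,linorder} supercurrent \<Rightarrow> 'n superform \<Rightarrow> 'n supercurrent" where
  "current_wedge T b = (\<lambda>a. T (b \<and>\<^sub>s a))"

definition current_J :: "'n::{finite,linorder} supercurrent \<Rightarrow> 'n supercurrent" where
  "current_J T = (\<lambda>a. T (Jop (Jop (Jop a))))"

definition current_d :: "nat \<Rightarrow> nat \<Rightarrow> 'n::{finite,linorder} supercurrent \<Rightarrow> 'n supercurrent" where
  "current_d p q T = (\<lambda>a. - ((-1) ^ (p + q)) * T (ext_d a))"

definition weakly_positive ::
  "(real^'n::{finite,linorder}) set \<Rightarrow> nat \<Rightarrow> 'n supercurrent \<Rightarrow> bool" where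
  "weakly_positive D m T \<longleftrightarrow>
     (\<forall>as. length as = m \<and> set as \<subseteq> test_forms D 1 0 \<longrightarrow>
        T (wedge_list (map (\<lambda>a. a \<and>\<^sub>s Jop a) as)) \<ge> 0)"

definition symmetric_current ::
  "(real^'n::{finite,linorder}) set \<Rightarrow> nat \<Rightarrow> 'n supercurrent \<Rightarrow> bool" where
  "symmetric_current D m T \<longleftrightarrow> (\<forall>a\<in>test_forms D m m. current_J T a = T a)"

text \<open>\<open>dT\<close> has bidimension \<open>(m-1,m)\<close>, hence \<open>dT \<and> \<beta>\<^bsup>m-1\<^esup>\<close> has bidimension \<open>(0,1)\<close>.\<close>

definition minimal_supercurrent ::
  "(real^'n::{finite,linorder}) set \<Rightarrow> nat \<Rightarrow> 'n supercurrent \<Rightarrow> bool" where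
  "minimal_supercurrent D m T \<longleftrightarrow>
     1 \<le> m \<and> m \<le> CARD('n) \<and> supercurrent D m m T \<and>
     weakly_positive D m T \<and> symmetric_current D m T \<and>
     zero_current D 0 1 (current_wedge (current_d m m T) (wedge_power beta (m - 1)))"

text \<open>The positive measure on \<open>D\<close> with which a positive supercurrent of bidegree \<open>(n,n)\<close> (bidimension
  \<open>(0,0)\<close>) is identified: the locally finite Borel measure on \<open>D\<close> representing it. It is
  unique, and for positive \<open>S\<close> it exists by the Riesz representation theorem.\<close>

definition measure_of_current ::
  "(real^'n::{finite,linorder}) set \<Rightarrow> 'n supercurrent \<Rightarrow> (real^'n::{finite,linorder}) measure" where
  "measure_of_current D S = (SOME \<mu>. sets \<mu> = sets (restrict_space borel D) \<and>
     (\<forall>K. compact K \<and> K \<subseteq> D \<longrightarrow> emeasure \<mu> K < \<infinity>) \<and>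
     (\<forall>f. fun_form f \<in> test_forms D 0 0 \<longrightarrow> S (fun_form f) = (LINT x|\<mu>. f x)))"

text \<open>The measure \<open>T \<and> \<beta>\<^sup>m / m!\<close>.\<close>

definition mass_measure ::
  "(real^'n::{finite,linorder}) set \<Rightarrow> nat \<Rightarrow> 'n supercurrent \<Rightarrow> (real^'n::{finite,linorder}) measure" where
  "mass_measure D m T = measure_of_current D
     (current_wedge T (\<lambda>I J x. wedge_power beta m I J x / fact m))"

definition current_density ::
  "(real^'n::{finite,linorder}) set \<Rightarrow> nat \<Rightarrow> 'n supercurrent \<Rightarrow> real^'n::{finite,linorder} \<Rightarrow> real" where
  "current_density D m T a = Lim (at_right 0) (\<lambda>r. measure (mass_measure D m T) (ball a r) / r ^ m)"

end

theory Submission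
  imports Defs "HOL-Library.Function_Algebras"
begin

text \<open>
  Let \<open>q\<close> be a subgradient of \<open>w\<close> at \<open>a\<close> and \<open>l x = w a + q \<bullet> (x - a)\<close>. The set \<open>C = {x. |x - a|\<^sup>m < l x}\<close> is
  convex, and since \<open>w \<ge> l\<close> on every segment from \<open>a\<close> inside \<open>D\<close>, the boundary values of \<open>w\<close> force
  \<open>C \<subseteq> D\<close>. So \<open>w\<close> may be replaced by the affine function \<open>l\<close>. Heuristically one tests minimality with the vector field
  \<open>(l r\<^sup>-\<^sup>m - 1) (x - a) + b q\<close> on \<open>C\<close>, where \<open>r = |x - a|\<close> and the function \<open>b\<close> of \<open>r\<close> and \<open>l\<close> vanishes
  on the boundary of \<open>C\<close> and satisfies \<open>\<partial>b/\<partial>r = - r\<^sup>1\<^sup>-\<^sup>m\<close>. Then the mixed terms in \<open>x - a\<close> and \<open>q\<close> of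
  the Jacobian are antisymmetric, hence invisible to the symmetric current, the terms in
  \<open>q \<otimes> q\<close> are nonnegative, and the remaining ones are bounded below by
  \<open>- m T \<and> \<beta>\<^sup>m/m!\<close> away from \<open>a\<close>, while the singularity at \<open>a\<close> contributes \<open>m l(a) \<gamma>\<^sub>T(a)\<close>.
  Smoothing this field gives, for the measure \<open>\<mu> = T \<and> \<beta>\<^sup>m/m!\<close>,
  \<open>\<mu>(B\<^sub>r) (l - r\<^sup>m) \<le> r\<^sup>m \<mu>(C)\<close> up to small errors. The case of constant \<open>l\<close> shows that the density
  exists; letting \<open>r \<rightarrow> 0\<close> gives the theorem.
\<close>

section \<open>Smooth families\<close>

text \<open>Origin of the field: in the Jacobian of \<open>\<phi> (x - a) + b q\<close>, with \<phi>
  and b functions of r and l, the mixed part is antisymmetric iff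
  \<open>\<partial>b/\<partial>r = - r \<partial>\<phi>/\<partial>l\<close>. For \<phi> = l r^-m - 1
  one has \<open>m \<phi> + r \<partial>\<phi>/\<partial>r = - m\<close>, so the powers of r cancel
  away from a. Then b is forced to be the integral of t^(1-m) from r to l^(1/m); it grows with l,
  whence the sign of the q-q term. The smoothing must keep the relation of b to \<phi> exact, since
  nothing else controls the mixed terms. So only two ingredients are replaced: r^m by a function
  \<Theta> bounded below near a, and the positive part of l - r^m by a smooth convex ramp. From
  \<phi> follows \<psi>, its derivative in l, and b is an integral of \<psi> in the variable r^2;
  hence the families with a parameter. Weak positivity tests only products of forms
  \<open>\<alpha> \<and> \<alpha>\<^sup>#\<close>. Every sign must come from a sum of such products,
  and a single factor \<open>|y|\<^sup>2 \<beta> - \<eta> \<and> \<eta>\<^sup>#\<close> would miss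
  the decisive constant m in the radial bound.\<close>

text \<open>Functions of \<open>x\<close> depending on a real parameter, smooth in \<open>x\<close> and with all derivatives
  jointly continuous, so that the parameter can be integrated out.\<close>

definition jsmooth :: "(real \<Rightarrow> real^'n::finite \<Rightarrow> real) \<Rightarrow> bool" where
  "jsmooth h \<longleftrightarrow> (\<forall>ks. (\<forall>t x. iterated_pd ks (h t) differentiable (at x)) \<and>
     continuous_on UNIV (\<lambda>z. iterated_pd ks (h (fst z)) (snd z)))"

lemma iterated_pd_Nil [simp]: "iterated_pd [] f = f"
  by (simp add: iterated_pd_def)

lemma iterated_pd_snoc: "iterated_pd (ks @ [k]) f = iterated_pd ks (pd k f)"
  by (simp add: iterated_pd_def)

text \<open>Smoothness is a greatest fixed point. All closure properties below are obtained by
  exhibiting a class stable under every \<open>pd k\<close>, so no higher Leibniz or chain formulas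
  occur.\<close>

lemma jsmooth_coinduct [consumes 1]:
  assumes "P h"
    and "\<And>h t x. P h \<Longrightarrow> h t differentiable (at x)"
    and "\<And>h. P h \<Longrightarrow> continuous_on UNIV (\<lambda>z. h (fst z) (snd z))"
    and "\<And>h k. P h \<Longrightarrow> P (\<lambda>t. pd k (h t))"
  shows "jsmooth h"
proof -
  have "(\<forall>t x. iterated_pd ks (h t) differentiable (at x)) \<and>
     continuous_on UNIV (\<lambda>z. iterated_pd ks (h (fst z)) (snd z))" if "P h" for ks h
    using that
  \<comment> \<open>\<open>iterated_pd\<close> is a \<open>foldr\<close>, so the derivative taken
    first is the last entry of the list.\<close>
  proof (induction ks arbitrary: h rule: rev_induct)
    case Nil
    then show ?case using assms(2,3) by simp
  next
    case (snoc k ks)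
    from snoc.IH[OF assms(4)[OF snoc.prems, of k]] show ?case unfolding iterated_pd_snoc .
  qed
  then show ?thesis using assms(1) by (simp add: jsmooth_def)
qed

lemma jsmooth_differentiable: "jsmooth h \<Longrightarrow> h t differentiable (at x)"
  unfolding jsmooth_def by (metis iterated_pd_Nil)

lemma jsmooth_continuous: "jsmooth h \<Longrightarrow> continuous_on UNIV (\<lambda>z. h (fst z) (snd z))"
  unfolding jsmooth_def by (metis (mono_tags, lifting) iterated_pd_Nil continuous_on_cong)

lemma jsmooth_pd: "jsmooth h \<Longrightarrow> jsmooth (\<lambda>t. pd k (h t))"
  unfolding jsmooth_def by (simp only: iterated_pd_snoc[symmetric]) blast

lemma smooth_on_iff_jsmooth: "smooth_on UNIV f \<longleftrightarrow> jsmooth (\<lambda>t. f)"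
proof
  assume f: "smooth_on UNIV f"
  have "continuous_on UNIV (\<lambda>z::real \<times> _. iterated_pd ks f (snd z))" for ks
  proof -
    have "continuous_on UNIV (iterated_pd ks f)"
      using f by (auto simp: smooth_on_def continuous_on_eq_continuous_at
          intro: differentiable_imp_continuous_within)
    then show ?thesis
      by (rule continuous_on_compose2) (auto intro: continuous_intros)
  qed
  then show "jsmooth (\<lambda>t. f)" using f by (auto simp: jsmooth_def smooth_on_def)
qed (auto simp: jsmooth_def smooth_on_def)

lemma pd_eqI: "(f has_derivative D) (at x) \<Longrightarrow> pd k f x = D (axis k 1)"
  unfolding pd_def using frechet_derivative_at by metis

lemma has_derivative_pd:
  "f differentiable (at x) \<Longrightarrow> (f has_derivative frechet_derivative f (at x)) (at x)"
  by (simp add: frechet_derivative_works)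

lemma pd_const [simp]: "pd k (\<lambda>x. c) = (\<lambda>x. 0)"
  by (rule ext) (simp add: pd_def)

lemma pd_add:
  assumes "f differentiable (at x)" "g differentiable (at x)"
  shows "pd k (\<lambda>x. f x + g x) x = pd k f x + pd k g x"
  using assms[THEN has_derivative_pd]
  by (subst pd_eqI[OF has_derivative_add]) (auto simp: pd_def)

lemma pd_mult:
  assumes "f differentiable (at x)" "g differentiable (at x)"
  shows "pd k (\<lambda>x. f x * g x) x = f x * pd k g x + pd k f x * g x"
  using assms[THEN has_derivative_pd]
  by (subst pd_eqI[OF has_derivative_mult]) (auto simp: pd_def)

lemma pd_compose:
  assumes "f differentiable (at x)" "(\<phi> has_real_derivative d) (at (f x))"
  shows "((\<lambda>x. \<phi> (f x)) has_derivative (\<lambda>h. d * frechet_derivative f (at x) h)) (at x)"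
    and "pd k (\<lambda>x. \<phi> (f x)) x = d * pd k f x"
proof -
  show *: "((\<lambda>x. \<phi> (f x)) has_derivative (\<lambda>h. d * frechet_derivative f (at x) h)) (at x)"
    using has_derivative_compose[OF has_derivative_pd[OF assms(1)] assms(2)[unfolded has_field_derivative_def]]
    by simp
  show "pd k (\<lambda>x. \<phi> (f x)) x = d * pd k f x"
    using pd_eqI[OF *] by (simp add: pd_def)
qed

text \<open>Smoothness of a function of one variable is witnessed by membership in such a class; unlike a
  sequence of derivatives, the class may be a linear span.\<close>

definition deriv_closed :: "real set \<Rightarrow> (real \<Rightarrow> real) set \<Rightarrow> bool" where
  "deriv_closed U G \<longleftrightarrow> open U \<and> (\<forall>g\<in>G. \<exists>g'\<in>G. \<forall>u\<in>U. (g has_real_derivative g' u) (at u))"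

text \<open>The derivative of a product is a sum of products, so products alone are not stable under
  \<open>pd k\<close>; the algebra generated by smooth families and compositions is.\<close>

inductive jalg :: "(real \<Rightarrow> real^'n::finite \<Rightarrow> real) \<Rightarrow> bool" where
  base: "jsmooth h \<Longrightarrow> jalg h"
| add: "jalg f \<Longrightarrow> jalg g \<Longrightarrow> jalg (\<lambda>t x. f t x + g t x)"
| mult: "jalg f \<Longrightarrow> jalg g \<Longrightarrow> jalg (\<lambda>t x. f t x * g t x)"
| comp: "deriv_closed U G \<Longrightarrow> \<phi> \<in> G \<Longrightarrow> jsmooth f \<Longrightarrow> (\<And>t x. f t x \<in> U) \<Longrightarrow>
    jalg (\<lambda>t x. \<phi> (f t x))"

lemma jalg_closed:
  assumes "jalg h"
  shows "(\<forall>t x. h t differentiable (at x)) \<and> continuous_on UNIV (\<lambda>z. h (fst z) (snd z)) \<and>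
    (\<forall>k. jalg (\<lambda>t. pd k (h t)))"
  using assms
proof induction
  case (base h)
  then show ?case
    by (auto intro: jsmooth_differentiable jsmooth_continuous jsmooth_pd jalg.base)
next
  case (add f g)
  have "(\<lambda>t. pd k (\<lambda>x. f t x + g t x)) = (\<lambda>t x. pd k (f t) x + pd k (g t) x)" for k
    using add by (auto simp: fun_eq_iff pd_add)
  then show ?case using add by (auto intro: jalg.add continuous_intros differentiable_add)
next
  case (mult f g)
  have "(\<lambda>t. pd k (\<lambda>x. f t x * g t x)) = (\<lambda>t x. f t x * pd k (g t) x + pd k (f t) x * g t x)" for k
    using mult by (auto simp: fun_eq_iff pd_mult)
  then show ?case using mult
    by (auto intro!: jalg.add jalg.mult continuous_intros differentiable_mult)
next
  case (comp U G \<phi> f)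
  then obtain \<phi>' where \<phi>': "\<phi>' \<in> G" "\<And>u. u \<in> U \<Longrightarrow> (\<phi> has_real_derivative \<phi>' u) (at u)"
    unfolding deriv_closed_def by blast
  have d: "f t differentiable (at x)" for t x using comp by (auto intro: jsmooth_differentiable)
  note * = pd_compose[OF d \<phi>'(2)[OF comp(4)]]
  have "(\<lambda>t. pd k (\<lambda>x. \<phi> (f t x))) = (\<lambda>t x. \<phi>' (f t x) * pd k (f t) x)" for k
    using *(2) by (auto simp: fun_eq_iff)
  moreover have "jalg (\<lambda>t x. \<phi>' (f t x) * pd k (f t) x)" for k
    using comp \<phi>' by (intro jalg.mult jalg.comp[of U G] jalg.base jsmooth_pd)
  moreover have "continuous_on U \<phi>"
    using \<phi>'(2) by (meson DERIV_isCont continuous_at_imp_continuous_on)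
  then have "continuous_on UNIV (\<lambda>z. \<phi> (f (fst z) (snd z)))"
    using comp(4) by (intro continuous_on_compose2[OF _ jsmooth_continuous[OF comp(3)]]) auto
  moreover have "(\<lambda>x. \<phi> (f t x)) differentiable (at x)" for t x
    using *(1) unfolding differentiable_def by blast
  ultimately show ?case by simp
qed

lemma jalg_jsmooth: "jalg h \<Longrightarrow> jsmooth h"
  by (rule jsmooth_coinduct[of jalg]) (auto dest: jalg_closed)

lemma jsmooth_add: "jsmooth f \<Longrightarrow> jsmooth g \<Longrightarrow> jsmooth (\<lambda>t x. f t x + g t x)"
  and jsmooth_mult: "jsmooth f \<Longrightarrow> jsmooth g \<Longrightarrow> jsmooth (\<lambda>t x. f t x * g t x)"
  by (auto intro: jalg_jsmooth jalg.intros)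

lemma jsmooth_comp:
  assumes "deriv_closed U G" "\<phi> \<in> G" "jsmooth f" "\<And>t x. f t x \<in> U"
  shows "jsmooth (\<lambda>t x. \<phi> (f t x))"
  using assms by (auto intro: jalg_jsmooth jalg.comp)

lemma jsmooth_fun_of_t:
  assumes "continuous_on UNIV c" shows "jsmooth (\<lambda>t x. c t)"
proof (rule jsmooth_coinduct[of "\<lambda>h. \<exists>c. continuous_on UNIV c \<and> h = (\<lambda>t x. c t)"])
  fix h :: "real \<Rightarrow> real^'n::finite \<Rightarrow> real"
  assume "\<exists>c. continuous_on UNIV c \<and> h = (\<lambda>t x. c t)"
  then obtain c where c: "continuous_on UNIV c" "h = (\<lambda>t x. c t)" by blast
  show "continuous_on UNIV (\<lambda>z. h (fst z) (snd z))"
    unfolding c(2) by (rule continuous_on_compose2[OF c(1)]) (auto intro: continuous_intros)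
  show "\<exists>c. continuous_on UNIV c \<and> (\<lambda>t. pd k (h t)) = (\<lambda>t x. c t)" for k
    unfolding c(2) by (intro exI[of _ "\<lambda>_. 0"]) auto
qed (use assms in auto)

lemma jsmooth_const: "jsmooth (\<lambda>t x. c)"
  by (rule jsmooth_fun_of_t) auto

lemma jsmooth_linear:
  assumes "bounded_linear f" shows "jsmooth (\<lambda>t. f)"
proof (rule jsmooth_coinduct[of "\<lambda>h. (\<exists>f. bounded_linear f \<and> h = (\<lambda>t. f)) \<or> (\<exists>c. h = (\<lambda>t x. c))"])
  fix h :: "real \<Rightarrow> real^'n::finite \<Rightarrow> real"
  assume h: "(\<exists>f. bounded_linear f \<and> h = (\<lambda>t. f)) \<or> (\<exists>c. h = (\<lambda>t x. c))"
  then show "h t differentiable (at x)" for t x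
    by (auto intro: linear_imp_differentiable bounded_linear.linear)
  show "continuous_on UNIV (\<lambda>z. h (fst z) (snd z))"
    using h by (auto intro!: continuous_intros intro: bounded_linear.continuous_on)
  show "(\<exists>f. bounded_linear f \<and> (\<lambda>t. pd k (h t)) = (\<lambda>t. f)) \<or> (\<exists>c. (\<lambda>t. pd k (h t)) = (\<lambda>t x. c))" for k
    using h
  proof
    assume "\<exists>f. bounded_linear f \<and> h = (\<lambda>t. f)"
    then obtain f where f: "bounded_linear f" "h = (\<lambda>t. f)" by blast
    have "pd k f x = f (axis k 1)" for x
      by (rule pd_eqI) (rule bounded_linear_imp_has_derivative[OF f(1)])
    then have "(\<lambda>t. pd k (h t)) = (\<lambda>t x. f (axis k 1))" unfolding f(2) by blast
    then show ?thesis by blast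
  next
    assume "\<exists>c. h = (\<lambda>t x. c)"
    then have "(\<lambda>t. pd k (h t)) = (\<lambda>t x. 0)" by auto
    then show ?thesis by blast
  qed
qed (use assms in auto)

text \<open>Joint continuity of the partial derivatives in (t, x) allows differentiation under the
  integral sign. The derivative is again such an integral, so these integrals form a class for
  \<open>jsmooth_coinduct\<close>; they are constant in their own parameter s.\<close>

lemma jsmooth_integral:
  assumes "jsmooth h"
  shows "jsmooth (\<lambda>s x. integral {0..1} (\<lambda>t. h t x))"
    and "pd k (\<lambda>x. integral {0..1} (\<lambda>t. h t x)) x = integral {0..1} (\<lambda>t. pd k (h t) x)"
proof -
  have cont: "continuous_on {0..1} (\<lambda>t. h t x)" if "jsmooth h" for h :: "real \<Rightarrow> real^'n::finite \<Rightarrow> real" and x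
    using continuous_on_compose2[OF jsmooth_continuous[OF that], of "{0..1}" "\<lambda>t. (t, x)"]
    by (simp add: continuous_on_Pair)
  have fr: "frechet_derivative (h t) (at x) v = (\<Sum>k\<in>UNIV. v $ k * pd k (h t) x)"
    if "jsmooth h" for h :: "real \<Rightarrow> real^'n::finite \<Rightarrow> real" and t x v
  proof -
    let ?D = "frechet_derivative (h t) (at x)"
    have lin: "linear ?D"
      by (intro linear_frechet_derivative jsmooth_differentiable that)
    have "?D (\<Sum>k\<in>UNIV. v $ k *\<^sub>R axis k 1) = (\<Sum>k\<in>UNIV. v $ k * ?D (axis k 1))"
      by (simp add: linear_sum[OF lin] linear_scale[OF lin])
    then show ?thesis
      unfolding pd_def basis_expansion[of v, unfolded scalar_mult_eq_scaleR] .
  qed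
  have int: "((\<lambda>x. integral {0..1} (\<lambda>t. h t x)) has_derivative
       (\<lambda>v. \<Sum>k\<in>UNIV. v $ k * integral {0..1} (\<lambda>t. pd k (h t) x))) (at x)"
    if h: "jsmooth h" for h :: "real \<Rightarrow> real^'n::finite \<Rightarrow> real" and x
  proof -
    \<comment> \<open>The gradient acts through the inner product, so continuity of the
      operator-valued derivative reduces to that of finitely many partial derivatives.\<close>
    define D where "D = (\<lambda>x t. blinfun_inner_left (\<chi> k. pd k (h t) x))"
    have D: "blinfun_apply (D x t) v = (\<Sum>k\<in>UNIV. v $ k * pd k (h t) x)" for x t v
      by (simp add: D_def inner_vec_def mult.commute)
    have "continuous_on UNIV (\<lambda>z. D (fst z) (snd z))"
    proof -
      have "continuous_on UNIV (\<lambda>z::(real^'n) \<times> real. pd k (h (snd z)) (fst z))" for k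
        using continuous_on_compose2[OF jsmooth_continuous[OF jsmooth_pd[OF h, of k]],
            of UNIV "\<lambda>z. (snd z, fst z)"]
        by (simp add: continuous_on_Pair continuous_on_fst continuous_on_snd continuous_on_id)
      then have "continuous_on UNIV (\<lambda>z::(real^'n) \<times> real. \<chi> k. pd k (h (snd z)) (fst z))"
        by (auto intro: continuous_on_vec_lambda)
      then show ?thesis unfolding D_def
        by (rule bounded_linear.continuous_on[OF bounded_linear_blinfun_inner_left])
    qed
    then have cD: "continuous_on (UNIV \<times> cbox 0 1) (\<lambda>(x, t). D x t)"
      by (auto simp: split_beta intro: continuous_on_subset)
    have "((\<lambda>x. integral (cbox 0 1) (\<lambda>t. h t x)) has_derivative integral (cbox 0 1) (D x)) (at x within UNIV)"
    proof (rule leibniz_rule[where fx = D])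
      show "((\<lambda>x. h t x) has_derivative blinfun_apply (D x t)) (at x within UNIV)" for x t
        using has_derivative_pd[OF jsmooth_differentiable[OF h, of t x]]
        by (rule has_derivative_eq_rhs) (auto simp: fun_eq_iff D fr[OF h])
      show "(\<lambda>t. h t x) integrable_on cbox 0 1" for x
        using cont[OF h] by (auto intro: integrable_continuous_interval)
    qed (use cD in auto)
    moreover have "blinfun_apply (integral (cbox 0 1) (D x)) v =
        (\<Sum>k\<in>UNIV. v $ k * integral {0..1} (\<lambda>t. pd k (h t) x))" for v
    proof -
      have "D x integrable_on cbox 0 1"
      proof (rule integrable_continuous)
        have "continuous_on (cbox 0 1) (\<lambda>t. (x, t))" by (intro continuous_intros)
        from continuous_on_compose2[OF cD this] show "continuous_on (cbox 0 1) (D x)" by auto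
      qed
      then have "blinfun_apply (integral (cbox 0 1) (D x)) v = integral (cbox 0 1) (\<lambda>t. D x t v)"
        by (rule blinfun_apply_integral)
      also have "\<dots> = (\<Sum>k\<in>UNIV. v $ k * integral {0..1} (\<lambda>t. pd k (h t) x))"
        unfolding D using cont[OF jsmooth_pd[OF h]]
        by (subst integral_sum) (auto intro!: integrable_continuous_interval continuous_intros)
      finally show ?thesis .
    qed
    then have "blinfun_apply (integral (cbox 0 1) (D x)) =
        (\<lambda>v. \<Sum>k\<in>UNIV. v $ k * integral {0..1} (\<lambda>t. pd k (h t) x))" by (rule ext)
    ultimately show ?thesis by simp
  qed
  have pd: "pd k (\<lambda>x. integral {0..1} (\<lambda>t. h t x)) x = integral {0..1} (\<lambda>t. pd k (h t) x)"
    if h: "jsmooth h" for h :: "real \<Rightarrow> real^'n::finite \<Rightarrow> real" and x k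
    by (subst pd_eqI[OF int[OF h]]) (simp add: axis_def if_distrib[of "\<lambda>c. c * _"] cong: if_cong)
  show "pd k (\<lambda>x. integral {0..1} (\<lambda>t. h t x)) x = integral {0..1} (\<lambda>t. pd k (h t) x)"
    by (rule pd[OF assms])
  let ?P = "\<lambda>g. \<exists>h. jsmooth h \<and> g = (\<lambda>(s::real) x. integral {0..1} (\<lambda>t. h t x))"
  show "jsmooth (\<lambda>s x. integral {0..1} (\<lambda>t. h t x))"
  proof (rule jsmooth_coinduct[of ?P])
    fix g :: "real \<Rightarrow> real^'n::finite \<Rightarrow> real" assume "?P g"
    then obtain h where h: "jsmooth h" "g = (\<lambda>s x. integral {0..1} (\<lambda>t. h t x))" by blast
    show d: "g t differentiable (at x)" for t x
      using int[OF h(1)] h(2) by (auto simp: differentiable_def)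
    have "continuous_on UNIV (g 0)"
      using d by (auto simp: continuous_on_eq_continuous_at intro: differentiable_imp_continuous_within)
    then show "continuous_on UNIV (\<lambda>z. g (fst z) (snd z))"
      unfolding h(2) by (rule continuous_on_compose2) (auto intro: continuous_intros)
    show "?P (\<lambda>t. pd k (g t))" for k
      unfolding h(2) by (intro exI[of _ "\<lambda>t. pd k (h t)"] conjI jsmooth_pd h(1) ext pd)
  qed (use assms in auto)
qed

section \<open>Flat functions and compositions with functions of one variable\<close>

definition flat :: "real \<Rightarrow> nat \<Rightarrow> real \<Rightarrow> real" where
  "flat \<kappa> k u = (if u \<le> 0 then 0 else exp (- \<kappa> / u) / u ^ k)"

lemma flat_nonneg: "0 \<le> flat \<kappa> k u"
  by (simp add: flat_def)

lemma flat_pos: "0 < u \<Longrightarrow> 0 < flat \<kappa> k u"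
  by (simp add: flat_def)

lemma flat_nonpos [simp]: "u \<le> 0 \<Longrightarrow> flat \<kappa> k u = 0"
  by (simp add: flat_def)

text \<open>With y = \<kappa> / h the quotient is a multiple of y^(k+1) / exp y for h > 0. It is the
  difference quotient at 0, the only point where differentiability of \<open>flat\<close> is in
  doubt.\<close>

lemma flat_quotient_tendsto_0:
  assumes "0 < \<kappa>"
  shows "((\<lambda>h. flat \<kappa> k h / h) \<longlongrightarrow> 0) (at 0)"
proof -
  have "((\<lambda>y. (inverse \<kappa>) ^ Suc k * (y ^ Suc k / exp y)) \<longlongrightarrow> (inverse \<kappa>) ^ Suc k * 0) at_top"
    by (intro tendsto_intros tendsto_power_div_exp_0)
  moreover have "filterlim (\<lambda>h. \<kappa> * inverse h) at_top (at_right (0::real))"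
    using assms filterlim_inverse_at_top_right
    by (intro filterlim_tendsto_pos_mult_at_top[OF tendsto_const]) auto
  ultimately have "((\<lambda>h. (inverse \<kappa>) ^ Suc k * ((\<kappa> * inverse h) ^ Suc k / exp (\<kappa> * inverse h)))
      \<longlongrightarrow> (inverse \<kappa>) ^ Suc k * 0) (at_right 0)"
    by (rule filterlim_compose)
  moreover have "eventually (\<lambda>h. (inverse \<kappa>) ^ Suc k * ((\<kappa> * inverse h) ^ Suc k / exp (\<kappa> * inverse h))
      = flat \<kappa> k h / h) (at_right 0)"
  proof (rule eventually_at_rightI[of 0 1])
    fix h :: real assume "h \<in> {0<..<1}"
    then have h: "0 < h" by simp
    have "(inverse \<kappa>) ^ Suc k * (\<kappa> * inverse h) ^ Suc k = (inverse \<kappa> * (\<kappa> * inverse h)) ^ Suc k"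
      by (rule power_mult_distrib[symmetric])
    also have "inverse \<kappa> * (\<kappa> * inverse h) = inverse h"
      using assms by simp
    also have "inverse h ^ Suc k = inverse (h ^ k * h)"
      by (simp add: power_inverse mult.commute)
    finally have "(inverse \<kappa>) ^ Suc k * (\<kappa> * inverse h) ^ Suc k = inverse (h ^ k * h)" .
    moreover have "exp (- \<kappa> / h) = inverse (exp (\<kappa> * inverse h))"
      by (simp add: exp_minus divide_inverse)
    ultimately show "(inverse \<kappa>) ^ Suc k * ((\<kappa> * inverse h) ^ Suc k / exp (\<kappa> * inverse h)) = flat \<kappa> k h / h"
      using h by (simp only: flat_def not_le[symmetric] if_False if_not_P times_divide_eq_right)
        (simp add: divide_inverse mult_ac)
  qed simp
  ultimately have r: "((\<lambda>h. flat \<kappa> k h / h) \<longlongrightarrow> 0) (at_right 0)"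
    by (simp add: tendsto_cong)
  have "((\<lambda>h. flat \<kappa> k h / h) \<longlongrightarrow> 0) (at_left 0)"
    by (rule tendsto_eventually, rule eventually_at_leftI[of "-1"]) auto
  with r show ?thesis by (simp add: filterlim_at_split)
qed

lemma DERIV_flat:
  assumes "0 < \<kappa>"
  shows "(flat \<kappa> k has_real_derivative (\<kappa> * flat \<kappa> (k + 2) u + (- real k) * flat \<kappa> (k + 1) u)) (at u)"
proof (cases u "0::real" rule: linorder_cases)
  case less
  have "((\<lambda>u. 0) has_real_derivative (\<kappa> * flat \<kappa> (k + 2) u + (- real k) * flat \<kappa> (k + 1) u)) (at u)"
    using less by simp
  then show ?thesis
    by (rule has_field_derivative_transform_within_open[of _ _ _ "{..<0}"]) (use less in auto)
next
  case equal
  show ?thesis using flat_quotient_tendsto_0[OF assms, of k]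
    by (simp add: equal has_field_derivative_iff)
next
  case greater
  have "((\<lambda>u. exp (- \<kappa> / u) / u ^ k) has_real_derivative
      (\<kappa> * flat \<kappa> (k + 2) u + (- real k) * flat \<kappa> (k + 1) u)) (at u)"
  proof (cases k)
    case 0
    then show ?thesis using greater
      by (auto intro!: derivative_eq_intros simp: flat_def power2_eq_square)
  next
    case (Suc j)
    have "((\<lambda>u. exp (- \<kappa> / u) * inverse (u ^ k)) has_real_derivative
        exp (- \<kappa> / u) * (\<kappa> / u\<^sup>2) * inverse (u ^ k) + exp (- \<kappa> / u) * (- (real k * u ^ (k - 1)) * (inverse (u ^ k))\<^sup>2)) (at u)"
      using greater
      by (auto intro!: derivative_eq_intros simp: power2_eq_square field_simps)
    moreover have e1: "exp (- \<kappa> / u) * (\<kappa> / u\<^sup>2) * inverse (u ^ k) = \<kappa> * flat \<kappa> (k + 2) u"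
      using greater by (simp add: flat_def field_simps power2_eq_square)
    moreover have e2: "exp (- \<kappa> / u) * (- (real k * u ^ (k - 1)) * (inverse (u ^ k))\<^sup>2) = - real k * flat \<kappa> (k + 1) u"
      using greater by (simp add: flat_def field_simps power2_eq_square Suc)
    ultimately show ?thesis unfolding e1 e2 by (simp only: divide_inverse[symmetric])
  qed
  then show ?thesis
    by (rule has_field_derivative_transform_within_open[of _ _ _ "{0<..}"])
      (use greater in \<open>auto simp: flat_def\<close>)
qed

inductive_set flats :: "real \<Rightarrow> (real \<Rightarrow> real) set" for \<kappa> where
  base: "flat \<kappa> k \<in> flats \<kappa>"
| add: "f \<in> flats \<kappa> \<Longrightarrow> g \<in> flats \<kappa> \<Longrightarrow> (\<lambda>u. f u + g u) \<in> flats \<kappa>"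
| scale: "f \<in> flats \<kappa> \<Longrightarrow> (\<lambda>u. c * f u) \<in> flats \<kappa>"

lemma deriv_closed_flats:
  assumes "0 < \<kappa>" shows "deriv_closed UNIV (flats \<kappa>)"
proof -
  have "\<exists>g'\<in>flats \<kappa>. \<forall>u. (g has_real_derivative g' u) (at u)" if "g \<in> flats \<kappa>" for g
    using that
  proof induction
    case (base k)
    show ?case
    proof (rule bexI[of _ "\<lambda>u. \<kappa> * flat \<kappa> (k + 2) u + (- real k) * flat \<kappa> (k + 1) u"])
      show "\<forall>u. (flat \<kappa> k has_real_derivative \<kappa> * flat \<kappa> (k + 2) u + (- real k) * flat \<kappa> (k + 1) u) (at u)"
        using DERIV_flat[OF assms] by blast
    qed (intro flats.intros)
  next
    case (add f g)
    then obtain f' g' where "f' \<in> flats \<kappa>" "\<forall>u. (f has_real_derivative f' u) (at u)"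
      "g' \<in> flats \<kappa>" "\<forall>u. (g has_real_derivative g' u) (at u)" by blast
    then show ?case
      by (intro bexI[of _ "\<lambda>u. f' u + g' u"]) (auto intro!: flats.add derivative_intros)
  next
    case (scale f c)
    then obtain f' where "f' \<in> flats \<kappa>" "\<forall>u. (f has_real_derivative f' u) (at u)" by blast
    then show ?case
      by (intro bexI[of _ "\<lambda>u. c * f' u"]) (auto intro!: flats.scale derivative_eq_intros)
  qed
  then show ?thesis by (simp add: deriv_closed_def)
qed

lemma deriv_closed_powr: "deriv_closed {0<..} {\<lambda>u. c * u powr s | c s. True}"
  unfolding deriv_closed_def
proof (intro conjI ballI)
  fix g :: "real \<Rightarrow> real" assume "g \<in> {\<lambda>u. c * u powr s | c s. True}"
  then obtain c s where g: "g = (\<lambda>u. c * u powr s)" by blast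
  show "\<exists>g'\<in>{\<lambda>u. c * u powr s | c s. True}. \<forall>u\<in>{0<..}. (g has_real_derivative g' u) (at u)"
  proof (rule bexI)
    show "\<forall>u\<in>{0<..}. (g has_real_derivative (c * s) * u powr (s - 1)) (at u)"
      unfolding g by (auto intro!: derivative_eq_intros has_real_derivative_powr simp: mult.assoc)
  qed blast
qed simp

lemma jsmooth_flat:
  assumes "0 < \<kappa>" "jsmooth f" shows "jsmooth (\<lambda>t x. flat \<kappa> k (f t x))"
  by (rule jsmooth_comp[OF deriv_closed_flats[OF assms(1)] flats.base assms(2)]) simp

lemma jsmooth_powr:
  assumes "jsmooth f" "\<And>t x. 0 < f t x" shows "jsmooth (\<lambda>t x. f t x powr s)"
proof -
  have "(\<lambda>u. 1 * u powr s) \<in> {\<lambda>u. c * u powr s | c s. True}" by blast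
  from jsmooth_comp[OF deriv_closed_powr this assms(1)] assms(2) show ?thesis by simp
qed

lemma jsmooth_cmult: "jsmooth f \<Longrightarrow> jsmooth (\<lambda>t x. c * f t x)"
  by (intro jsmooth_mult jsmooth_const)

lemma jsmooth_minus: "jsmooth f \<Longrightarrow> jsmooth (\<lambda>t x. - f t x)"
  using jsmooth_cmult[of f "-1"] by simp

lemma jsmooth_diff: "jsmooth f \<Longrightarrow> jsmooth g \<Longrightarrow> jsmooth (\<lambda>t x. f t x - g t x)"
  using jsmooth_add[OF _ jsmooth_minus, of f g] by simp

lemma jsmooth_power: "jsmooth f \<Longrightarrow> jsmooth (\<lambda>t x. f t x ^ k)"
  by (induction k) (auto intro: jsmooth_mult jsmooth_const)

lemma jsmooth_sum: "(\<And>i. i \<in> I \<Longrightarrow> jsmooth (f i)) \<Longrightarrow> jsmooth (\<lambda>t x. \<Sum>i\<in>I. f i t x)"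
  by (induction I rule: infinite_finite_induct) (auto intro: jsmooth_add jsmooth_const)

lemma jsmooth_divide:
  assumes "jsmooth f" "jsmooth g" "\<And>t x. 0 < g t x" shows "jsmooth (\<lambda>t x. f t x / g t x)"
proof -
  have "g t x powr (-1) = inverse (g t x)" for t x
    using assms(3)[of t x] by (simp add: powr_minus)
  then show ?thesis
    using jsmooth_mult[OF assms(1) jsmooth_powr[OF assms(2,3), of "-1"]] by (simp add: divide_inverse)
qed

lemma jsmooth_component: "jsmooth (\<lambda>t x. x $ i)"
  by (rule jsmooth_linear) (rule bounded_linear_vec_nth)

lemma jsmooth_norm_sq: "jsmooth (\<lambda>t x. (norm (x - p))\<^sup>2)"
proof -
  have "(norm (x - p))\<^sup>2 = (\<Sum>i\<in>UNIV. (x $ i - p $ i) ^ 2)" for x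
    unfolding power2_norm_eq_inner by (simp add: inner_vec_def power2_eq_square)
  then show ?thesis
    by (simp add: jsmooth_sum jsmooth_power jsmooth_diff jsmooth_component jsmooth_const)
qed

lemmas jsmooth_intros = jsmooth_add jsmooth_mult jsmooth_minus jsmooth_diff jsmooth_power
  jsmooth_sum jsmooth_component jsmooth_norm_sq jsmooth_const

section \<open>Smooth functions without parameter\<close>

abbreviation smooth :: "(real^'n::finite \<Rightarrow> real) \<Rightarrow> bool" where
  "smooth \<equiv> smooth_on UNIV"

lemma smooth_add: "smooth f \<Longrightarrow> smooth g \<Longrightarrow> smooth (\<lambda>x. f x + g x)"
  and smooth_mult: "smooth f \<Longrightarrow> smooth g \<Longrightarrow> smooth (\<lambda>x. f x * g x)"
  and smooth_minus: "smooth f \<Longrightarrow> smooth (\<lambda>x. - f x)"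
  and smooth_diff: "smooth f \<Longrightarrow> smooth g \<Longrightarrow> smooth (\<lambda>x. f x - g x)"
  and smooth_power: "smooth f \<Longrightarrow> smooth (\<lambda>x. f x ^ l)"
  and smooth_const: "smooth (\<lambda>x. c)"
  and smooth_component: "smooth (\<lambda>x. x $ i)"
  and smooth_norm_sq: "smooth (\<lambda>x. (norm (x - p))\<^sup>2)"
  and smooth_flat: "0 < \<kappa> \<Longrightarrow> smooth f \<Longrightarrow> smooth (\<lambda>x. flat \<kappa> j (f x))"
  unfolding smooth_on_iff_jsmooth
  by (intro jsmooth_intros jsmooth_flat; assumption)+

lemma smooth_sum: "(\<And>i. i \<in> I \<Longrightarrow> smooth (f i)) \<Longrightarrow> smooth (\<lambda>x. \<Sum>i\<in>I. f i x)"
  and smooth_powr: "smooth g \<Longrightarrow> (\<And>x. 0 < g x) \<Longrightarrow> smooth (\<lambda>x. g x powr s)"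
  and smooth_divide: "smooth g' \<Longrightarrow> smooth g \<Longrightarrow> (\<And>x. 0 < g x) \<Longrightarrow> smooth (\<lambda>x. g' x / g x)"
  unfolding smooth_on_iff_jsmooth
  by (intro jsmooth_sum jsmooth_powr jsmooth_divide; assumption)+

lemmas smooth_intros = smooth_add smooth_mult smooth_minus smooth_diff smooth_power
  smooth_sum smooth_component smooth_norm_sq smooth_const

lemma smooth_differentiable: "smooth f \<Longrightarrow> f differentiable (at x)"
  unfolding smooth_on_iff_jsmooth by (rule jsmooth_differentiable)

lemma smooth_continuous: "smooth f \<Longrightarrow> continuous_on S f"
  by (meson continuous_at_imp_continuous_on differentiable_imp_continuous_within smooth_differentiable)

section \<open>Test functions\<close>

definition testfun :: "(real^'n::finite) set \<Rightarrow> (real^'n \<Rightarrow> real) \<Rightarrow> bool" where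
  "testfun D f \<longleftrightarrow> smooth f \<and> (\<exists>K. compact K \<and> K \<subseteq> D \<and> (\<forall>x. x \<notin> K \<longrightarrow> f x = 0))"

lemma testfun_smooth: "testfun D f \<Longrightarrow> smooth f"
  by (simp add: testfun_def)

lemma testfun_outside: "testfun D f \<Longrightarrow> x \<notin> D \<Longrightarrow> f x = 0"
  unfolding testfun_def by blast

lemma testfun_subset: "testfun D f \<Longrightarrow> D \<subseteq> D' \<Longrightarrow> testfun D' f"
  unfolding testfun_def by blast

lemma testfunI:
  "smooth f \<Longrightarrow> compact K \<Longrightarrow> K \<subseteq> D \<Longrightarrow> (\<And>x. x \<notin> K \<Longrightarrow> f x = 0) \<Longrightarrow> testfun D f"
  unfolding testfun_def by blast

lemma testfun_add: "testfun D f \<Longrightarrow> testfun D g \<Longrightarrow> testfun D (\<lambda>x. f x + g x)"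
proof -
  assume "testfun D f" "testfun D g"
  then obtain K L where "smooth f" "smooth g" "compact K" "K \<subseteq> D" "\<forall>x. x \<notin> K \<longrightarrow> f x = 0"
      "compact L" "L \<subseteq> D" "\<forall>x. x \<notin> L \<longrightarrow> g x = 0"
    unfolding testfun_def by blast
  then show ?thesis by (intro testfunI[of _ "K \<union> L"] smooth_add) auto
qed

lemma testfun_mult: "testfun D f \<Longrightarrow> smooth g \<Longrightarrow> testfun D (\<lambda>x. f x * g x)"
  unfolding testfun_def by (metis mult_zero_left smooth_mult)

lemma testfun_mult': "smooth g \<Longrightarrow> testfun D f \<Longrightarrow> testfun D (\<lambda>x. g x * f x)"
  using testfun_mult[of D f g] by (simp add: mult.commute)

lemma testfun_cmult: "testfun D f \<Longrightarrow> testfun D (\<lambda>x. c * f x)"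
  by (rule testfun_mult'[OF smooth_const])

lemma testfun_minus: "testfun D f \<Longrightarrow> testfun D (\<lambda>x. - f x)"
  using testfun_cmult[of D f "-1"] by simp

lemma testfun_diff: "testfun D f \<Longrightarrow> testfun D g \<Longrightarrow> testfun D (\<lambda>x. f x - g x)"
  using testfun_add[OF _ testfun_minus, of D f g] by simp

lemma testfun_zero: "testfun D (\<lambda>x. 0)"
  by (intro testfunI[of _ "{}"] smooth_const) auto

lemma testfun_sum: "(\<And>i. i \<in> I \<Longrightarrow> testfun D (f i)) \<Longrightarrow> testfun D (\<lambda>x. \<Sum>i\<in>I. f i x)"
  by (induction I rule: infinite_finite_induct) (auto intro: testfun_add testfun_zero)

lemma testfun_integrable:
  assumes "testfun D f" "f \<in> borel_measurable M"
    and M: "\<And>K. compact K \<Longrightarrow> K \<subseteq> D \<Longrightarrow> K \<in> sets M \<and> emeasure M K < \<infinity>"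
  shows "integrable M f"
proof -
  obtain K where K: "compact K" "K \<subseteq> D" "\<And>x. x \<notin> K \<Longrightarrow> f x = 0"
    using assms(1) by (auto simp: testfun_def)
  have "bounded (f ` K)"
    using K(1) testfun_smooth[OF assms(1)]
    by (intro compact_imp_bounded compact_continuous_image smooth_continuous)
  then obtain B where "\<And>x. x \<in> K \<Longrightarrow> norm (f x) \<le> B" by (auto simp: bounded_iff)
  then show ?thesis
    using K(3) M[OF K(1,2)] assms(2) by (intro integrableI_bounded_set[of K]) auto
qed

lemma testfun_borel_measurable: "testfun D f \<Longrightarrow> f \<in> borel_measurable borel"
  by (intro borel_measurable_continuous_onI smooth_continuous testfun_smooth)

lemma smooth_step:
  assumes "smooth f"
  obtains g where "smooth g" "\<And>x. 0 \<le> g x" "\<And>x. g x \<le> 1" "\<And>x. f x \<le> 0 \<Longrightarrow> g x = 0"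
    "\<And>x. 1 \<le> f x \<Longrightarrow> g x = 1"
proof
  let ?g = "\<lambda>x. flat 1 0 (f x) / (flat 1 0 (f x) + flat 1 0 (1 - f x))"
  have pos: "0 < flat 1 0 (f x) + flat 1 0 (1 - f x)" for x
  proof (cases "0 < f x")
    case True
    then show ?thesis using flat_pos[of "f x" 1 0] flat_nonneg[of 1 0 "1 - f x"] by linarith
  next
    case False
    then show ?thesis using flat_pos[of "1 - f x" 1 0] flat_nonneg[of 1 0 "f x"] by linarith
  qed
  show "smooth ?g" using assms pos by (intro smooth_divide smooth_intros smooth_flat) auto
  show "0 \<le> ?g x" for x by (simp add: flat_nonneg)
  show "?g x \<le> 1" for x using pos[of x] by (simp add: divide_le_eq flat_nonneg)
  show "f x \<le> 0 \<Longrightarrow> ?g x = 0" for x by simp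
  show "1 \<le> f x \<Longrightarrow> ?g x = 1" for x using pos[of x] by simp
qed

lemma cutoff_exists:
  fixes K U :: "(real^'n::finite) set"
  assumes K: "compact K" "K \<subseteq> U" "open U"
  obtains \<eta> N where "testfun U \<eta>" "\<And>x. 0 \<le> \<eta> x" "\<And>x. \<eta> x \<le> 1" "open N" "K \<subseteq> N"
    "\<And>x. x \<in> N \<Longrightarrow> \<eta> x = 1"
proof (cases "K = {}")
  case True
  show thesis
    by (rule that[of "\<lambda>x. 0" "{}"]) (use True in \<open>auto intro: testfun_zero\<close>)
next
  case False
  have "\<forall>p\<in>K. \<exists>r>0. cball p r \<subseteq> U"
    using K by (meson open_contains_cball subsetD)
  then obtain r where r: "\<And>p. p \<in> K \<Longrightarrow> 0 < r p" "\<And>p. p \<in> K \<Longrightarrow> cball p (r p) \<subseteq> U" by metis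
  have "K \<subseteq> (\<Union>p\<in>K. ball p (r p))" using r by auto
  then obtain P where P: "P \<subseteq> K" "finite P" "K \<subseteq> (\<Union>p\<in>P. ball p (r p))"
    using compactE_image[OF K(1), of K "\<lambda>p. ball p (r p)"] by blast
  define F where "F x = (\<Sum>p\<in>P. flat 1 0 ((r p)\<^sup>2 - (norm (x - p))\<^sup>2))" for x
  have F: "smooth F" unfolding F_def by (intro smooth_intros smooth_flat) auto
  have F0: "F x = 0" if "x \<notin> (\<Union>p\<in>P. cball p (r p))" for x
    unfolding F_def
  proof (rule sum.neutral, rule ballI)
    fix p assume p: "p \<in> P"
    then have "r p \<le> norm (x - p)" using that by (auto simp: dist_norm norm_minus_commute)
    then have "(r p)\<^sup>2 \<le> (norm (x - p))\<^sup>2" using r(1)[of p] p P by (intro power_mono) auto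
    then show "flat 1 0 ((r p)\<^sup>2 - (norm (x - p))\<^sup>2) = 0" by simp
  qed
  have Fpos: "0 < F x" if "x \<in> K" for x
  proof -
    from that P(3) have "x \<in> (\<Union>p\<in>P. ball p (r p))" by (rule rev_subsetD)
    then obtain p where p: "p \<in> P" "x \<in> ball p (r p)" by blast
    then have "(norm (x - p))\<^sup>2 < (r p)\<^sup>2"
      by (intro power_strict_mono) (auto simp: dist_norm norm_minus_commute)
    then show ?thesis unfolding F_def
      using p P(2) by (intro sum_pos2[of _ p]) (auto intro: flat_pos flat_nonneg)
  qed
  obtain x0 where x0: "x0 \<in> K" "\<And>x. x \<in> K \<Longrightarrow> F x0 \<le> F x"
    using continuous_attains_inf[OF K(1) False smooth_continuous[OF F]] by blast
  \<comment> \<open>F x0 is the minimum of F over K. The factor 2 makes the step equal to 1 already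
    where F > F x0 / 2, which is an open neighbourhood of K and not just K itself.\<close>
  obtain \<eta> where \<eta>: "smooth \<eta>" "\<And>x. 0 \<le> \<eta> x" "\<And>x. \<eta> x \<le> 1" "\<And>x. 2 / F x0 * F x \<le> 0 \<Longrightarrow> \<eta> x = 0"
    "\<And>x. 1 \<le> 2 / F x0 * F x \<Longrightarrow> \<eta> x = 1"
    using smooth_step[OF smooth_mult[OF smooth_const F], of "2 / F x0"] by blast
  show thesis
  proof (rule that)
    show "testfun U \<eta>"
    proof (rule testfunI[OF \<eta>(1)])
      show "compact (\<Union>p\<in>P. cball p (r p))" using P(2) by auto
      show "(\<Union>p\<in>P. cball p (r p)) \<subseteq> U" using r P by blast
    qed (auto intro!: \<eta>(4) simp: F0)
    show "open {x. F x0 / 2 < F x}"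
      using smooth_continuous[OF F] by (intro open_Collect_less continuous_on_const)
    show "K \<subseteq> {x. F x0 / 2 < F x}"
    proof
      fix x assume "x \<in> K"
      then show "x \<in> {x. F x0 / 2 < F x}" using x0(2)[of x] Fpos[OF x0(1)] by simp
    qed
    show "\<eta> x = 1" if "x \<in> {x. F x0 / 2 < F x}" for x
      using that Fpos[OF x0(1)] by (intro \<eta>(5)) (simp add: field_simps)
  qed (use \<eta> in auto)
qed

section \<open>The measure of a positive functional\<close>

locale positive_functional =
  fixes D :: "(real^'n::finite) set" and S :: "(real^'n \<Rightarrow> real) \<Rightarrow> real"
  assumes open_D: "open D"
    and S_add: "\<And>f g. testfun D f \<Longrightarrow> testfun D g \<Longrightarrow> S (\<lambda>x. f x + g x) = S f + S g"
    and S_cmult: "\<And>c f. testfun D f \<Longrightarrow> S (\<lambda>x. c * f x) = c * S f"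
    and S_nonneg: "\<And>f. testfun D f \<Longrightarrow> (\<And>x. 0 \<le> f x) \<Longrightarrow> 0 \<le> S f"
begin

lemma S_diff: "testfun D f \<Longrightarrow> testfun D g \<Longrightarrow> S (\<lambda>x. f x - g x) = S f - S g"
  using S_add[of f "\<lambda>x. (-1) * g x"] S_cmult[of g "-1"] testfun_cmult[of D g "-1"] by simp

lemma S_mono: "testfun D f \<Longrightarrow> testfun D g \<Longrightarrow> (\<And>x. f x \<le> g x) \<Longrightarrow> S f \<le> S g"
  using S_nonneg[of "\<lambda>x. g x - f x"] S_diff[of g f] testfun_diff[of D g f] by simp

lemma S_zero: "S (\<lambda>x. 0) = 0"
  using S_cmult[OF testfun_zero, of 0] by simp

lemma S_sum:
  assumes "\<And>i. i \<in> I \<Longrightarrow> testfun D (f i)"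
  shows "S (\<lambda>x. \<Sum>i\<in>I. f i x) = (\<Sum>i\<in>I. S (f i))"
  using assms
  by (induction I rule: infinite_finite_induct) (simp_all add: S_zero S_add testfun_sum)

definition unit_test :: "(real^'n) set \<Rightarrow> (real^'n \<Rightarrow> real) set" where
  "unit_test U = {f. testfun (U \<inter> D) f \<and> (\<forall>x. 0 \<le> f x \<and> f x \<le> 1)}"

definition content_of :: "(real^'n) set \<Rightarrow> ennreal" where
  "content_of U = (SUP f\<in>unit_test U. ennreal (S f))"

lemma unit_testD:
  assumes "f \<in> unit_test U"
  shows "testfun D f" "0 \<le> f x" "f x \<le> 1" "x \<notin> U \<Longrightarrow> f x = 0"
  using assms testfun_outside[of "U \<inter> D" f x] testfun_subset[of "U \<inter> D" f D]
  by (auto simp: unit_test_def)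

lemma content_of_upper: "f \<in> unit_test U \<Longrightarrow> ennreal (S f) \<le> content_of U"
  unfolding content_of_def by (rule SUP_upper)

lemma content_of_mono: "U \<subseteq> V \<Longrightarrow> content_of U \<le> content_of V"
  unfolding content_of_def unit_test_def
  by (intro SUP_subset_mono) (auto intro: testfun_subset)

lemma content_of_empty: "content_of {} = 0"
proof -
  have "f = (\<lambda>x. 0)" if "f \<in> unit_test {}" for f
    using unit_testD(4)[OF that] by auto
  then have "ennreal (S f) \<le> 0" if "f \<in> unit_test {}" for f
    using S_zero that by force
  then have "content_of {} \<le> 0"
    unfolding content_of_def by (rule SUP_least)
  then show ?thesis by simp
qed

text \<open>A partition of unity splits f: \<eta> is 1 on a neighbourhood N of the part of the
  support outside V, so (1 - \<eta>) f lives on the compact set K - N, which lies in V.\<close>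

lemma content_of_Un:
  assumes "open U" "open V"
  shows "content_of (U \<union> V) \<le> content_of U + content_of V"
  unfolding content_of_def[of "U \<union> V"]
proof (rule SUP_least)
  fix f assume f: "f \<in> unit_test (U \<union> V)"
  then obtain K where K: "compact K" "K \<subseteq> (U \<union> V) \<inter> D" "\<And>x. x \<notin> K \<Longrightarrow> f x = 0"
    by (auto simp: unit_test_def testfun_def)
  have "compact (K - V)" "K - V \<subseteq> U \<inter> D" "open (U \<inter> D)"
    using K assms open_D by (auto simp: compact_diff)
  then obtain \<eta> N where \<eta>: "testfun (U \<inter> D) \<eta>" "\<And>x. 0 \<le> \<eta> x" "\<And>x. \<eta> x \<le> 1" "open N" "K - V \<subseteq> N"
    "\<And>x. x \<in> N \<Longrightarrow> \<eta> x = 1" using cutoff_exists[of "K - V" "U \<inter> D"] by metis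
  have sf: "smooth f" using unit_testD(1)[OF f] by (rule testfun_smooth)
  have 1: "(\<lambda>x. \<eta> x * f x) \<in> unit_test U"
    using testfun_mult[OF \<eta>(1) sf] \<eta>(2,3) unit_testD(2,3)[OF f] by (auto simp: unit_test_def mult_le_one)
  have "testfun (V \<inter> D) (\<lambda>x. (1 - \<eta> x) * f x)"
  proof (rule testfunI)
    show "smooth (\<lambda>x. (1 - \<eta> x) * f x)"
      by (intro smooth_intros sf testfun_smooth[OF \<eta>(1)])
    show "compact (K - N)" using K \<eta> by (simp add: compact_diff)
    show "K - N \<subseteq> V \<inter> D" using K \<eta> by blast
    show "(1 - \<eta> x) * f x = 0" if "x \<notin> K - N" for x using that K(3) \<eta>(6) by auto
  qed
  then have 2: "(\<lambda>x. (1 - \<eta> x) * f x) \<in> unit_test V"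
    using \<eta>(2,3) unit_testD(2,3)[OF f] by (auto simp: unit_test_def mult_le_one)
  have "f = (\<lambda>x. \<eta> x * f x + (1 - \<eta> x) * f x)" by (simp add: fun_eq_iff algebra_simps)
  then have "S f = S (\<lambda>x. \<eta> x * f x + (1 - \<eta> x) * f x)" by (rule arg_cong)
  also have "\<dots> = S (\<lambda>x. \<eta> x * f x) + S (\<lambda>x. (1 - \<eta> x) * f x)"
    by (intro S_add unit_testD(1)[OF 1] unit_testD(1)[OF 2])
  finally have "ennreal (S f) = ennreal (S (\<lambda>x. \<eta> x * f x)) + ennreal (S (\<lambda>x. (1 - \<eta> x) * f x))"
    using S_nonneg[OF unit_testD(1)[OF 1] unit_testD(2)[OF 1]] S_nonneg[OF unit_testD(1)[OF 2] unit_testD(2)[OF 2]]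
    by (simp only: ennreal_plus)
  also have "\<dots> \<le> content_of U + content_of V"
    by (intro add_mono content_of_upper 1 2)
  finally show "ennreal (S f) \<le> content_of U + content_of V" .
qed

text \<open>Test functions have compact support, so only finitely many of the sets matter and finite
  subadditivity suffices.\<close>

lemma content_of_UN:
  fixes U :: "nat \<Rightarrow> (real^'n) set"
  assumes "\<And>i. open (U i)"
  shows "content_of (\<Union>i. U i) \<le> (\<Sum>i. content_of (U i))"
  unfolding content_of_def[of "\<Union>i. U i"]
proof (rule SUP_least)
  fix f assume f: "f \<in> unit_test (\<Union>i. U i)"
  then obtain K where K: "compact K" "K \<subseteq> (\<Union>i. U i) \<inter> D" "\<And>x. x \<notin> K \<Longrightarrow> f x = 0"
    by (auto simp: unit_test_def testfun_def)
  have cov: "K \<subseteq> (\<Union>i\<in>UNIV. U i)" using K(2) by auto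
  obtain C where C: "finite C" "K \<subseteq> (\<Union>i\<in>C. U i)"
    by (rule compactE_image[OF K(1) assms cov]) auto
  then obtain n where n: "C \<subseteq> {..<n}" by (auto simp: finite_nat_iff_bounded)
  have "K \<subseteq> (\<Union>i<n. U i) \<inter> D" using C n K(2) by blast
  then have "testfun ((\<Union>i<n. U i) \<inter> D) f"
    using K(1,3) unit_testD(1)[OF f] by (auto simp: testfun_def)
  then have "f \<in> unit_test (\<Union>i<n. U i)" using unit_testD(2,3)[OF f] by (simp add: unit_test_def)
  then have "ennreal (S f) \<le> content_of (\<Union>i<n. U i)" by (rule content_of_upper)
  also have "\<dots> \<le> (\<Sum>i<n. content_of (U i))"
  proof (induction n)
    case (Suc n)
    have "content_of (\<Union>i<Suc n. U i) = content_of ((\<Union>i<n. U i) \<union> U n)"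
      by (simp add: lessThan_Suc Un_commute)
    also have "\<dots> \<le> content_of (\<Union>i<n. U i) + content_of (U n)"
      using assms by (intro content_of_Un) auto
    also have "\<dots> \<le> (\<Sum>i<Suc n. content_of (U i))" using Suc by (simp add: add_right_mono)
    finally show ?case .
  qed (simp add: content_of_empty)
  also have "\<dots> \<le> (\<Sum>i. content_of (U i))" by (intro sum_le_suminf) auto
  finally show "ennreal (S f) \<le> (\<Sum>i. content_of (U i))" .
qed

section \<open>Outer measure and Caratheodory's criterion\<close>

definition outer :: "(real^'n) set \<Rightarrow> ennreal" where
  "outer A = (INF U\<in>{U. open U \<and> A \<subseteq> U}. content_of U)"

lemma outer_le: "open U \<Longrightarrow> A \<subseteq> U \<Longrightarrow> outer A \<le> content_of U"
  unfolding outer_def by (rule INF_lower) simp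

lemma outer_mono: "A \<subseteq> B \<Longrightarrow> outer A \<le> outer B"
  unfolding outer_def by (rule INF_superset_mono) auto

lemma outer_open: "open U \<Longrightarrow> outer U = content_of U"
  unfolding outer_def by (rule antisym) (auto intro!: INF_lower INF_greatest content_of_mono)

lemma outer_UN: "outer (\<Union>i::nat. A i) \<le> (\<Sum>i. outer (A i))"
proof (rule ennreal_le_epsilon)
  fix e :: real
  assume fin: "(\<Sum>i. outer (A i)) < top" and e: "0 < e"
  have "\<exists>U. open U \<and> A i \<subseteq> U \<and> content_of U \<le> outer (A i) + ennreal (e * (1/2) ^ Suc i)" for i
  proof -
    have "outer (A i) \<noteq> top"
      using fin ennreal_suminf_lessD[of "\<lambda>i. outer (A i)" top i] by auto
    then have "outer (A i) < outer (A i) + ennreal (e * (1/2) ^ Suc i)"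
      using e by (simp add: ennreal_add_left_cancel_less[of _ 0, simplified] less_top)
    then show ?thesis unfolding outer_def by (auto simp: INF_less_iff dest: less_imp_le)
  qed
  then obtain U where U: "\<And>i. open (U i)" "\<And>i. A i \<subseteq> U i"
    "\<And>i. content_of (U i) \<le> outer (A i) + ennreal (e * (1/2) ^ Suc i)" by metis
  have "outer (\<Union>i. A i) \<le> content_of (\<Union>i. U i)" using U by (intro outer_le) auto
  also have "\<dots> \<le> (\<Sum>i. content_of (U i))" using U by (intro content_of_UN) auto
  also have "\<dots> \<le> (\<Sum>i. outer (A i) + ennreal (e * (1/2) ^ Suc i))"
    by (intro suminf_le U summableI)
  also have "\<dots> = (\<Sum>i. outer (A i)) + (\<Sum>i. ennreal (e * (1/2) ^ Suc i))"
    by (intro suminf_add[symmetric]) auto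
  also have "(\<Sum>i. ennreal (e * (1/2) ^ Suc i)) = ennreal (e * 1)"
    using e by (intro suminf_ennreal_eq sums_mult power_half_series) auto
  finally show "outer (\<Union>i. A i) \<le> (\<Sum>i. outer (A i)) + ennreal e" by simp
qed

lemma outer_measure_space_outer: "outer_measure_space (Pow UNIV) outer"
  unfolding outer_measure_space_def
proof (intro conjI)
  show "positive (Pow UNIV) outer"
    by (simp add: positive_def outer_open content_of_empty)
  show "increasing (Pow UNIV) outer"
    by (simp add: increasing_def outer_mono)
  show "countably_subadditive (Pow UNIV) outer"
    by (simp add: countably_subadditive_def outer_UN)
qed

text \<open>If f lives on a compact K inside U \<inter> V and g lives in U - K, then f + g is still
  at most 1, so the two contents add up to at most that of U. Here U - K is an open set containing A
  - V.\<close>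

lemma outer_open_split:
  assumes V: "open V"
  shows "outer (A \<inter> V) + outer (A - V) \<le> outer A"
  unfolding outer_def[of A]
proof (rule INF_greatest, clarify)
  fix U assume U: "open U" "A \<subseteq> U"
  have *: "ennreal (S f) + outer (A - V) \<le> content_of U" if f: "f \<in> unit_test (U \<inter> V)" for f
  proof -
    obtain K where K: "compact K" "K \<subseteq> (U \<inter> V) \<inter> D" "\<And>x. x \<notin> K \<Longrightarrow> f x = 0"
      using f by (auto simp: unit_test_def testfun_def)
    have "ennreal (S f) + ennreal (S g) \<le> content_of U" if g: "g \<in> unit_test (U - K)" for g
    proof -
      have "0 \<le> f x + g x \<and> f x + g x \<le> 1" for x
        using K(3)[of x] unit_testD(2,3)[OF f, of x] unit_testD(2,3)[OF g, of x] unit_testD(4)[OF g, of x]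
        by (cases "x \<in> K") auto
      moreover have "testfun (U \<inter> D) (\<lambda>x. f x + g x)"
        using f g by (intro testfun_add) (auto simp: unit_test_def elim: testfun_subset)
      ultimately have "(\<lambda>x. f x + g x) \<in> unit_test U" by (simp add: unit_test_def)
      from content_of_upper[OF this] show ?thesis
        using S_nonneg[OF unit_testD(1)[OF f] unit_testD(2)[OF f]]
          S_nonneg[OF unit_testD(1)[OF g] unit_testD(2)[OF g]]
        by (simp add: S_add[OF unit_testD(1)[OF f] unit_testD(1)[OF g]])
    qed
    moreover have "unit_test (U - K) \<noteq> {}"
      using testfun_zero[of "(U - K) \<inter> D"] by (force simp: unit_test_def)
    ultimately have "ennreal (S f) + content_of (U - K) \<le> content_of U"
      unfolding content_of_def[of "U - K"]
      by (subst ennreal_SUP_add_right) (auto intro: SUP_least)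
    moreover have "outer (A - V) \<le> content_of (U - K)"
      using U K by (intro outer_le) (auto simp: open_Diff compact_imp_closed)
    ultimately show ?thesis by (meson add_left_mono order_trans)
  qed
  have ne: "unit_test (U \<inter> V) \<noteq> {}"
    using testfun_zero[of "(U \<inter> V) \<inter> D"] by (force simp: unit_test_def)
  have "outer (A \<inter> V) \<le> content_of (U \<inter> V)" using U V by (intro outer_le) auto
  then have "outer (A \<inter> V) + outer (A - V) \<le> content_of (U \<inter> V) + outer (A - V)"
    by (rule add_right_mono)
  also have "\<dots> \<le> content_of U"
    unfolding content_of_def[of "U \<inter> V"] using *
    by (subst ennreal_SUP_add_left[symmetric, OF ne]) (auto intro: SUP_least)
  finally show "outer (A \<inter> V) + outer (A - V) \<le> content_of U" .
qed

definition riesz_measure :: "(real^'n) measure" where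
  "riesz_measure = measure_of UNIV (sets borel) outer"

lemma sets_riesz [simp, measurable_cong]: "sets riesz_measure = sets borel"
  and space_riesz [simp]: "space riesz_measure = UNIV"
  by (simp_all add: riesz_measure_def sigma_algebra.sets_measure_of_eq[OF sets.sigma_algebra_axioms, of borel, simplified])

lemma emeasure_riesz:
  assumes "A \<in> sets borel" shows "emeasure riesz_measure A = outer A"
proof -
  interpret sigma_algebra "UNIV :: (real^'n) set" "Pow UNIV" by (rule sigma_algebra_Pow)
  let ?L = "lambda_system UNIV (Pow UNIV) outer"
  have L: "measure_space UNIV ?L outer"
    by (rule caratheodory_lemma[OF outer_measure_space_outer])
  have "V \<in> ?L" if "open V" for V
  proof -
    have "outer (A \<inter> V) + outer (A - V) = outer A" for A
    proof (rule antisym[OF outer_open_split[OF that]])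
      have "outer ((A \<inter> V) \<union> (A - V)) \<le> outer (A \<inter> V) + outer (A - V)"
        using outer_measure_space_outer unfolding outer_measure_space_def
        by (intro subadditiveD[where f = outer and M = "Pow UNIV"] countably_subadditive_subadditive) auto
      then show "outer A \<le> outer (A \<inter> V) + outer (A - V)" by (simp add: Int_Diff_Un)
    qed
    then show ?thesis unfolding lambda_system_eq by blast
  qed
  then have "sigma_sets UNIV {V. open V} \<subseteq> ?L"
    using L by (intro sigma_algebra.sigma_sets_subset) (auto simp: measure_space_def)
  then have "sets borel \<subseteq> ?L" by (simp add: borel_def)
  then have "measure_space UNIV (sets borel) outer"
    using sets.sigma_algebra_axioms[of "borel :: (real^'n) measure"] by (intro measure_down[OF L]) auto
  then show ?thesis using assms unfolding riesz_measure_def measure_space_def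
    by (intro emeasure_measure_of_sigma) auto
qed

lemma emeasure_riesz_le:
  assumes "open U" "testfun D g" "\<And>x. 0 \<le> g x" "\<And>x. x \<in> U \<Longrightarrow> g x = 1"
  shows "emeasure riesz_measure U \<le> ennreal (S g)"
proof -
  have "S f \<le> S g" if f: "f \<in> unit_test U" for f
  proof (rule S_mono[OF unit_testD(1)[OF f] assms(2)])
    show "f x \<le> g x" for x
      using unit_testD(3,4)[OF f, of x] assms(3,4)[of x] by (cases "x \<in> U") auto
  qed
  then have "content_of U \<le> ennreal (S g)"
    unfolding content_of_def by (intro SUP_least ennreal_leI)
  then show ?thesis using assms(1) by (simp add: emeasure_riesz outer_open)
qed

lemma emeasure_riesz_ge:
  assumes "open U" "f \<in> unit_test U"
  shows "ennreal (S f) \<le> emeasure riesz_measure U"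
  using content_of_upper[OF assms(2)] assms(1) by (simp add: emeasure_riesz outer_open)

lemma emeasure_riesz_compact:
  assumes "compact K" "K \<subseteq> D"
  shows "emeasure riesz_measure K < \<infinity>"
proof -
  obtain \<eta> N where \<eta>: "testfun D \<eta>" "\<And>x. 0 \<le> \<eta> x" "open N" "K \<subseteq> N" "\<And>x. x \<in> N \<Longrightarrow> \<eta> x = 1"
    using cutoff_exists[OF assms open_D] by metis
  have "emeasure riesz_measure K \<le> emeasure riesz_measure N"
    using \<eta> by (intro emeasure_mono) auto
  also have "\<dots> \<le> ennreal (S \<eta>)" by (intro emeasure_riesz_le \<eta>)
  also have "\<dots> < \<infinity>" by simp
  finally show ?thesis .
qed

section \<open>Integrals against the Riesz measure\<close>

lemma riesz_integrable:
  assumes "testfun D f" shows "integrable riesz_measure f"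
proof (rule testfun_integrable[OF assms])
  show "f \<in> borel_measurable riesz_measure"
    using testfun_borel_measurable[OF assms] by (simp cong: measurable_cong_sets)
qed (use emeasure_riesz_compact in \<open>auto simp: compact_imp_closed\<close>)

text \<open>Cutting \<open>N f\<close> into \<open>n\<close> layers of height one: on each layer both sides lie between the
  measures of two superlevel sets, and these measures telescope.\<close>

lemma riesz_nonneg_estimate:
  fixes N :: nat
  assumes f: "testfun D f" "\<And>x. 0 \<le> f x"
    and K: "compact K" "K \<subseteq> D" "\<And>x. x \<notin> K \<Longrightarrow> f x = 0"
    and \<eta>: "testfun D \<eta>" "\<And>x. 0 \<le> \<eta> x" "\<And>x. x \<in> K \<Longrightarrow> \<eta> x = 1"
  shows "real N * \<bar>S f - (LINT x|riesz_measure. f x)\<bar> \<le> 2 * S \<eta> + 4 * measure riesz_measure K"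
proof -
  let ?M = riesz_measure
  let ?I = "\<lambda>g. LINT x|?M. g x"
  have sf: "smooth f" by (rule testfun_smooth[OF f(1)])
  have c: "continuous_on A f" for A using sf by (rule smooth_continuous)
  have "\<exists>g. smooth g \<and> (\<forall>x. 0 \<le> g x) \<and> (\<forall>x. g x \<le> 1) \<and> (\<forall>x. N * f x \<le> real i \<longrightarrow> g x = 0)
      \<and> (\<forall>x. real i + 1 \<le> N * f x \<longrightarrow> g x = 1)" for i :: nat
  proof -
    have "smooth (\<lambda>x. N * f x - i)" by (intro smooth_intros sf)
    then obtain g where "smooth g" "\<And>x. 0 \<le> g x" "\<And>x. g x \<le> 1" "\<And>x. N * f x - i \<le> 0 \<Longrightarrow> g x = 0"
      "\<And>x. 1 \<le> N * f x - i \<Longrightarrow> g x = 1" using smooth_step by blast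
    then show ?thesis by (intro exI[of _ g]) auto
  qed
  then obtain g where "\<forall>i. smooth (g i) \<and> (\<forall>x. 0 \<le> g i x) \<and> (\<forall>x. g i x \<le> 1) \<and>
      (\<forall>x. N * f x \<le> real i \<longrightarrow> g i x = 0) \<and> (\<forall>x. real i + 1 \<le> N * f x \<longrightarrow> g i x = 1)"
    by metis
  then have g: "smooth (g i)" "0 \<le> g i x" "g i x \<le> 1"
    "N * f x \<le> real i \<Longrightarrow> g i x = 0" "real i + 1 \<le> N * f x \<Longrightarrow> g i x = 1" for i x
    by auto
  define U where "U i = {x. real i < N * f x}" for i :: nat
  have U: "open (U i)" for i
    unfolding U_def using c by (intro open_Collect_less continuous_intros) auto
  have UK: "U i \<subseteq> K" for i
  proof
    fix x assume "x \<in> U i"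
    then show "x \<in> K" using K(3)[of x] by (cases "x \<in> K") (auto simp: U_def)
  qed
  have Kb: "K \<in> sets ?M" using K by (auto simp: compact_imp_closed)
  have finK: "emeasure ?M K < top" using emeasure_riesz_compact[OF K(1,2)] by simp
  have finU: "emeasure ?M (U i) \<noteq> top" for i
    using emeasure_mono[OF UK Kb, of i] finK by (auto simp: top_unique)
  have gt: "testfun D (g i)" for i
  proof (rule testfunI[OF g(1) K(1,2)])
    fix x assume "x \<notin> K"
    then have "f x = 0" by (rule K(3))
    then show "g i x = 0" by (intro g(4)) simp
  qed
  define a where "a i = measure ?M (U i)" for i
  have ea: "emeasure ?M (U i) = ennreal (a i)" for i
    unfolding a_def using finU by (rule emeasure_eq_ennreal_measure)
  have a0: "0 \<le> a i" for i by (simp add: a_def)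
  have aK: "a i \<le> measure ?M K" for i
    unfolding a_def using UK Kb finK by (intro measure_mono_fmeasurable fmeasurableI) (auto simp: U)
  have ind: "integrable ?M (indicator (U i) :: _ \<Rightarrow> real)" for i
    using U finU by (auto simp: less_top)
  \<comment> \<open>Both quantities lie between a (i + 1) and a (i - 1). The index drops by one on
    the upper side because the support of \<open>g i\<close> lies in the closed set where N f \<ge>
    i, which is contained in the open set \<open>U (i - 1)\<close> but in general not in
    \<open>U i\<close>; so the layers start at i = 1.\<close>
  have lay: "\<bar>S (g i) - ?I (g i)\<bar> \<le> a (i - 1) - a (i + 1)" if i: "1 \<le> i" for i
  proof -
    have "ennreal (a (i + 1)) \<le> ennreal (S (g i))"
      unfolding ea[symmetric] by (intro emeasure_riesz_le U gt g) (auto simp: U_def g(5))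
    then have 1: "a (i + 1) \<le> S (g i)"
      using S_nonneg[OF gt g(2)] by (simp add: ennreal_le_iff)
    have "testfun (U (i - 1) \<inter> D) (g i)"
    proof (rule testfunI[OF g(1)])
      show "compact (K \<inter> {x. real i \<le> N * f x})"
        using c by (intro compact_Int_closed K(1) closed_Collect_le continuous_intros) auto
      show "K \<inter> {x. real i \<le> N * f x} \<subseteq> U (i - 1) \<inter> D"
        using K(2) i by (auto simp: U_def of_nat_diff)
      fix x assume "x \<notin> K \<inter> {x. real i \<le> N * f x}"
      then have "N * f x \<le> real i" using K(3)[of x] by (cases "x \<in> K") auto
      then show "g i x = 0" by (rule g(4))
    qed
    then have "ennreal (S (g i)) \<le> ennreal (a (i - 1))"
      unfolding ea[symmetric] using g by (intro emeasure_riesz_ge U) (simp add: unit_test_def)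
    then have 2: "S (g i) \<le> a (i - 1)" using a0 by (simp add: ennreal_le_iff)
    have "?I (indicator (U (i + 1))) \<le> ?I (g i)"
      using g(2,5) by (intro integral_mono ind riesz_integrable gt) (auto simp: U_def indicator_def)
    then have 3: "a (i + 1) \<le> ?I (g i)" by (simp add: a_def)
    have "?I (g i) \<le> ?I (indicator (U (i - 1)))"
    proof (intro integral_mono ind riesz_integrable gt)
      fix x
      show "g i x \<le> indicator (U (i - 1)) x"
        using g(3)[of i x] g(4)[of x i] i by (auto simp: U_def indicator_def of_nat_diff)
    qed
    then have 4: "?I (g i) \<le> a (i - 1)" by (simp add: a_def)
    show ?thesis using 1 2 3 4 by linarith
  qed
  have "bounded (f ` K)" using K(1) c by (intro compact_imp_bounded compact_continuous_image)
  then obtain B where B: "\<And>x. x \<in> K \<Longrightarrow> norm (f x) \<le> B" by (auto simp: bounded_iff)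
  obtain n :: nat where n: "N * \<bar>B\<bar> \<le> n" using real_arch_simple by blast
  have Nn: "N * f x \<le> n" for x
  proof (cases "x \<in> K")
    case True
    then have "N * f x \<le> N * \<bar>B\<bar>" using B[OF True] f(2)[of x] by (intro mult_left_mono) auto
    then show ?thesis using n by simp
  qed (use K(3) in auto)
  define G where "G x = (\<Sum>i=1..n. g i x)" for x
  have up: "(\<Sum>i=1..k. g i x) \<le> min (N * f x) k" for k x
  proof (induction k)
    case (Suc k)
    then show ?case using g(3)[of "Suc k" x] g(4)[of x "Suc k"]
      by (cases "N * f x \<le> Suc k") (auto simp: min_def split: if_splits)
  qed (simp add: f)
  have lo: "min (N * f x - 2) k \<le> (\<Sum>i=1..k. g i x)" for k x
  proof (induction k)
    case (Suc k)
    then show ?case using g(2)[of "Suc k" x] g(5)[of "Suc k" x]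
      by (cases "Suc k + 1 \<le> N * f x") (auto simp: min_def split: if_splits)
  qed simp
  \<comment> \<open>The omitted bottom layer and the unfinished top layer cost at most 1 each, so
    the remainder stays between 0 and 2 independently of N. This makes the error of order 1/N after
    division.\<close>
  define R where "R x = N * f x - G x" for x
  have R: "0 \<le> R x \<and> R x \<le> 2" for x
    using up[of x n] lo[of x n] Nn[of x] by (auto simp: R_def G_def min_def split: if_splits)
  have RK: "R x = 0" if "x \<notin> K" for x
    using K(3)[OF that] g(4)[of x] by (simp add: R_def G_def)
  have Gt: "testfun D G" unfolding G_def by (intro testfun_sum gt)
  have Rt: "testfun D R" unfolding R_def by (intro testfun_diff testfun_cmult f Gt)
  have "S R = N * S f - S G"
    unfolding R_def by (simp add: S_diff testfun_cmult f Gt S_cmult)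
  moreover have "S G = (\<Sum>i=1..n. S (g i))" unfolding G_def by (intro S_sum gt)
  moreover have "0 \<le> S R" using R by (intro S_nonneg Rt) auto
  moreover have "S R \<le> S (\<lambda>x. 2 * \<eta> x)"
  proof (intro S_mono Rt testfun_cmult \<eta>(1))
    show "R x \<le> 2 * \<eta> x" for x using R[of x] RK[of x] \<eta>(2,3)[of x] by (cases "x \<in> K") auto
  qed
  moreover have "?I R = N * ?I f - ?I G"
    unfolding R_def by (simp add: riesz_integrable f Gt)
  moreover have "?I G = (\<Sum>i=1..n. ?I (g i))"
    unfolding G_def by (rule Bochner_Integration.integral_sum) (rule riesz_integrable[OF gt])
  moreover have "0 \<le> ?I R" using R by (intro integral_nonneg_AE) auto
  moreover have "?I R \<le> ?I (\<lambda>x. 2 * indicator K x)"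
  proof (rule integral_mono[OF riesz_integrable[OF Rt]])
    show "integrable ?M (\<lambda>x. 2 * indicator K x :: real)"
      using Kb finK by (intro integrable_mult_right) auto
    show "R x \<le> 2 * indicator K x" for x using R[of x] RK[of x] by (auto simp: indicator_def)
  qed
  moreover have "?I (\<lambda>x. 2 * indicator K x) = 2 * measure ?M K" using Kb by simp
  moreover have "\<bar>(\<Sum>i=1..n. S (g i)) - (\<Sum>i=1..n. ?I (g i))\<bar> \<le> 2 * measure ?M K"
  proof -
    have "\<bar>(\<Sum>i=1..n. S (g i)) - (\<Sum>i=1..n. ?I (g i))\<bar> \<le> (\<Sum>i=1..n. \<bar>S (g i) - ?I (g i)\<bar>)"
      unfolding sum_subtractf[symmetric] by (rule sum_abs)
    also have "\<dots> \<le> (\<Sum>i=1..n. a (i - 1) - a (i + 1))" by (intro sum_mono lay) auto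
    also have "\<dots> = a 0 + a 1 - a n - a (n + 1)" by (induction n) auto
    also have "\<dots> \<le> 2 * measure ?M K" using a0[of n] a0[of "n + 1"] aK[of 0] aK[of 1] by linarith
    finally show ?thesis .
  qed
  ultimately have "\<bar>N * S f - N * ?I f\<bar> \<le> 2 * S \<eta> + 4 * measure ?M K"
    using S_cmult[OF \<eta>(1), of 2] by linarith
  then show ?thesis by (simp add: abs_mult right_diff_distrib[symmetric])
qed

lemma riesz_nonneg:
  assumes "testfun D f" "\<And>x. 0 \<le> f x"
  shows "S f = (LINT x|riesz_measure. f x)"
proof (rule ccontr)
  assume ne: "S f \<noteq> (LINT x|riesz_measure. f x)"
  obtain K where K: "compact K" "K \<subseteq> D" "\<And>x. x \<notin> K \<Longrightarrow> f x = 0"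
    using assms by (auto simp: testfun_def)
  obtain \<eta> N where \<eta>: "testfun D \<eta>" "\<And>x. 0 \<le> \<eta> x" "K \<subseteq> N" "\<And>x. x \<in> N \<Longrightarrow> \<eta> x = 1"
    using cutoff_exists[OF K(1,2) open_D] by metis
  obtain N :: nat where "2 * S \<eta> + 4 * measure riesz_measure K < N * \<bar>S f - (LINT x|riesz_measure. f x)\<bar>"
    using reals_Archimedean3[of "\<bar>S f - (LINT x|riesz_measure. f x)\<bar>"] ne by auto
  moreover have "N * \<bar>S f - (LINT x|riesz_measure. f x)\<bar> \<le> 2 * S \<eta> + 4 * measure riesz_measure K"
    by (rule riesz_nonneg_estimate) (use assms K \<eta> in auto)
  ultimately show False by simp
qed

text \<open>A multiple of a cutoff equal to 1 on the support makes f nonnegative; linearity on both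
  sides removes it again.\<close>

lemma riesz:
  assumes "testfun D f"
  shows "S f = (LINT x|riesz_measure. f x)"
proof -
  obtain K where K: "compact K" "K \<subseteq> D" "\<And>x. x \<notin> K \<Longrightarrow> f x = 0"
    using assms by (auto simp: testfun_def)
  obtain \<eta> N where \<eta>: "testfun D \<eta>" "\<And>x. 0 \<le> \<eta> x" "K \<subseteq> N" "\<And>x. x \<in> N \<Longrightarrow> \<eta> x = 1"
    using cutoff_exists[OF K(1,2) open_D] by metis
  have "bounded (f ` K)"
    using K(1) assms by (intro compact_imp_bounded compact_continuous_image smooth_continuous testfun_smooth)
  then obtain B where B: "\<And>x. x \<in> K \<Longrightarrow> norm (f x) \<le> B" by (auto simp: bounded_iff)
  have pos: "0 \<le> f x + \<bar>B\<bar> * \<eta> x" for x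
    using B[of x] \<eta>(2)[of x] \<eta>(4)[of x] \<eta>(3) K(3)[of x] by (cases "x \<in> K") force+
  have t: "testfun D (\<lambda>x. \<bar>B\<bar> * \<eta> x)" by (intro testfun_cmult \<eta>)
  have "S f + S (\<lambda>x. \<bar>B\<bar> * \<eta> x) = S (\<lambda>x. f x + \<bar>B\<bar> * \<eta> x)"
    by (intro S_add[symmetric] assms t)
  also have "\<dots> = (LINT x|riesz_measure. f x + \<bar>B\<bar> * \<eta> x)"
    by (intro riesz_nonneg testfun_add assms t pos)
  also have "\<dots> = (LINT x|riesz_measure. f x) + (LINT x|riesz_measure. \<bar>B\<bar> * \<eta> x)"
    by (intro Bochner_Integration.integral_add riesz_integrable assms t)
  also have "(LINT x|riesz_measure. \<bar>B\<bar> * \<eta> x) = S (\<lambda>x. \<bar>B\<bar> * \<eta> x)"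
    by (intro riesz_nonneg[symmetric] t) (simp add: \<eta>)
  finally show ?thesis by simp
qed

theorem riesz_representation:
  "\<exists>\<mu>. sets \<mu> = sets (restrict_space borel D) \<and>
    (\<forall>K. compact K \<and> K \<subseteq> D \<longrightarrow> emeasure \<mu> K < \<infinity>) \<and>
    (\<forall>f. testfun D f \<longrightarrow> S f = (LINT x|\<mu>. f x))"
proof (intro exI[of _ "restrict_space riesz_measure D"] conjI allI impI)
  have D: "D \<inter> space riesz_measure \<in> sets riesz_measure" using open_D by simp
  show "sets (restrict_space riesz_measure D) = sets (restrict_space borel D)"
    by (rule sets_restrict_space_cong) simp
  show "emeasure (restrict_space riesz_measure D) K < \<infinity>" if "compact K \<and> K \<subseteq> D" for K
    using emeasure_riesz_compact that D by (simp add: emeasure_restrict_space)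
  show "S f = (LINT x|restrict_space riesz_measure D. f x)" if "testfun D f" for f
  proof -
    have "indicator D x *\<^sub>R f x = f x" for x
      using testfun_outside[OF that, of x] by (cases "x \<in> D") auto
    then show ?thesis unfolding integral_restrict_space[OF D] by (simp only: riesz[OF that])
  qed
qed

end

section \<open>The algebra of superforms\<close>

lemma sum_fun_apply: "(\<Sum>i\<in>S. f i) x = (\<Sum>i\<in>S. f i x)"
  by (induction S rule: infinite_finite_induct) auto

definition scal :: "(real^'n::{finite,linorder} \<Rightarrow> real) \<Rightarrow> 'n superform \<Rightarrow> 'n superform" where
  "scal f a = (\<lambda>I J x. f x * a I J x)"

definition wedge_sign :: "'n::{finite,linorder} set \<Rightarrow> 'n set \<Rightarrow> 'n set \<Rightarrow> 'n set \<Rightarrow> real" where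
  "wedge_sign I J I' J' = (-1) ^ (card J * card I') * shuffle_sign I I' * shuffle_sign J J'"

lemma wedge_alt: "(a \<and>\<^sub>s b) K L x = (\<Sum>I\<in>Pow K. \<Sum>J\<in>Pow L.
    wedge_sign I J (K - I) (L - J) * a I J x * b (K - I) (L - J) x)"
  by (simp add: wedge_def wedge_sign_def)

lemma wedge_add_left: "(a + b) \<and>\<^sub>s c = a \<and>\<^sub>s c + b \<and>\<^sub>s c"
  and wedge_add_right: "c \<and>\<^sub>s (a + b) = c \<and>\<^sub>s a + c \<and>\<^sub>s b"
  and wedge_diff_left: "(a - b) \<and>\<^sub>s c = a \<and>\<^sub>s c - b \<and>\<^sub>s c"
  and wedge_diff_right: "c \<and>\<^sub>s (a - b) = c \<and>\<^sub>s a - c \<and>\<^sub>s b"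
  by (simp_all add: fun_eq_iff wedge_alt algebra_simps sum.distrib sum_subtractf)

lemma wedge_zero_left: "0 \<and>\<^sub>s c = 0" and wedge_zero_right: "c \<and>\<^sub>s 0 = 0"
  by (simp_all add: fun_eq_iff wedge_alt)

lemma wedge_sum_left: "(\<Sum>i\<in>S. a i) \<and>\<^sub>s c = (\<Sum>i\<in>S. a i \<and>\<^sub>s c)"
  by (induction S rule: infinite_finite_induct) (simp_all only: sum.infinite sum.empty sum.insert wedge_zero_left wedge_add_left not_False_eq_True)

lemma wedge_sum_right: "c \<and>\<^sub>s (\<Sum>i\<in>S. a i) = (\<Sum>i\<in>S. c \<and>\<^sub>s a i)"
  by (induction S rule: infinite_finite_induct) (simp_all only: sum.infinite sum.empty sum.insert wedge_zero_right wedge_add_right not_False_eq_True)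

lemma wedge_scal_left: "scal f a \<and>\<^sub>s b = scal f (a \<and>\<^sub>s b)"
  and wedge_scal_right: "a \<and>\<^sub>s scal f b = scal f (a \<and>\<^sub>s b)"
  by (simp_all add: fun_eq_iff wedge_alt scal_def sum_distrib_left mult_ac)

lemma scal_scal: "scal f (scal g a) = scal (\<lambda>x. f x * g x) a"
  and scal_add: "scal f (a + b) = scal f a + scal f b"
  and scal_diff: "scal f (a - b) = scal f a - scal f b"
  and scal_add_left: "scal (\<lambda>x. f x + g x) a = scal f a + scal g a"
  and scal_zero: "scal f 0 = 0"
  and scal_one: "scal (\<lambda>x. 1) a = a"
  by (simp_all add: scal_def fun_eq_iff algebra_simps)

section \<open>Signs, associativity and graded commutativity of the wedge product\<close>

lemma shuffle_sign_empty [simp]: "shuffle_sign {} I = 1" "shuffle_sign I {} = 1"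
  by (simp_all add: shuffle_sign_def)

lemma shuffle_sign_Un_left:
  assumes "A \<inter> B = {}"
  shows "shuffle_sign (A \<union> B) C = shuffle_sign A C * shuffle_sign B C"
proof -
  have "{(i, i'). i \<in> A \<union> B \<and> i' \<in> C \<and> i' < i} =
      {(i, i'). i \<in> A \<and> i' \<in> C \<and> i' < i} \<union> {(i, i'). i \<in> B \<and> i' \<in> C \<and> i' < i}" by auto
  moreover have "card \<dots> = card {(i, i'). i \<in> A \<and> i' \<in> C \<and> i' < i} + card {(i, i'). i \<in> B \<and> i' \<in> C \<and> i' < i}"
    using assms by (intro card_Un_disjoint) auto
  ultimately show ?thesis by (simp add: shuffle_sign_def power_add)
qed

lemma shuffle_sign_Un_right:
  assumes "B \<inter> C = {}"
  shows "shuffle_sign A (B \<union> C) = shuffle_sign A B * shuffle_sign A C"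
proof -
  have "{(i, i'). i \<in> A \<and> i' \<in> B \<union> C \<and> i' < i} =
      {(i, i'). i \<in> A \<and> i' \<in> B \<and> i' < i} \<union> {(i, i'). i \<in> A \<and> i' \<in> C \<and> i' < i}" by auto
  moreover have "card \<dots> = card {(i, i'). i \<in> A \<and> i' \<in> B \<and> i' < i} + card {(i, i'). i \<in> A \<and> i' \<in> C \<and> i' < i}"
    using assms by (intro card_Un_disjoint) auto
  ultimately show ?thesis by (simp add: shuffle_sign_def power_add)
qed

text \<open>Each pair of A \<times> B is an inversion for exactly one of the two orders, so the two
  inversion counts add up to |A| |B|.\<close>

lemma shuffle_sign_commute:
  assumes "A \<inter> B = {}"
  shows "shuffle_sign A B = (-1) ^ (card A * card B) * shuffle_sign B A"
proof -
  let ?X = "{(i, i'). i \<in> A \<and> i' \<in> B \<and> i' < i}"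
  let ?Y = "{(i, i'). i \<in> B \<and> i' \<in> A \<and> i' < i}"
  have ne: "i \<noteq> i'" if "i \<in> A" "i' \<in> B" for i i' using assms that by auto
  have "(i, i') \<in> ?X \<union> prod.swap ` ?Y" if p: "i \<in> A" "i' \<in> B" for i i'
  proof (cases "i' < i")
    case True
    then show ?thesis using p by simp
  next
    case False
    then have "i < i'" using ne[OF p] by simp
    then have "(i, i') \<in> prod.swap ` ?Y" using p by (intro image_eqI[of _ _ "(i', i)"]) simp_all
    then show ?thesis by (rule UnI2)
  qed
  then have "A \<times> B \<subseteq> ?X \<union> prod.swap ` ?Y" by blast
  then have "A \<times> B = ?X \<union> prod.swap ` ?Y" by fastforce
  moreover have "card (?X \<union> prod.swap ` ?Y) = card ?X + card (prod.swap ` ?Y)"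
    by (intro card_Un_disjoint) auto
  moreover have "card (prod.swap ` ?Y) = card ?Y"
    by (intro card_image) (auto simp: inj_on_def)
  ultimately have "card A * card B = card ?X + card ?Y"
    using card_cartesian_product[of A B] by simp
  then show ?thesis by (simp add: shuffle_sign_def power_add power_mult_distrib[symmetric])
qed

text \<open>Nested pairs A \<subseteq> I become disjoint pairs with I = A \<union> B, the way in
  which the product bracketed to the right is expanded.\<close>

lemma sum_Pow_Pow:
  fixes F :: "'a::finite set \<Rightarrow> 'a set \<Rightarrow> real"
  shows "(\<Sum>I\<in>Pow K. \<Sum>A\<in>Pow I. F I A) = (\<Sum>A\<in>Pow K. \<Sum>B\<in>Pow (K - A). F (A \<union> B) A)"
  unfolding sum.Sigma[OF finite, OF ballI, OF finite]
  by (rule sum.reindex_bij_witness[where i = "\<lambda>(A, B). (A \<union> B, A)" and j = "\<lambda>(I, A). (A, I - A)"])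
    (auto simp: Un_absorb1 Un_Diff)

text \<open>The sign identity behind associativity: both sides are the sign of bringing three blocks
  into increasing order, grouped from the left or from the right.\<close>

lemma wedge_sign_cocycle:
  assumes "A \<inter> I = {}" "A \<inter> C = {}" "I \<inter> C = {}" "B \<inter> J = {}" "B \<inter> E = {}" "J \<inter> E = {}"
  shows "wedge_sign (A \<union> I) (B \<union> J) C E * wedge_sign A B I J =
    wedge_sign A B (I \<union> C) (J \<union> E) * wedge_sign I J C E"
  using assms
  by (simp add: wedge_sign_def shuffle_sign_Un_left shuffle_sign_Un_right card_Un_disjoint
      algebra_simps power_add)

lemma wedge_assoc: "(a \<and>\<^sub>s b) \<and>\<^sub>s c = a \<and>\<^sub>s (b \<and>\<^sub>s c)"
proof (intro ext)
  fix K L x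
  let ?F = "\<lambda>I J A B. wedge_sign I J (K - I) (L - J) * (wedge_sign A B (I - A) (J - B) *
      a A B x * b (I - A) (J - B) x) * c (K - I) (L - J) x"
  have "((a \<and>\<^sub>s b) \<and>\<^sub>s c) K L x = (\<Sum>I\<in>Pow K. \<Sum>J\<in>Pow L. \<Sum>A\<in>Pow I. \<Sum>B\<in>Pow J. ?F I J A B)"
    by (simp add: wedge_alt sum_distrib_left sum_distrib_right)
  also have "\<dots> = (\<Sum>I\<in>Pow K. \<Sum>A\<in>Pow I. \<Sum>J\<in>Pow L. \<Sum>B\<in>Pow J. ?F I J A B)"
    by (intro sum.cong refl sum.swap)
  also have "\<dots> = (\<Sum>A\<in>Pow K. \<Sum>I\<in>Pow (K - A). \<Sum>B\<in>Pow L. \<Sum>J\<in>Pow (L - B). ?F (A \<union> I) (B \<union> J) A B)"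
    by (simp only: sum_Pow_Pow)
  also have "\<dots> = (\<Sum>A\<in>Pow K. \<Sum>I\<in>Pow (K - A). \<Sum>B\<in>Pow L. \<Sum>J\<in>Pow (L - B).
      wedge_sign A B (K - A) (L - B) * a A B x *
      (wedge_sign I J (K - A - I) (L - B - J) * b I J x * c (K - A - I) (L - B - J) x))"
  proof (intro sum.cong refl)
    fix A I B J assume *: "A \<in> Pow K" "I \<in> Pow (K - A)" "B \<in> Pow L" "J \<in> Pow (L - B)"
    have s: "A \<union> I - A = I" "B \<union> J - B = J" "K - (A \<union> I) = K - A - I" "L - (B \<union> J) = L - B - J"
      "I \<union> (K - A - I) = K - A" "J \<union> (L - B - J) = L - B" using * by auto
    have "wedge_sign (A \<union> I) (B \<union> J) (K - A - I) (L - B - J) * wedge_sign A B I J =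
        wedge_sign A B (K - A) (L - B) * wedge_sign I J (K - A - I) (L - B - J)"
      using wedge_sign_cocycle[of A I "K - A - I" B J "L - B - J"] * unfolding s by blast
    moreover have assoc: "w1 * (w2 * p * q) * r = w3 * p * (w4 * q * r)"
      if "w1 * w2 = w3 * w4" for w1 w2 w3 w4 p q r :: real
    proof -
      have "w1 * (w2 * p * q) * r = (w1 * w2) * (p * q * r)" by (simp only: mult_ac)
      also have "\<dots> = w3 * p * (w4 * q * r)" unfolding that by (simp only: mult_ac)
      finally show ?thesis .
    qed
    ultimately show "?F (A \<union> I) (B \<union> J) A B = wedge_sign A B (K - A) (L - B) * a A B x *
      (wedge_sign I J (K - A - I) (L - B - J) * b I J x * c (K - A - I) (L - B - J) x)"
      unfolding s by (intro assoc)
  qed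
  also have "\<dots> = (\<Sum>A\<in>Pow K. \<Sum>B\<in>Pow L. \<Sum>I\<in>Pow (K - A). \<Sum>J\<in>Pow (L - B).
      wedge_sign A B (K - A) (L - B) * a A B x *
      (wedge_sign I J (K - A - I) (L - B - J) * b I J x * c (K - A - I) (L - B - J) x))"
    by (intro sum.cong refl sum.swap)
  also have "\<dots> = (a \<and>\<^sub>s (b \<and>\<^sub>s c)) K L x"
    by (simp add: wedge_alt sum_distrib_left)
  finally show "((a \<and>\<^sub>s b) \<and>\<^sub>s c) K L x = (a \<and>\<^sub>s (b \<and>\<^sub>s c)) K L x" .
qed

lemma wedge_sign_commute:
  assumes "I \<inter> I' = {}" "J \<inter> J' = {}"
  shows "wedge_sign I J I' J' = (-1) ^ ((card I + card J) * (card I' + card J')) * wedge_sign I' J' I J"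
proof -
  have e: "(-1) ^ (k + k + l) = (-1 :: real) ^ l" for k l :: nat
    by (simp add: power_add power_mult_distrib[symmetric])
  have "(-1::real) ^ ((card I + card J) * (card I' + card J')) * (-1) ^ (card J' * card I) =
      (-1) ^ (card J' * card I + card J' * card I + (card J * card I' + card I * card I' + card J * card J'))"
    by (simp add: power_add[symmetric] algebra_simps)
  then show ?thesis
    unfolding wedge_sign_def shuffle_sign_commute[OF assms(1)] shuffle_sign_commute[OF assms(2)] e
    by (simp add: power_add mult_ac)
qed

lemma wedge_commute:
  assumes "has_bidegree p q a" "has_bidegree r s b"
  shows "a \<and>\<^sub>s b = scal (\<lambda>x. (-1) ^ ((p + q) * (r + s))) (b \<and>\<^sub>s a)"
proof (intro ext)
  fix K L x
  have "(a \<and>\<^sub>s b) K L x = (\<Sum>I\<in>Pow K. \<Sum>J\<in>Pow L.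
      wedge_sign (K - I) (L - J) I J * a (K - I) (L - J) x * b I J x)"
  proof -
    have r: "(\<Sum>I\<in>Pow M. F I) = (\<Sum>I\<in>Pow M. F (M - I))" for F :: "'a set \<Rightarrow> real" and M
      by (rule sum.reindex_bij_witness[where i = "\<lambda>I. M - I" and j = "\<lambda>I. M - I"]) (auto simp: double_diff)
    have "(a \<and>\<^sub>s b) K L x = (\<Sum>I\<in>Pow K. \<Sum>J\<in>Pow L. wedge_sign (K - I) (L - J) (K - (K - I)) (L - (L - J)) *
        a (K - I) (L - J) x * b (K - (K - I)) (L - (L - J)) x)"
      unfolding wedge_alt by (rule trans[OF r sum.cong[OF refl r]])
    also have "\<dots> = (\<Sum>I\<in>Pow K. \<Sum>J\<in>Pow L. wedge_sign (K - I) (L - J) I J * a (K - I) (L - J) x * b I J x)"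
      by (intro sum.cong refl) (simp add: double_diff)
    finally show ?thesis .
  qed
  also have "\<dots> = (\<Sum>I\<in>Pow K. \<Sum>J\<in>Pow L. (-1) ^ ((p + q) * (r + s)) *
      (wedge_sign I J (K - I) (L - J) * b I J x * a (K - I) (L - J) x))"
  proof (intro sum.cong refl)
    fix I J
    show "wedge_sign (K - I) (L - J) I J * a (K - I) (L - J) x * b I J x = (-1) ^ ((p + q) * (r + s)) *
      (wedge_sign I J (K - I) (L - J) * b I J x * a (K - I) (L - J) x)"
    proof (cases "a (K - I) (L - J) x = 0 \<or> b I J x = 0")
      case False
      then have "card (K - I) = p" "card (L - J) = q" "card I = r" "card J = s"
        using assms unfolding has_bidegree_def by blast+
      then show ?thesis by (subst wedge_sign_commute) auto
    qed auto
  qed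
  also have "\<dots> = scal (\<lambda>x. (-1) ^ ((p + q) * (r + s))) (b \<and>\<^sub>s a) K L x"
    by (simp add: wedge_alt scal_def sum_distrib_left)
  finally show "(a \<and>\<^sub>s b) K L x = scal (\<lambda>x. (-1) ^ ((p + q) * (r + s))) (b \<and>\<^sub>s a) K L x" .
qed

lemma wedge_commute_even:
  assumes "has_bidegree p q a" "has_bidegree r s b" "even (p + q)"
  shows "a \<and>\<^sub>s b = b \<and>\<^sub>s a"
  using wedge_commute[OF assms(1,2)] assms(3) by (simp add: scal_one)

lemma wedge_self_odd:
  assumes "has_bidegree p q a" "odd (p + q)"
  shows "a \<and>\<^sub>s a = 0"
proof (intro ext)
  fix I J x
  have "(a \<and>\<^sub>s a) I J x = - (a \<and>\<^sub>s a) I J x"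
    using assms(2) by (subst wedge_commute[OF assms(1,1)]) (simp add: scal_def)
  then show "(a \<and>\<^sub>s a) I J x = 0 I J x" by simp
qed

lemma has_bidegree_wedge:
  assumes "has_bidegree p q a" "has_bidegree r s b"
  shows "has_bidegree (p + r) (q + s) (a \<and>\<^sub>s b)"
  unfolding has_bidegree_def
proof (intro allI impI)
  fix K L x assume "(a \<and>\<^sub>s b) K L x \<noteq> 0"
  then obtain I where I: "I \<in> Pow K" "(\<Sum>J\<in>Pow L.
      wedge_sign I J (K - I) (L - J) * a I J x * b (K - I) (L - J) x) \<noteq> 0"
    unfolding wedge_alt by (rule sum.not_neutral_contains_not_neutral)
  from I(2) obtain J where "J \<in> Pow L" "wedge_sign I J (K - I) (L - J) * a I J x * b (K - I) (L - J) x \<noteq> 0"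
    by (rule sum.not_neutral_contains_not_neutral)
  then have "a I J x \<noteq> 0" "b (K - I) (L - J) x \<noteq> 0" "J \<subseteq> L" by auto
  with assms have "card I = p" "card J = q" "card (K - I) = r" "card (L - J) = s" "J \<subseteq> L"
    unfolding has_bidegree_def by blast+
  moreover have "I \<subseteq> K" using I(1) by simp
  ultimately show "card K = p + r \<and> card L = q + s"
    by (metis card_Diff_subset card_mono finite le_add_diff_inverse)
qed

lemma has_bidegree_add: "has_bidegree p q a \<Longrightarrow> has_bidegree p q b \<Longrightarrow> has_bidegree p q (a + b)"
  unfolding has_bidegree_def by (metis add.right_neutral plus_fun_apply)

lemma has_bidegree_zero: "has_bidegree p q 0"
  by (simp add: has_bidegree_def)

lemma has_bidegree_scal: "has_bidegree p q a \<Longrightarrow> has_bidegree p q (scal f a)"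
  by (auto simp: has_bidegree_def scal_def)

lemma has_bidegree_fun_form: "has_bidegree 0 0 (fun_form f)"
  by (simp add: has_bidegree_def fun_form_def)

lemma sum_Pow_eq_single:
  fixes g :: "'a::finite set \<Rightarrow> real"
  assumes "A \<subseteq> K" "\<And>I. I \<subseteq> K \<Longrightarrow> I \<noteq> A \<Longrightarrow> g I = 0"
  shows "(\<Sum>I\<in>Pow K. g I) = g A"
  using assms by (subst sum.mono_neutral_right[of _ "{A}"]) auto

lemma fun_form_wedge: "fun_form f \<and>\<^sub>s a = scal f a"
proof (intro ext)
  fix K L x
  show "(fun_form f \<and>\<^sub>s a) K L x = scal f a K L x"
    unfolding wedge_alt
    by (subst sum_Pow_eq_single[of "{}"], simp, simp add: fun_form_def,
        subst sum_Pow_eq_single[of "{}"]) (auto simp: fun_form_def wedge_sign_def scal_def)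
qed

lemma wedge_fun_form: "a \<and>\<^sub>s fun_form f = scal f a"
proof (intro ext)
  fix K L x
  show "(a \<and>\<^sub>s fun_form f) K L x = scal f a K L x"
  proof -
    have "(a \<and>\<^sub>s fun_form f) K L x = (\<Sum>J\<in>Pow L.
        wedge_sign K J (K - K) (L - J) * a K J x * fun_form f (K - K) (L - J) x)"
      unfolding wedge_alt by (rule sum_Pow_eq_single) (auto simp: fun_form_def)
    also have "\<dots> = wedge_sign K L (K - K) (L - L) * a K L x * fun_form f (K - K) (L - L) x"
      by (rule sum_Pow_eq_single) (auto simp: fun_form_def)
    finally show ?thesis by (simp add: fun_form_def wedge_sign_def scal_def)
  qed
qed

lemmas wedge_one_left = fun_form_wedge[of "\<lambda>x. 1", unfolded scal_one]
  and wedge_one_right = wedge_fun_form[of _ "\<lambda>x. 1", unfolded scal_one]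

section \<open>Forms of bidegree (1,0), (0,1) and (1,1)\<close>

definition covx :: "('n \<Rightarrow> real^'n::{finite,linorder} \<Rightarrow> real) \<Rightarrow> 'n superform" where
  "covx v = (\<lambda>I J x. if card I = 1 \<and> J = {} then v (the_elem I) x else 0)"

definition covxi :: "('n \<Rightarrow> real^'n::{finite,linorder} \<Rightarrow> real) \<Rightarrow> 'n superform" where
  "covxi v = (\<lambda>I J x. if I = {} \<and> card J = 1 then v (the_elem J) x else 0)"

text \<open>The form \<open>\<Sum> A\<^sub>j\<^sub>k dx\<^sub>j \<and> d\<xi>\<^sub>k\<close>.\<close>

definition mform :: "('n \<Rightarrow> 'n \<Rightarrow> real^'n::{finite,linorder} \<Rightarrow> real) \<Rightarrow> 'n superform" where
  "mform A = (\<lambda>I J x. if card I = 1 \<and> card J = 1 then A (the_elem I) (the_elem J) x else 0)"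

lemma covx_wedge_covxi: "covx u \<and>\<^sub>s covxi v = mform (\<lambda>j k x. u j x * v k x)"
proof (intro ext)
  fix K L x
  show "(covx u \<and>\<^sub>s covxi v) K L x = mform (\<lambda>j k x. u j x * v k x) K L x"
  proof -
    have "(covx u \<and>\<^sub>s covxi v) K L x = (\<Sum>J\<in>Pow L.
        wedge_sign K J (K - K) (L - J) * covx u K J x * covxi v (K - K) (L - J) x)"
      unfolding wedge_alt by (rule sum_Pow_eq_single) (auto simp: covxi_def)
    also have "\<dots> = wedge_sign K {} (K - K) (L - {}) * covx u K {} x * covxi v (K - K) (L - {}) x"
      by (rule sum_Pow_eq_single) (auto simp: covx_def)
    finally show ?thesis by (simp add: covx_def covxi_def wedge_sign_def mform_def)
  qed
qed

lemma Jop_covx: "Jop (covx v) = covxi v"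
  by (auto simp: Jop_def covx_def covxi_def fun_eq_iff)

lemma Jop_mform: "Jop (mform A) = mform (\<lambda>j k. A k j)"
  by (auto simp: Jop_def mform_def fun_eq_iff)

lemma mform_add: "mform A + mform B = mform (\<lambda>j k x. A j k x + B j k x)"
  and mform_diff: "mform A - mform B = mform (\<lambda>j k x. A j k x - B j k x)"
  and scal_mform: "scal f (mform A) = mform (\<lambda>j k x. f x * A j k x)"
  by (auto simp: mform_def scal_def fun_eq_iff)

lemma mform_sum: "(\<Sum>i\<in>S. mform (A i)) = mform (\<lambda>j k x. \<Sum>i\<in>S. A i j k x)"
  by (auto simp: mform_def sum_fun_apply fun_eq_iff)

lemma has_bidegree_covx: "has_bidegree 1 0 (covx v)"
  and has_bidegree_covxi: "has_bidegree 0 1 (covxi v)"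
  and has_bidegree_mform: "has_bidegree 1 1 (mform A)"
  by (auto simp: has_bidegree_def covx_def covxi_def mform_def)

lemma dx_covx: "dx k = covx (\<lambda>i x. if i = k then 1 else 0)"
  and dxi_covxi: "dxi k = covxi (\<lambda>i x. if i = k then 1 else 0)"
  by (auto simp: dx_def dxi_def covx_def covxi_def fun_eq_iff card_1_singleton_iff)

lemma beta_eq_sum: "beta = (\<Sum>i\<in>UNIV. mform (\<lambda>j k x. (if j = i then 1 else 0) * (if k = i then 1 else 0)))"
proof -
  have "beta = (\<Sum>j\<in>UNIV. dx j \<and>\<^sub>s dxi j)"
    by (simp add: beta_def fun_eq_iff sum_fun_apply)
  then show ?thesis unfolding dx_covx dxi_covxi covx_wedge_covxi .
qed

lemma beta_mform: "beta = mform (\<lambda>j k x. if j = k then 1 else 0)"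
  unfolding beta_eq_sum mform_sum
  by (simp add: if_distrib[of "\<lambda>c. c * _"] eq_commute cong: if_cong)

lemma mform_wedge_commute: "has_bidegree p q a \<Longrightarrow> mform A \<and>\<^sub>s a = a \<and>\<^sub>s mform A"
  by (rule wedge_commute_even[OF has_bidegree_mform]) auto

text \<open>The square contains the odd form \<open>covx u\<close> twice. Since \<open>mform\<close>
  has even total degree, the form between the two copies can be moved away, and
  \<open>covx u \<and>\<^sub>s covx u\<close> vanishes.\<close>

lemma mform_rank_one_sq: "mform (\<lambda>j k x. u j x * v k x) \<and>\<^sub>s mform (\<lambda>j k x. u j x * v k x) = 0"
proof -
  have "covx u \<and>\<^sub>s (covxi v \<and>\<^sub>s (covx u \<and>\<^sub>s covxi v)) = covx u \<and>\<^sub>s ((covx u \<and>\<^sub>s covxi v) \<and>\<^sub>s covxi v)"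
    unfolding covx_wedge_covxi by (subst mform_wedge_commute[OF has_bidegree_covxi]) simp
  also have "\<dots> = (covx u \<and>\<^sub>s covx u) \<and>\<^sub>s (covxi v \<and>\<^sub>s covxi v)" by (simp add: wedge_assoc)
  also have "covx u \<and>\<^sub>s covx u = 0" by (rule wedge_self_odd[OF has_bidegree_covx]) simp
  finally show ?thesis unfolding covx_wedge_covxi[symmetric] by (simp only: wedge_assoc wedge_zero_left)
qed

section \<open>Wedge powers\<close>

lemma wedge_list_Nil: "wedge_list [] = fun_form (\<lambda>x. 1)"
  and wedge_list_Cons: "wedge_list (a # as) = a \<and>\<^sub>s wedge_list as"
  by (simp_all add: wedge_list_def)

lemma wedge_power_0: "wedge_power a 0 = fun_form (\<lambda>x. 1)"
  and wedge_power_Suc: "wedge_power a (Suc m) = a \<and>\<^sub>s wedge_power a m"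
  by (simp_all add: wedge_power_def wedge_list_def)

lemma has_bidegree_wedge_power:
  "has_bidegree p q a \<Longrightarrow> has_bidegree (m * p) (m * q) (wedge_power a m)"
  by (induction m)
    (auto simp: wedge_power_0 wedge_power_Suc has_bidegree_fun_form intro: has_bidegree_wedge)

lemma has_bidegree_beta_power: "has_bidegree m m (wedge_power beta m)"
  using has_bidegree_wedge_power[OF has_bidegree_mform, of m] by (simp add: beta_mform)

text \<open>The binomial expansion for commuting elements stops after its linear term because z
  squares to zero. The hypothesis \<open>Z\<close> is commutation of b and z with a trailing
  factor.\<close>

lemma wedge_power_diff_nilpotent:
  assumes Z: "\<And>a. (b \<and>\<^sub>s z) \<and>\<^sub>s a = z \<and>\<^sub>s (b \<and>\<^sub>s a)" and z: "z \<and>\<^sub>s z = 0"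
  shows "wedge_power (scal \<rho> b - z) (Suc k) = scal (\<lambda>x. \<rho> x ^ Suc k) (wedge_power b (Suc k))
     - scal (\<lambda>x. real (Suc k) * \<rho> x ^ k) (wedge_power b k \<and>\<^sub>s z)"
proof (induction k)
  case 0
  show ?case by (simp add: wedge_power_0 wedge_power_Suc wedge_one_left wedge_one_right scal_one)
next
  case (Suc k)
  have comm: "z \<and>\<^sub>s wedge_power b j = wedge_power b j \<and>\<^sub>s z" for j
  proof (induction j)
    case (Suc j)
    have "z \<and>\<^sub>s (b \<and>\<^sub>s wedge_power b j) = b \<and>\<^sub>s (z \<and>\<^sub>s wedge_power b j)"
      using Z[of "wedge_power b j"] by (simp add: wedge_assoc)
    then show ?case using Suc by (simp add: wedge_power_Suc wedge_assoc)
  qed (simp add: wedge_power_0 wedge_one_left wedge_one_right)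
  have "z \<and>\<^sub>s (wedge_power b k \<and>\<^sub>s z) = wedge_power b k \<and>\<^sub>s (z \<and>\<^sub>s z)"
    by (metis comm wedge_assoc)
  then have nil: "z \<and>\<^sub>s (wedge_power b k \<and>\<^sub>s z) = 0" by (simp add: z wedge_zero_right)
  have "wedge_power (scal \<rho> b - z) (Suc (Suc k)) =
      (scal \<rho> b - z) \<and>\<^sub>s (scal (\<lambda>x. \<rho> x ^ Suc k) (wedge_power b (Suc k))
     - scal (\<lambda>x. real (Suc k) * \<rho> x ^ k) (wedge_power b k \<and>\<^sub>s z))"
    by (subst wedge_power_Suc) (simp only: Suc)
  also have "\<dots> = scal (\<lambda>x. \<rho> x * \<rho> x ^ Suc k) (wedge_power b (Suc (Suc k)))
     - scal (\<lambda>x. \<rho> x ^ Suc k) (wedge_power b (Suc k) \<and>\<^sub>s z)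
     - scal (\<lambda>x. \<rho> x * (real (Suc k) * \<rho> x ^ k)) (wedge_power b (Suc k) \<and>\<^sub>s z)"
    unfolding wedge_diff_left wedge_diff_right wedge_scal_left wedge_scal_right scal_scal nil scal_zero comm
      scal_diff
    by (simp only: wedge_power_Suc wedge_assoc diff_zero mult_ac)
  also have "\<dots> = scal (\<lambda>x. \<rho> x ^ Suc (Suc k)) (wedge_power b (Suc (Suc k)))
     - scal (\<lambda>x. real (Suc (Suc k)) * \<rho> x ^ Suc k) (wedge_power b (Suc k) \<and>\<^sub>s z)"
    by (simp add: scal_def fun_eq_iff algebra_simps)
  finally show ?case .
qed

lemma beta_diff_rank_one_power:
  "wedge_power (scal \<rho> beta - mform (\<lambda>j k x. y j x * y k x)) (Suc k) =
     scal (\<lambda>x. \<rho> x ^ Suc k) (wedge_power beta (Suc k))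
     - scal (\<lambda>x. real (Suc k) * \<rho> x ^ k) (wedge_power beta k \<and>\<^sub>s mform (\<lambda>j k x. y j x * y k x))"
proof (rule wedge_power_diff_nilpotent[OF _ mform_rank_one_sq])
  show "(beta \<and>\<^sub>s mform (\<lambda>j k x. y j x * y k x)) \<and>\<^sub>s a = mform (\<lambda>j k x. y j x * y k x) \<and>\<^sub>s (beta \<and>\<^sub>s a)" for a
    unfolding beta_mform by (subst mform_wedge_commute[OF has_bidegree_mform]) (simp add: wedge_assoc)
qed

section \<open>Minimal supercurrents\<close>

definition smooth_form :: "'n::{finite,linorder} superform \<Rightarrow> bool" where
  "smooth_form a \<longleftrightarrow> (\<forall>I J. smooth (a I J))"

lemma smooth_form_wedge:
  assumes "smooth_form a" "smooth_form b" shows "smooth_form (a \<and>\<^sub>s b)"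
proof -
  have "(a \<and>\<^sub>s b) K L = (\<lambda>x. \<Sum>I\<in>Pow K. \<Sum>J\<in>Pow L.
      wedge_sign I J (K - I) (L - J) * a I J x * b (K - I) (L - J) x)" for K L
    by (rule ext) (rule wedge_alt)
  then show ?thesis using assms unfolding smooth_form_def by (simp add: smooth_sum smooth_mult smooth_const)
qed

lemma smooth_form_add: "smooth_form a \<Longrightarrow> smooth_form b \<Longrightarrow> smooth_form (a + b)"
  by (simp add: smooth_form_def plus_fun_def smooth_add)

lemma smooth_form_scal: "smooth f \<Longrightarrow> smooth_form a \<Longrightarrow> smooth_form (scal f a)"
  by (simp add: smooth_form_def scal_def smooth_mult)

lemma smooth_form_zero: "smooth_form 0"
  by (simp add: smooth_form_def zero_fun_def smooth_const)

lemma smooth_if: "(P \<Longrightarrow> smooth f) \<Longrightarrow> smooth (\<lambda>x. if P then f x else 0)"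
  by (cases P) (auto intro: smooth_const)

lemma smooth_form_fun_form: "smooth f \<Longrightarrow> smooth_form (fun_form f)"
  and smooth_form_covx: "(\<And>j. smooth (v j)) \<Longrightarrow> smooth_form (covx v)"
  and smooth_form_covxi: "(\<And>j. smooth (v j)) \<Longrightarrow> smooth_form (covxi v)"
  and smooth_form_mform: "(\<And>j k. smooth (A j k)) \<Longrightarrow> smooth_form (mform A)"
  by (auto simp: smooth_form_def fun_form_def covx_def covxi_def mform_def intro!: smooth_if)

lemma smooth_form_beta: "smooth_form beta"
  unfolding beta_mform by (intro smooth_form_mform smooth_const)

lemma smooth_form_wedge_power: "smooth_form a \<Longrightarrow> smooth_form (wedge_power a k)"
  by (induction k) (auto simp: wedge_power_0 wedge_power_Suc smooth_form_fun_form smooth_const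
      intro: smooth_form_wedge)

lemma supported_in_wedge_right: "supported_in K b \<Longrightarrow> supported_in K (a \<and>\<^sub>s b)"
  by (simp add: supported_in_def wedge_def)

lemma test_formsI:
  assumes "has_bidegree p q a" "smooth_form a" "compact K" "K \<subseteq> D" "supported_in K a"
  shows "a \<in> test_forms D p q"
  using assms by (auto simp: test_forms_def smooth_form_def)

lemma scal_test_forms:
  assumes "testfun D f" "has_bidegree p q a" "smooth_form a"
  shows "scal f a \<in> test_forms D p q"
proof -
  obtain K where K: "compact K" "K \<subseteq> D" "\<And>x. x \<notin> K \<Longrightarrow> f x = 0"
    using assms(1) by (auto simp: testfun_def)
  show ?thesis
    by (rule test_formsI[OF has_bidegree_scal[OF assms(2)] smooth_form_scal[OF testfun_smooth[OF assms(1)] assms(3)] K(1,2)])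
      (simp add: supported_in_def scal_def K(3))
qed

lemma testfun_common_support:
  fixes A :: "'i::finite \<Rightarrow> real^'n::finite \<Rightarrow> real"
  assumes "\<And>i. testfun D (A i)"
  obtains K where "compact K" "K \<subseteq> D" "\<And>i x. x \<notin> K \<Longrightarrow> A i x = 0"
proof -
  have "\<forall>i. \<exists>K. compact K \<and> K \<subseteq> D \<and> (\<forall>x. x \<notin> K \<longrightarrow> A i x = 0)"
    using assms by (simp add: testfun_def)
  then obtain K where K: "\<And>i. compact (K i)" "\<And>i. K i \<subseteq> D" "\<And>i x. x \<notin> K i \<Longrightarrow> A i x = 0"
    by metis
  show thesis by (rule that[of "\<Union>i. K i"]) (use K in auto)
qed

lemma covxi_test_forms:
  assumes "\<And>j. testfun D (v j)" shows "covxi v \<in> test_forms D 0 1"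
proof -
  obtain K where K: "compact K" "K \<subseteq> D" "\<And>j x. x \<notin> K \<Longrightarrow> v j x = 0"
    by (rule testfun_common_support[OF assms]) (rule that)
  show ?thesis
    by (rule test_formsI[OF has_bidegree_covxi smooth_form_covxi K(1,2)])
      (use K(3) assms[THEN testfun_smooth] in \<open>auto simp: supported_in_def covxi_def\<close>)
qed

lemma wedge_mform_test_forms:
  assumes "\<And>j k. testfun D (A j k)" "has_bidegree p p b" "smooth_form b"
  shows "b \<and>\<^sub>s mform A \<in> test_forms D (Suc p) (Suc p)"
proof -
  obtain K where K: "compact K" "K \<subseteq> D" "\<And>i x. x \<notin> K \<Longrightarrow> A (fst i) (snd i) x = 0"
    by (rule testfun_common_support[of D "\<lambda>i. A (fst i) (snd i)"]) (rule assms(1), rule that)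
  have "supported_in K (mform A)"
    using K(3) by (auto simp: supported_in_def mform_def)
  moreover have "has_bidegree (Suc p) (Suc p) (b \<and>\<^sub>s mform A)"
    using has_bidegree_wedge[OF assms(2) has_bidegree_mform] by simp
  ultimately show ?thesis
    by (intro test_formsI[OF _ _ K(1,2)] supported_in_wedge_right smooth_form_wedge smooth_form_mform assms
        testfun_smooth[OF assms(1)])
qed

lemma fun_form_test_forms_iff: "fun_form f \<in> test_forms D 0 0 \<longleftrightarrow> testfun D f"
proof
  assume *: "fun_form f \<in> test_forms D 0 0"
  then have "smooth (fun_form f {} {})" unfolding test_forms_def by blast
  moreover have "fun_form f {} {} = f" by (simp add: fun_form_def fun_eq_iff)
  moreover obtain K where "compact K" "K \<subseteq> D" "supported_in K (fun_form f)"
    using * unfolding test_forms_def by blast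
  moreover from this have "f x = 0" if "x \<notin> K" for x
    using that \<open>fun_form f {} {} = f\<close> unfolding supported_in_def by metis
  ultimately show "testfun D f" by (metis testfunI)
next
  assume f: "testfun D f"
  then obtain K where K: "compact K" "K \<subseteq> D" "\<And>x. x \<notin> K \<Longrightarrow> f x = 0"
    by (auto simp: testfun_def)
  show "fun_form f \<in> test_forms D 0 0"
    by (rule test_formsI[OF has_bidegree_fun_form smooth_form_fun_form[OF testfun_smooth[OF f]] K(1,2)])
      (simp add: supported_in_def fun_form_def K(3))
qed

lemma pd_cmult: "f differentiable (at x) \<Longrightarrow> pd k (\<lambda>x. c * f x) x = c * pd k f x"
  using pd_mult[of "\<lambda>x. c" x f k] by simp

lemma pd_sum:
  assumes "\<And>i. i \<in> S \<Longrightarrow> smooth (f i)"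
  shows "pd k (\<lambda>x. \<Sum>i\<in>S. f i x) x = (\<Sum>i\<in>S. pd k (f i) x)"
  using assms
proof (induction S rule: infinite_finite_induct)
  case (insert i S)
  then show ?case
    by (simp add: pd_add smooth_differentiable smooth_sum)
qed auto

definition const_form :: "'n::{finite,linorder} superform \<Rightarrow> bool" where
  "const_form b \<longleftrightarrow> (\<forall>I J x. b I J x = b I J 0)"

lemma const_form_beta_power: "const_form (wedge_power beta k)"
proof (induction k)
  case 0
  then show ?case by (simp add: const_form_def wedge_power_0 fun_form_def)
next
  case (Suc k)
  have b: "beta I J x = beta I J 0" for I J :: "'a set" and x
    by (simp add: beta_mform mform_def)
  show ?case
    unfolding const_form_def wedge_power_Suc wedge_def
  proof (intro allI sum.cong refl)
    fix K L :: "'a set" and x I J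
    have "wedge_power beta k (K - I) (L - J) x = wedge_power beta k (K - I) (L - J) 0"
      using Suc unfolding const_form_def by blast
    then show "(- 1) ^ (card J * card (K - I)) * shuffle_sign I (K - I) * shuffle_sign J (L - J) *
        beta I J x * wedge_power beta k (K - I) (L - J) x =
        (- 1) ^ (card J * card (K - I)) * shuffle_sign I (K - I) * shuffle_sign J (L - J) *
        beta I J 0 * wedge_power beta k (K - I) (L - J) 0"
      using b[of I J x] by simp
  qed
qed

lemma pd_const_form_wedge:
  assumes "const_form b" "smooth_form c"
  shows "(\<lambda>I J. pd k ((b \<and>\<^sub>s c) I J)) = b \<and>\<^sub>s (\<lambda>I J. pd k (c I J))"
proof (intro ext)
  fix K L x
  let ?w = "\<lambda>I J. wedge_sign I J (K - I) (L - J) * b I J 0"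
  have c: "smooth (c I J)" for I J using assms(2) by (simp add: smooth_form_def)
  have b: "b I J x = b I J 0" for I J x using assms(1) unfolding const_form_def by blast
  have "(b \<and>\<^sub>s c) K L = (\<lambda>x. \<Sum>I\<in>Pow K. \<Sum>J\<in>Pow L. ?w I J * c (K - I) (L - J) x)"
    by (rule ext) (unfold wedge_alt, intro sum.cong refl, subst b, rule refl)
  then have "pd k ((b \<and>\<^sub>s c) K L) x = (\<Sum>I\<in>Pow K. \<Sum>J\<in>Pow L. ?w I J * pd k (c (K - I) (L - J)) x)"
    by (simp only:) (simp add: pd_sum pd_cmult smooth_sum smooth_mult smooth_const c smooth_differentiable)
  also have "\<dots> = (b \<and>\<^sub>s (\<lambda>I J. pd k (c I J))) K L x"
    unfolding wedge_alt b[of _ _ x] ..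
  finally show "pd k ((b \<and>\<^sub>s c) K L) x = (b \<and>\<^sub>s (\<lambda>I J. pd k (c I J))) K L x" .
qed

text \<open>A form with constant coefficients and even total degree lets \<open>ext_d\<close> pass
  through, leaving only the Jacobian of Y. Applied to powers of \<open>beta\<close>, this turns
  minimality into a statement about matrix fields.\<close>

lemma ext_d_wedge_covxi:
  assumes b: "const_form b" "has_bidegree p p b" and Y: "\<And>k. smooth (Y k)"
  shows "ext_d (b \<and>\<^sub>s covxi Y) = b \<and>\<^sub>s mform (\<lambda>j k. pd j (Y k))"
proof -
  have pdY: "(\<lambda>I J. pd i (covxi Y I J)) = covxi (\<lambda>k. pd i (Y k))" for i
  proof (intro ext)
    show "pd i (covxi Y I J) x = covxi (\<lambda>k. pd i (Y k)) I J x" for I J x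
      by (cases "I = {}"; cases "card J = 1") (simp_all add: covxi_def)
  qed
  have "ext_d (b \<and>\<^sub>s covxi Y) = (\<Sum>i\<in>UNIV. dx i \<and>\<^sub>s (\<lambda>I J. pd i ((b \<and>\<^sub>s covxi Y) I J)))"
    by (simp add: ext_d_def fun_eq_iff sum_fun_apply)
  also have "\<dots> = (\<Sum>i\<in>UNIV. dx i \<and>\<^sub>s (b \<and>\<^sub>s covxi (\<lambda>k. pd i (Y k))))"
    by (simp only: pd_const_form_wedge[OF b(1) smooth_form_covxi[OF Y]] pdY)
  also have "\<dots> = (\<Sum>i\<in>UNIV. b \<and>\<^sub>s (dx i \<and>\<^sub>s covxi (\<lambda>k. pd i (Y k))))"
  proof (intro sum.cong refl)
    fix i
    have "dx i \<and>\<^sub>s b = b \<and>\<^sub>s dx i"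
      unfolding dx_covx by (rule wedge_commute_even[OF b(2) has_bidegree_covx, symmetric]) simp
    then show "dx i \<and>\<^sub>s (b \<and>\<^sub>s covxi (\<lambda>k. pd i (Y k))) = b \<and>\<^sub>s (dx i \<and>\<^sub>s covxi (\<lambda>k. pd i (Y k)))"
      by (simp only: wedge_assoc[symmetric])
  qed
  also have "\<dots> = b \<and>\<^sub>s mform (\<lambda>j k x. \<Sum>i\<in>UNIV. (if j = i then 1 else 0) * pd i (Y k) x)"
    unfolding wedge_sum_right[symmetric] dx_covx covx_wedge_covxi mform_sum ..
  also have "mform (\<lambda>j k x. \<Sum>i\<in>UNIV. (if j = i then 1 else 0) * pd i (Y k) x) = mform (\<lambda>j k. pd j (Y k))"
    by (simp add: if_distrib[of "\<lambda>c. c * _"] cong: if_cong)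
  finally show ?thesis .
qed

lemma Jop_beta: "Jop beta = beta"
  unfolding beta_mform Jop_mform by (simp add: eq_commute)

lemma Jop_beta_power: "Jop (wedge_power beta k) = wedge_power beta k"
  by (induction k) (simp_all add: wedge_power_0 wedge_power_Suc Jop_wedge Jop_fun_form Jop_beta)

section \<open>Sums of products of squares\<close>

definition prod_form :: "('n \<Rightarrow> real^'n::{finite,linorder} \<Rightarrow> real) list \<Rightarrow> 'n superform" where
  "prod_form vs = wedge_list (map (\<lambda>v. mform (\<lambda>j k x. v j x * v k x)) vs)"

lemma prod_form_Nil: "prod_form [] = fun_form (\<lambda>x. 1)"
  and prod_form_Cons: "prod_form (v # vs) = mform (\<lambda>j k x. v j x * v k x) \<and>\<^sub>s prod_form vs"
  by (simp_all add: prod_form_def wedge_list_def)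

lemma has_bidegree_prod_form: "has_bidegree (length vs) (length vs) (prod_form vs)"
proof (induction vs)
  case (Cons v vs)
  show ?case using has_bidegree_wedge[OF has_bidegree_mform Cons] by (simp add: prod_form_Cons)
qed (simp add: prod_form_Nil has_bidegree_fun_form)

lemma smooth_form_prod_form: "(\<And>v j. v \<in> set vs \<Longrightarrow> smooth (v j)) \<Longrightarrow> smooth_form (prod_form vs)"
  by (induction vs) (auto simp: prod_form_Nil prod_form_Cons
      intro!: smooth_form_fun_form smooth_const smooth_form_wedge smooth_form_mform smooth_mult)

lemma prod_form_scal:
  "wedge_list (map (\<lambda>v. covx (\<lambda>j x. g x * v j x) \<and>\<^sub>s Jop (covx (\<lambda>j x. g x * v j x))) vs) =
    scal (\<lambda>x. g x ^ (2 * length vs)) (prod_form vs)"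
proof (induction vs)
  case (Cons v vs)
  have "covx (\<lambda>j x. g x * v j x) \<and>\<^sub>s Jop (covx (\<lambda>j x. g x * v j x)) =
      scal (\<lambda>x. g x ^ 2) (mform (\<lambda>j k x. v j x * v k x))"
    unfolding Jop_covx covx_wedge_covxi scal_mform by (simp add: power2_eq_square mult_ac)
  then show ?case
    by (simp add: Cons wedge_list_Cons prod_form_Cons wedge_scal_left wedge_scal_right scal_scal power_add
        power2_eq_square mult_ac)
qed (simp add: wedge_list_Nil prod_form_Nil scal_one)

text \<open>The strongly positive forms used to exploit weak positivity. A finite sum is encoded by
  the list of its summands, each a list of the k covector fields whose squares are wedged.
  Nonnegative weights stay outside, since a function need not have a smooth root of order 2 k;
  \<open>T_prod_form_nonneg\<close> brings them in.\<close>

definition poscone :: "nat \<Rightarrow> 'n::{finite,linorder} superform set" where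
  "poscone k = {\<omega>. \<exists>xss. \<omega> = sum_list (map prod_form xss) \<and>
     (\<forall>vs\<in>set xss. length vs = k \<and> (\<forall>v\<in>set vs. \<forall>j. smooth (v j)))}"

lemma poscone_zero: "0 \<in> poscone k"
  unfolding poscone_def by (intro CollectI exI[of _ "[]"]) auto

lemma poscone_one: "fun_form (\<lambda>x. 1) \<in> poscone 0"
  unfolding poscone_def by (intro CollectI exI[of _ "[[]]"]) (simp only: prod_form_Nil list.map sum_list.Cons sum_list.Nil add_0_right, simp)

lemma poscone_add:
  assumes "a \<in> poscone k" "b \<in> poscone k" shows "a + b \<in> poscone k"
proof -
  obtain xs ys where "a = sum_list (map prod_form xs)" "b = sum_list (map prod_form ys)"
    "\<forall>vs\<in>set xs. length vs = k \<and> (\<forall>v\<in>set vs. \<forall>j. smooth (v j))"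
    "\<forall>vs\<in>set ys. length vs = k \<and> (\<forall>v\<in>set vs. \<forall>j. smooth (v j))"
    using assms unfolding poscone_def by blast
  then show ?thesis unfolding poscone_def
    by (intro CollectI exI[of _ "xs @ ys"]) (simp only: map_append sum_list.append set_append ball_Un simp_thms)
qed

lemma poscone_sum: "(\<And>i. i \<in> S \<Longrightarrow> a i \<in> poscone k) \<Longrightarrow> (\<Sum>i\<in>S. a i) \<in> poscone k"
proof (induction S rule: infinite_finite_induct)
  case (insert i S)
  have "a i + sum a S \<in> poscone k" using insert by (intro poscone_add) auto
  then show ?case using insert by (simp only: sum.insert not_False_eq_True)
qed (simp_all only: sum.infinite sum.empty poscone_zero not_False_eq_True)

lemma poscone_wedge:
  assumes "\<And>j. smooth (v j)" "\<omega> \<in> poscone k"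
  shows "mform (\<lambda>j k x. v j x * v k x) \<and>\<^sub>s \<omega> \<in> poscone (Suc k)"
proof -
  obtain xs where xs: "\<omega> = sum_list (map prod_form xs)"
    "\<forall>vs\<in>set xs. length vs = k \<and> (\<forall>v\<in>set vs. \<forall>j. smooth (v j))"
    using assms(2) unfolding poscone_def by blast
  have "mform (\<lambda>j k x. v j x * v k x) \<and>\<^sub>s sum_list (map prod_form xs) = sum_list (map prod_form (map (Cons v) xs))"
    by (induction xs) (simp_all only: list.map sum_list.Nil sum_list.Cons wedge_zero_right wedge_add_right prod_form_Cons)
  moreover have "\<forall>vs\<in>set (map (Cons v) xs). length vs = Suc k \<and> (\<forall>v\<in>set vs. \<forall>j. smooth (v j))"
    using xs(2) assms(1) by auto
  ultimately show ?thesis unfolding poscone_def xs(1) by blast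
qed

lemma poscone_power:
  assumes "\<And>i j. i \<in> S \<Longrightarrow> smooth (v i j)"
  shows "wedge_power (\<Sum>i\<in>S. mform (\<lambda>j k x. v i j x * v i k x)) n \<in> poscone n"
proof (induction n)
  case (Suc n)
  then show ?case unfolding wedge_power_Suc wedge_sum_left
    by (intro poscone_sum poscone_wedge assms)
qed (simp add: wedge_power_0 poscone_one)

lemma poscone_beta_power: "wedge_power beta k \<in> poscone k"
  unfolding beta_eq_sum by (rule poscone_power) (rule smooth_const)

section \<open>Positivity, stationarity and symmetry of T on matrix fields\<close>

locale minimal_current =
  fixes D :: "(real^'n::{finite,linorder}) set" and m :: nat and T :: "'n supercurrent"
  assumes open_D: "open D" and minimal: "minimal_supercurrent D m T"
begin

lemma m: "1 \<le> m" "m \<le> CARD('n)"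
  using minimal by (auto simp: minimal_supercurrent_def)

lemma T_add: "a \<in> test_forms D m m \<Longrightarrow> b \<in> test_forms D m m \<Longrightarrow> T (a + b) = T a + T b"
  using minimal by (simp add: minimal_supercurrent_def supercurrent_def plus_fun_def)

lemma T_cmult: "a \<in> test_forms D m m \<Longrightarrow> T (scal (\<lambda>x. c) a) = c * T a"
  using minimal by (simp add: minimal_supercurrent_def supercurrent_def scal_def)

lemma T_scal_add:
  assumes "testfun D f" "testfun D g" "has_bidegree m m \<omega>" "smooth_form \<omega>"
  shows "T (scal (\<lambda>x. f x + g x) \<omega>) = T (scal f \<omega>) + T (scal g \<omega>)"
  unfolding scal_add_left using assms by (intro T_add scal_test_forms)

lemma T_scal_cmult:
  assumes "testfun D f" "has_bidegree m m \<omega>" "smooth_form \<omega>"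
  shows "T (scal (\<lambda>x. c * f x) \<omega>) = c * T (scal f \<omega>)"
  unfolding scal_scal[symmetric] using assms by (intro T_cmult scal_test_forms)

text \<open>Distributing the weight over the factors needs f^(1/(2 m)), which may fail to be smooth
  where f vanishes. So f + \<epsilon> is used and cut off by \<eta>; as \<eta> = 1 where f is
  nonzero, the error is \<epsilon> \<eta>^(2 m), and \<epsilon> is arbitrary.\<close>

lemma T_prod_form_nonneg:
  assumes f: "testfun D f" "\<And>x. 0 \<le> f x" and vs: "length vs = m" "\<And>v j. v \<in> set vs \<Longrightarrow> smooth (v j)"
  shows "0 \<le> T (scal f (prod_form vs))"
proof -
  obtain K where K: "compact K" "K \<subseteq> D" "\<And>x. x \<notin> K \<Longrightarrow> f x = 0"
    using f by (auto simp: testfun_def)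
  obtain \<eta> N where \<eta>: "testfun D \<eta>" "\<And>x. 0 \<le> \<eta> x" "K \<subseteq> N" "\<And>x. x \<in> N \<Longrightarrow> \<eta> x = 1"
    using cutoff_exists[OF K(1,2) open_D] by metis
  have \<eta>K: "\<eta> x = 1" if "f x \<noteq> 0" for x using that K(3) \<eta>(3,4) by blast
  have bd: "has_bidegree m m (prod_form vs)" using has_bidegree_prod_form[of vs] vs(1) by simp
  have sm: "smooth_form (prod_form vs)" using vs(2) by (rule smooth_form_prod_form)
  have \<eta>m: "testfun D (\<lambda>x. \<eta> x ^ (2 * m))"
  proof -
    obtain k where "2 * m = Suc k" using m(1) by (cases "2 * m") auto
    then show ?thesis using \<eta>(1) by (simp add: testfun_mult smooth_power testfun_smooth)
  qed
  have key: "0 \<le> T (scal f (prod_form vs)) + \<epsilon> * T (scal (\<lambda>x. \<eta> x ^ (2 * m)) (prod_form vs))"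
    if \<epsilon>: "0 < \<epsilon>" for \<epsilon>
  proof -
    define g where "g x = \<eta> x * (f x + \<epsilon>) powr (1 / (2 * m))" for x
    have pos: "0 < f x + \<epsilon>" for x using f(2)[of x] \<epsilon> by simp
    have g: "testfun D g" unfolding g_def
      by (intro testfun_mult \<eta>(1) smooth_powr smooth_intros testfun_smooth[OF f(1)] pos)
    have gm: "g x ^ (2 * m) = f x + \<epsilon> * \<eta> x ^ (2 * m)" for x
    proof -
      have "((f x + \<epsilon>) powr (1 / (2 * m))) ^ (2 * m) = f x + \<epsilon>"
        using pos[of x] m(1) by (simp add: powr_power)
      then have "g x ^ (2 * m) = \<eta> x ^ (2 * m) * (f x + \<epsilon>)"
        by (simp add: g_def power_mult_distrib)
      then show ?thesis using \<eta>K[of x] by (cases "f x = 0") (auto simp: algebra_simps)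
    qed
    let ?\<alpha> = "\<lambda>v. covx (\<lambda>j x. g x * v j x)"
    have "?\<alpha> v \<in> test_forms D 1 0" if "v \<in> set vs" for v
    proof -
      have "?\<alpha> v = scal g (covx v)" by (auto simp: scal_def covx_def fun_eq_iff)
      then show ?thesis
        using scal_test_forms[OF g has_bidegree_covx smooth_form_covx] vs(2)[OF that] by simp
    qed
    then have "0 \<le> T (wedge_list (map (\<lambda>a. a \<and>\<^sub>s Jop a) (map ?\<alpha> vs)))"
      using minimal vs(1) unfolding minimal_supercurrent_def weakly_positive_def by (metis (no_types, lifting) image_subsetI length_map list.set_map)
    also have "wedge_list (map (\<lambda>a. a \<and>\<^sub>s Jop a) (map ?\<alpha> vs)) = scal (\<lambda>x. f x + \<epsilon> * \<eta> x ^ (2 * m)) (prod_form vs)"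
      using prod_form_scal[of g vs] by (simp add: o_def vs(1) gm)
    also have "T \<dots> = T (scal f (prod_form vs)) + \<epsilon> * T (scal (\<lambda>x. \<eta> x ^ (2 * m)) (prod_form vs))"
      by (simp add: T_scal_add[OF f(1) testfun_cmult[OF \<eta>m] bd sm] T_scal_cmult[OF \<eta>m bd sm])
    finally show ?thesis .
  qed
  show ?thesis
  proof (rule ccontr)
    let ?c = "T (scal (\<lambda>x. \<eta> x ^ (2 * m)) (prod_form vs))" and ?t = "T (scal f (prod_form vs))"
    assume "\<not> 0 \<le> ?t"
    then have t: "?t < 0" by simp
    let ?e = "- ?t / (2 * (\<bar>?c\<bar> + 1))"
    have "0 < ?e" using t by (intro divide_pos_pos) auto
    then have "0 \<le> ?t + ?e * ?c" by (rule key)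
    moreover have "?e * ?c \<le> ?e * (\<bar>?c\<bar> + 1)" using \<open>0 < ?e\<close> by (intro mult_left_mono) auto
    moreover have "?e * (\<bar>?c\<bar> + 1) = - ?t / 2" by (simp add: field_simps)
    ultimately show False using t by linarith
  qed
qed

lemma poscone_props:
  assumes "\<omega> \<in> poscone k" shows "has_bidegree k k \<omega>" "smooth_form \<omega>"
proof -
  obtain xs where xs: "\<omega> = sum_list (map prod_form xs)"
    "\<forall>vs\<in>set xs. length vs = k \<and> (\<forall>v\<in>set vs. \<forall>j. smooth (v j))"
    using assms unfolding poscone_def by blast
  have "has_bidegree k k (sum_list (map prod_form xs)) \<and> smooth_form (sum_list (map prod_form xs))"
    using xs(2)
  proof (induction xs)
    case (Cons vs xs)
    have "has_bidegree k k (prod_form vs)" using Cons.prems has_bidegree_prod_form[of vs] by simp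
    moreover have "smooth_form (prod_form vs)" using Cons.prems by (intro smooth_form_prod_form) auto
    ultimately show ?case unfolding list.map sum_list.Cons
      using Cons by (intro conjI has_bidegree_add smooth_form_add) auto
  qed (simp add: has_bidegree_zero smooth_form_zero del: zero_fun_apply)
  then show "has_bidegree k k \<omega>" "smooth_form \<omega>" by (simp_all add: xs(1))
qed

lemma T_zero: "T 0 = 0"
proof -
  have "0 \<in> test_forms D m m"
    by (rule test_formsI[OF has_bidegree_zero smooth_form_zero, of "{}"]) (auto simp: supported_in_def)
  from T_cmult[OF this, of 0] show ?thesis by (simp add: scal_zero)
qed

lemma T_poscone_nonneg:
  assumes f: "testfun D f" "\<And>x. 0 \<le> f x" and \<omega>: "\<omega> \<in> poscone m"
  shows "0 \<le> T (scal f \<omega>)"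
proof -
  obtain xs where xs: "\<omega> = sum_list (map prod_form xs)"
    "\<forall>vs\<in>set xs. length vs = m \<and> (\<forall>v\<in>set vs. \<forall>j. smooth (v j))"
    using \<omega> unfolding poscone_def by blast
  have "0 \<le> T (scal f (sum_list (map prod_form xs)))" using xs(2)
  proof (induction xs)
    case Nil
    show ?case by (simp only: list.map sum_list.Nil scal_zero T_zero order_refl)
  next
    case (Cons vs xs)
    have c: "prod_form vs \<in> poscone m" unfolding poscone_def
      using Cons.prems by (intro CollectI exI[of _ "[vs]"]) (simp only: list.map sum_list.Cons sum_list.Nil add_0_right, simp)
    have d: "sum_list (map prod_form xs) \<in> poscone m" unfolding poscone_def using Cons.prems by auto
    have "T (scal f (sum_list (map prod_form (vs # xs)))) =
        T (scal f (prod_form vs)) + T (scal f (sum_list (map prod_form xs)))"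
      unfolding list.map sum_list.Cons scal_add
      by (intro T_add scal_test_forms f poscone_props[OF c] poscone_props[OF d])
    moreover have "0 \<le> T (scal f (prod_form vs))"
      using Cons.prems by (intro T_prod_form_nonneg f) auto
    moreover have "0 \<le> T (scal f (sum_list (map prod_form xs)))" using Cons by simp
    ultimately show ?case by linarith
  qed
  then show ?thesis by (simp add: xs(1))
qed

text \<open>T \<and> \<beta>^(m-1) as a functional on matrix fields. It plays the part of
  integrating the trace of A along the tangent planes of a varifold, and
  \<open>TT_divergence\<close> is then stationarity.\<close>

definition TT :: "('n \<Rightarrow> 'n \<Rightarrow> real^'n::{finite,linorder} \<Rightarrow> real) \<Rightarrow> real" where
  "TT A = T (wedge_power beta (m - 1) \<and>\<^sub>s mform A)"

lemma TT_form: "(\<And>j k. testfun D (A j k)) \<Longrightarrow> wedge_power beta (m - 1) \<and>\<^sub>s mform A \<in> test_forms D m m"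
  using wedge_mform_test_forms[OF _ has_bidegree_beta_power smooth_form_wedge_power[OF smooth_form_beta], of D A "m - 1"]
    m(1) by simp

lemma TT_add:
  assumes "\<And>j k. testfun D (A j k)" "\<And>j k. testfun D (B j k)"
  shows "TT (\<lambda>j k x. A j k x + B j k x) = TT A + TT B"
  unfolding TT_def mform_add[symmetric] wedge_add_right using assms by (intro T_add TT_form)

lemma TT_cmult:
  assumes "\<And>j k. testfun D (A j k)"
  shows "TT (\<lambda>j k x. c * A j k x) = c * TT A"
  unfolding TT_def scal_mform[symmetric] wedge_scal_right using assms by (intro T_cmult TT_form)

lemma TT_diff:
  assumes "\<And>j k. testfun D (A j k)" "\<And>j k. testfun D (B j k)"
  shows "TT (\<lambda>j k x. A j k x - B j k x) = TT A - TT B"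
proof -
  have "TT (\<lambda>j k x. A j k x + (-1) * B j k x) = TT A + TT (\<lambda>j k x. (-1) * B j k x)"
    by (intro TT_add assms testfun_cmult)
  also have "TT (\<lambda>j k x. (-1) * B j k x) = (-1) * TT B"
    by (intro TT_cmult assms)
  finally show ?thesis by simp
qed

lemma TT_divergence:
  assumes "\<And>k. testfun D (Y k)"
  shows "TT (\<lambda>j k. pd j (Y k)) = 0"
proof -
  have "current_wedge (current_d m m T) (wedge_power beta (m - 1)) (covxi Y) = 0"
    using minimal covxi_test_forms[of D Y, OF assms]
    unfolding minimal_supercurrent_def zero_current_def by blast
  then have "T (ext_d (wedge_power beta (m - 1) \<and>\<^sub>s covxi Y)) = 0"
    by (simp add: current_wedge_def current_d_def)
  then show ?thesis unfolding TT_def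
    by (subst (asm) ext_d_wedge_covxi[OF const_form_beta_power has_bidegree_beta_power testfun_smooth[OF assms]])
qed

text \<open>Powers of \<open>beta\<close> are fixed by J, so on these forms J acts by transposing
  the matrix.\<close>

lemma TT_transpose:
  assumes "\<And>j k. testfun D (A j k)"
  shows "TT (\<lambda>j k. A k j) = TT A"
proof -
  have "current_J T (wedge_power beta (m - 1) \<and>\<^sub>s mform A) = T (wedge_power beta (m - 1) \<and>\<^sub>s mform A)"
    using minimal TT_form[of A, OF assms]
    unfolding minimal_supercurrent_def symmetric_current_def by blast
  then show ?thesis
    by (simp add: TT_def current_J_def Jop_wedge Jop_beta_power Jop_mform)
qed

lemma beta_power_m: "beta \<and>\<^sub>s wedge_power beta (m - 1) = wedge_power beta m"
  using m(1) by (cases m) (simp_all add: wedge_power_Suc)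

lemma TT_identity: "TT (\<lambda>j k x. f x * (if j = k then 1 else 0)) = T (scal f (wedge_power beta m))"
proof -
  have "mform (\<lambda>j k x. f x * (if j = k then 1 else 0)) = scal f beta"
    by (simp add: beta_mform scal_mform)
  moreover have "wedge_power beta (m - 1) \<and>\<^sub>s (beta :: 'n superform) = wedge_power beta m"
    unfolding beta_power_m[symmetric] by (simp add: beta_mform mform_wedge_commute[OF has_bidegree_beta_power, unfolded beta_mform])
  ultimately show ?thesis by (simp add: TT_def wedge_scal_right)
qed

lemma TT_rank_one:
  "TT (\<lambda>j k x. f x * (v j x * v k x)) =
    T (scal f (wedge_power beta (m - 1) \<and>\<^sub>s mform (\<lambda>j k x. v j x * v k x)))"
  by (simp add: TT_def scal_mform[symmetric] wedge_scal_right)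

lemma TT_rank_one_nonneg:
  assumes "testfun D f" "\<And>x. 0 \<le> f x" "\<And>j. smooth (v j)"
  shows "0 \<le> TT (\<lambda>j k x. f x * (v j x * v k x))"
proof -
  have "mform (\<lambda>j k x. v j x * v k x) \<and>\<^sub>s wedge_power beta (m - 1) \<in> poscone (Suc (m - 1))"
    by (intro poscone_wedge assms poscone_beta_power)
  then have "wedge_power beta (m - 1) \<and>\<^sub>s mform (\<lambda>j k x. v j x * v k x) \<in> poscone m"
    using m(1) by (simp add: mform_wedge_commute[OF has_bidegree_beta_power])
  then show ?thesis unfolding TT_rank_one by (intro T_poscone_nonneg assms)
qed

text \<open>Lagrange's identity \<open>|y|\<^sup>2 |v|\<^sup>2 - (y \<bullet> v)\<^sup>2 = 1/2 \<Sum> (y\<^sub>i v\<^sub>j - y\<^sub>j v\<^sub>i)\<^sup>2\<close> writes \<open>|y|\<^sup>2 \<beta> - \<eta> \<and> \<eta>\<^sup>#\<close>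
  with \<open>\<eta> = \<Sum> y\<^sub>j dx\<^sub>j\<close> as a sum of squares. Its \<open>m\<close>-th power is
  \<open>|y|\<^bsup>2m\<^esup> \<beta>\<^sup>m - m |y|\<^bsup>2m-2\<^esup> \<beta>\<^bsup>m-1\<^esup> \<and> \<eta> \<and> \<eta>\<^sup>#\<close>.\<close>

lemma lagrange_mform:
  fixes y :: "'n \<Rightarrow> real^'n::{finite,linorder} \<Rightarrow> real"
  defines "v \<equiv> \<lambda>(i, j) p x. (y i x * (if p = j then 1 else 0) - y j x * (if p = i then 1 else 0)) / sqrt 2"
  shows "scal (\<lambda>x. \<Sum>i\<in>UNIV. y i x ^ 2) beta - mform (\<lambda>j k x. y j x * y k x) =
    (\<Sum>ij\<in>UNIV. mform (\<lambda>p q x. v ij p x * v ij q x))"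
proof -
  have "(\<Sum>ij\<in>UNIV. v ij p x * v ij q x) = (\<Sum>i\<in>UNIV. y i x ^ 2) * (if p = q then 1 else 0) - y p x * y q x"
    for p q x
  proof -
    let ?d = "\<lambda>p j. if p = j then 1 else (0::real)"
    have "(\<Sum>ij\<in>UNIV. v ij p x * v ij q x) = (\<Sum>i\<in>UNIV. \<Sum>j\<in>UNIV. v (i, j) p x * v (i, j) q x)"
      by (simp add: sum.cartesian_product)
    also have "\<dots> = (\<Sum>i\<in>UNIV. \<Sum>j\<in>UNIV. (y i x ^ 2 * (?d p j * ?d q j) - (y i x * ?d q i) * (y j x * ?d p j)
        - (y i x * ?d p i) * (y j x * ?d q j) + (?d p i * ?d q i) * y j x ^ 2) / 2)"
      unfolding v_def by (intro sum.cong refl) (simp add: field_simps power2_eq_square)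
    also have "\<dots> = ((\<Sum>i\<in>UNIV. y i x ^ 2) * (\<Sum>j\<in>UNIV. ?d p j * ?d q j)
        - (\<Sum>i\<in>UNIV. y i x * ?d q i) * (\<Sum>j\<in>UNIV. y j x * ?d p j)
        - (\<Sum>i\<in>UNIV. y i x * ?d p i) * (\<Sum>j\<in>UNIV. y j x * ?d q j)
        + (\<Sum>i\<in>UNIV. ?d p i * ?d q i) * (\<Sum>j\<in>UNIV. y j x ^ 2)) / 2"
      by (simp only: sum_divide_distrib[symmetric] sum.distrib sum_subtractf sum_product)
    also have "(\<Sum>j\<in>UNIV. ?d p j * ?d q j) = (if p = q then 1 else 0)"
      by (simp add: if_distrib[of "\<lambda>c. c * _"] eq_commute cong: if_cong)
    also have "(\<Sum>i\<in>UNIV. y i x * ?d q i) = y q x"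
      by (simp add: if_distrib[of "\<lambda>c. _ * c"] cong: if_cong)
    also have "(\<Sum>i\<in>UNIV. y i x * ?d p i) = y p x"
      by (simp add: if_distrib[of "\<lambda>c. _ * c"] cong: if_cong)
    finally show ?thesis by (simp add: field_simps)
  qed
  then show ?thesis
    unfolding mform_sum beta_mform scal_mform mform_diff by simp
qed

text \<open>An m-dimensional tangent plane has trace m, while one direction contributes at most 1;
  this is that ratio for currents. It follows from positivity of the m-th power of the sum of
  squares in \<open>lagrange_mform\<close>: the rank-one part is nilpotent and its linear term
  carries the factor m. The price is the weight \<rho>^(m-1), because y is not normalised and may
  vanish.\<close>

lemma TT_radial_le:
  fixes y :: "'n \<Rightarrow> real^'n::{finite,linorder} \<Rightarrow> real"
  assumes g: "testfun D g" "\<And>x. 0 \<le> g x" and y: "\<And>j. smooth (y j)"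
  defines "\<rho> \<equiv> \<lambda>x. \<Sum>i\<in>UNIV. y i x ^ 2"
  shows "real m * TT (\<lambda>j k x. g x * \<rho> x ^ (m - 1) * (y j x * y k x)) \<le> T (scal (\<lambda>x. g x * \<rho> x ^ m) (wedge_power beta m))"
proof -
  let ?N = "mform (\<lambda>j k x. y j x * y k x)"
  define v where "v = (\<lambda>(i, j) p x. (y i x * (if p = j then 1 else 0) - y j x * (if p = i then 1 else 0)) / sqrt 2)"
  have \<rho>: "smooth \<rho>" unfolding \<rho>_def by (intro smooth_intros y)
  have "smooth (v ij p)" for ij p
    unfolding v_def by (cases ij) (auto intro!: smooth_divide smooth_intros y)
  then have "wedge_power (\<Sum>ij\<in>UNIV. mform (\<lambda>p q x. v ij p x * v ij q x)) m \<in> poscone m"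
    by (intro poscone_power)
  moreover have "scal \<rho> beta - ?N = (\<Sum>ij\<in>UNIV. mform (\<lambda>p q x. v ij p x * v ij q x))"
    unfolding \<rho>_def v_def by (rule lagrange_mform)
  ultimately have c: "wedge_power (scal \<rho> beta - ?N) m \<in> poscone m" by simp
  have gm: "testfun D (\<lambda>x. g x * \<rho> x ^ k)" for k by (intro testfun_mult smooth_power \<rho> g)
  have bd: "has_bidegree m m (wedge_power beta m)" "has_bidegree m m (wedge_power beta (m - 1) \<and>\<^sub>s ?N)"
    using has_bidegree_beta_power has_bidegree_wedge[OF has_bidegree_beta_power has_bidegree_mform, of "m - 1"] m(1)
    by auto
  have sf: "smooth_form (wedge_power beta m)" "smooth_form (wedge_power beta (m - 1) \<and>\<^sub>s ?N)"
    by (intro smooth_form_wedge smooth_form_wedge_power smooth_form_beta smooth_form_mform smooth_mult y)+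
  have "wedge_power (scal \<rho> beta - ?N) m = scal (\<lambda>x. \<rho> x ^ m) (wedge_power beta m)
     - scal (\<lambda>x. real m * \<rho> x ^ (m - 1)) (wedge_power beta (m - 1) \<and>\<^sub>s ?N)"
    using beta_diff_rank_one_power[of \<rho> y "m - 1"] m(1) by simp
  then have "scal g (wedge_power (scal \<rho> beta - ?N) m) = scal (\<lambda>x. g x * \<rho> x ^ m) (wedge_power beta m)
     + scal (\<lambda>x. (- real m) * (g x * \<rho> x ^ (m - 1))) (wedge_power beta (m - 1) \<and>\<^sub>s ?N)"
    by (simp only: scal_diff scal_scal) (simp add: scal_def fun_eq_iff algebra_simps)
  moreover have "0 \<le> T (scal g (wedge_power (scal \<rho> beta - ?N) m))"
    by (intro T_poscone_nonneg g c)
  moreover have "T (scal (\<lambda>x. g x * \<rho> x ^ m) (wedge_power beta m)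
     + scal (\<lambda>x. (- real m) * (g x * \<rho> x ^ (m - 1))) (wedge_power beta (m - 1) \<and>\<^sub>s ?N)) =
     T (scal (\<lambda>x. g x * \<rho> x ^ m) (wedge_power beta m)) +
     (- real m) * T (scal (\<lambda>x. g x * \<rho> x ^ (m - 1)) (wedge_power beta (m - 1) \<and>\<^sub>s ?N))"
    by (simp only: T_add[OF scal_test_forms[OF gm bd(1) sf(1)] scal_test_forms[OF testfun_cmult[OF gm] bd(2) sf(2)]]
      T_scal_cmult[OF gm bd(2) sf(2)])
  ultimately show ?thesis by (simp add: TT_rank_one)
qed

section \<open>The mass measure and the first variation\<close>

lemma mass_functional: "positive_functional D (\<lambda>f. T (scal f (wedge_power beta m)) / fact m)"
proof
  note b = has_bidegree_beta_power[of m] smooth_form_wedge_power[OF smooth_form_beta, of m]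
  show "T (scal (\<lambda>x. f x + g x) (wedge_power beta m)) / fact m =
      T (scal f (wedge_power beta m)) / fact m + T (scal g (wedge_power beta m)) / fact m"
    if "testfun D f" "testfun D g" for f g
    by (simp add: T_scal_add[OF that b] add_divide_distrib)
  show "T (scal (\<lambda>x. c * f x) (wedge_power beta m)) / fact m = c * (T (scal f (wedge_power beta m)) / fact m)"
    if "testfun D f" for c f
    by (simp add: T_scal_cmult[OF that b])
  show "0 \<le> T (scal f (wedge_power beta m)) / fact m" if "testfun D f" "\<And>x. 0 \<le> f x" for f
    using T_poscone_nonneg[OF that poscone_beta_power] by simp
qed (rule open_D)

text \<open>\<open>measure_of_current\<close> is a choice, so nothing is known of it before a
  representing measure exists; \<open>riesz_representation\<close> provides one. The factor
  \<open>fact m\<close> undoes the normalisation of the mass.\<close>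

lemma mass_measure_props:
  shows sets_mass: "sets (mass_measure D m T) = sets (restrict_space borel D)"
    and mass_compact: "compact K \<Longrightarrow> K \<subseteq> D \<Longrightarrow> emeasure (mass_measure D m T) K < \<infinity>"
    and mass_integral: "testfun D f \<Longrightarrow>
      T (scal f (wedge_power beta m)) = fact m * (LINT x|mass_measure D m T. f x)"
proof -
  let ?S = "current_wedge T (\<lambda>I J x. wedge_power beta m I J x / fact m)"
  let ?P = "\<lambda>\<mu>. sets \<mu> = sets (restrict_space borel D) \<and>
     (\<forall>K. compact K \<and> K \<subseteq> D \<longrightarrow> emeasure \<mu> K < \<infinity>) \<and>
     (\<forall>f. fun_form f \<in> test_forms D 0 0 \<longrightarrow> ?S (fun_form f) = (LINT x|\<mu>. f x))"
  have S: "?S (fun_form f) = T (scal f (wedge_power beta m)) / fact m" if "testfun D f" for f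
  proof -
    have "(\<lambda>I J x. wedge_power beta m I J x / fact m) \<and>\<^sub>s fun_form f =
        scal (\<lambda>x. (1 / fact m) * f x) (wedge_power beta m)"
      unfolding wedge_fun_form by (simp add: scal_def fun_eq_iff)
    then show ?thesis
      using T_scal_cmult[OF that has_bidegree_beta_power smooth_form_wedge_power[OF smooth_form_beta], of "1 / fact m"]
      by (simp add: current_wedge_def)
  qed
  have "\<exists>\<mu>. ?P \<mu>"
    using positive_functional.riesz_representation[OF mass_functional] S
    by (simp add: fun_form_test_forms_iff)
  then have P: "?P (mass_measure D m T)"
    unfolding mass_measure_def measure_of_current_def by (rule someI_ex)
  then show "sets (mass_measure D m T) = sets (restrict_space borel D)" by blast
  show "compact K \<Longrightarrow> K \<subseteq> D \<Longrightarrow> emeasure (mass_measure D m T) K < \<infinity>" using P by blast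
  show "T (scal f (wedge_power beta m)) = fact m * (LINT x|mass_measure D m T. f x)" if "testfun D f"
    using P that S[OF that] by (simp add: fun_form_test_forms_iff field_simps)
qed

text \<open>Only the antisymmetric part of the Jacobian of \<open>\<phi> (x - a) + b q\<close> has no sign, and it is not
  seen by a symmetric current; this is what the shape of the gradients of \<open>\<phi>\<close> and \<open>b\<close> is made for.\<close>

lemma first_variation_inequality:
  fixes a q :: "real^'n::{finite,linorder}"
  defines "\<rho> \<equiv> \<lambda>x. (norm (x - a))\<^sup>2"
  assumes t: "testfun D \<phi>" "testfun D b" "testfun D g" "testfun D \<psi>" "testfun D h"
    and pos: "\<And>x. 0 \<le> g x" "\<And>x. 0 \<le> h x"
    and d\<phi>: "\<And>j x. pd j \<phi> x = - (g x * \<rho> x ^ (m - 1)) * (x - a) $ j + \<psi> x * q $ j"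
    and db: "\<And>j x. pd j b x = - \<psi> x * (x - a) $ j + h x * q $ j"
  shows "(LINT x|mass_measure D m T. real m * \<phi> x - g x * \<rho> x ^ m) \<le> 0"
proof -
  define y where "y j x = x $ j - a $ j" for j :: 'n and x
  have y: "smooth (y j)" for j unfolding y_def by (intro smooth_intros)
  have \<rho>: "\<rho> x = (\<Sum>i\<in>UNIV. y i x ^ 2)" for x
    unfolding \<rho>_def y_def power2_norm_eq_inner by (simp add: inner_vec_def power2_eq_square)
  have s\<rho>: "smooth \<rho>" unfolding \<rho>_def by (rule smooth_norm_sq)
  define Y where "Y k x = \<phi> x * y k x + b x * q $ k" for k x
  have Y: "testfun D (Y k)" for k
    unfolding Y_def by (intro testfun_add testfun_mult t y smooth_const)
  have pdy: "pd j (y k) x = (if j = k then 1 else 0)" for j k x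
  proof -
    have "((\<lambda>x. x $ k - a $ k) has_derivative (\<lambda>v. v $ k - 0)) (at x)"
      by (intro has_derivative_diff has_derivative_const bounded_linear_imp_has_derivative bounded_linear_vec_nth)
    from pd_eqI[OF this, of j] show ?thesis by (simp add: y_def[abs_def] axis_def)
  qed
  \<comment> \<open>A is the isotropic part, B the radial part and E the q-q term. The coefficient
    \<psi> has opposite signs in \<open>d\<phi>\<close> and \<open>db\<close>, so the mixed part is
    C minus its transpose.\<close>
  define A where "A j k x = \<phi> x * (if j = k then 1 else 0)" for j k :: 'n and x
  define B where "B j k x = g x * \<rho> x ^ (m - 1) * (y j x * y k x)" for j k x
  define C where "C j k x = \<psi> x * (q $ j * y k x)" for j k x
  define E where "E j k x = h x * (q $ j * q $ k)" for j k x
  have tt: "testfun D (A j k)" "testfun D (B j k)" "testfun D (C j k)" "testfun D (E j k)" for j k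
    unfolding A_def B_def C_def E_def by (intro testfun_mult t smooth_const smooth_mult smooth_power y s\<rho>)+
  have "pd j (Y k) x = ((A j k x - B j k x) + (C j k x - C k j x)) + E j k x" for j k x
  proof -
    have "pd j (Y k) x = (\<phi> x * pd j (y k) x + pd j \<phi> x * y k x) + pd j b x * q $ k"
      unfolding Y_def using t(1,2)[THEN testfun_smooth] y[of k]
      by (simp add: pd_add pd_mult smooth_differentiable smooth_mult smooth_const)
    then show ?thesis
      by (simp add: pdy d\<phi> db A_def B_def C_def E_def y_def algebra_simps)
  qed
  then have "(\<lambda>j k. pd j (Y k)) = (\<lambda>j k x. ((A j k x - B j k x) + (C j k x - C k j x)) + E j k x)"
    by (intro ext)
  with TT_divergence[of Y, OF Y] have "TT (\<lambda>j k x. ((A j k x - B j k x) + (C j k x - C k j x)) + E j k x) = 0"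
    by simp
  moreover have "TT (\<lambda>j k x. ((A j k x - B j k x) + (C j k x - C k j x)) + E j k x) =
      ((TT A - TT B) + (TT C - TT (\<lambda>j k. C k j))) + TT E"
    by (simp add: TT_add TT_diff tt testfun_add testfun_diff)
  ultimately have "TT A - TT B + TT E = 0" using TT_transpose[of C] tt(3) by simp
  moreover have "0 \<le> TT E"
    unfolding E_def by (rule TT_rank_one_nonneg[OF t(5) pos(2) smooth_const])
  ultimately have "real m * TT A \<le> real m * TT B" by (intro mult_left_mono) auto
  also have "\<dots> \<le> T (scal (\<lambda>x. g x * \<rho> x ^ m) (wedge_power beta m))"
    unfolding B_def \<rho> by (rule TT_radial_le[OF t(3) pos(1) y])
  finally have "real m * T (scal \<phi> (wedge_power beta m)) \<le> T (scal (\<lambda>x. g x * \<rho> x ^ m) (wedge_power beta m))"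
    unfolding A_def TT_identity .
  moreover have gt: "testfun D (\<lambda>x. g x * \<rho> x ^ m)" by (intro testfun_mult t smooth_power s\<rho>)
  moreover have "T (scal (\<lambda>x. real m * \<phi> x - g x * \<rho> x ^ m) (wedge_power beta m)) =
      real m * T (scal \<phi> (wedge_power beta m)) - T (scal (\<lambda>x. g x * \<rho> x ^ m) (wedge_power beta m))"
    using positive_functional.S_diff[OF mass_functional testfun_cmult[OF t(1), of m] gt]
      positive_functional.S_cmult[OF mass_functional t(1), of m]
    by (simp add: field_simps)
  moreover have "testfun D (\<lambda>x. real m * \<phi> x - g x * \<rho> x ^ m)"
    by (intro testfun_diff testfun_cmult t gt)
  ultimately have "fact m * (LINT x|mass_measure D m T. real m * \<phi> x - g x * \<rho> x ^ m) \<le> 0"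
    using mass_integral by simp
  then show ?thesis
    using mult_le_cancel_left_pos[of "fact m :: real" "LINT x|mass_measure D m T. real m * \<phi> x - g x * \<rho> x ^ m" 0]
    by simp
qed

end

section \<open>The test vector field\<close>

text \<open>Once a function is known to be differentiable, its partial derivatives can be read off
  along coordinate lines. This reduces the gradients of the fields to one-variable rules.\<close>

lemma pd_eq_DERIV:
  assumes "f differentiable (at x)" "((\<lambda>s. f (x + s *\<^sub>R axis k 1)) has_real_derivative d) (at 0)"
  shows "pd k f x = d"
proof -
  have "((\<lambda>s::real. x + s *\<^sub>R axis k 1) has_derivative (\<lambda>s. s *\<^sub>R axis k 1)) (at 0)"
    by (auto intro!: derivative_eq_intros)
  moreover have "(f has_derivative frechet_derivative f (at x)) (at (x + 0 *\<^sub>R axis k 1))"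
    using has_derivative_pd[OF assms(1)] by simp
  ultimately have "((\<lambda>s. f (x + s *\<^sub>R axis k 1)) has_derivative (\<lambda>s. frechet_derivative f (at x) (s *\<^sub>R axis k 1))) (at 0)"
    by (rule has_derivative_compose)
  moreover have "frechet_derivative f (at x) (s *\<^sub>R axis k 1) = pd k f x * s" for s
    using linear_scale[OF linear_frechet_derivative[OF assms(1)]] by (simp add: pd_def)
  ultimately have "((\<lambda>s. f (x + s *\<^sub>R axis k 1)) has_real_derivative pd k f x) (at 0)"
    by (simp add: has_field_derivative_def)
  then show ?thesis using assms(2) by (rule DERIV_unique)
qed

text \<open>A smooth convex substitute for max u 0 with error at most \<kappa>. The slope
  \<open>ramp1\<close> lies between 0 and 1, so the mass term stays below the mass of a compact set;
  \<open>ramp2\<close> is nonnegative, which gives the sign of the q-q term.\<close>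

definition ramp :: "real \<Rightarrow> real \<Rightarrow> real" where "ramp \<kappa> u = u * flat \<kappa> 0 u"
definition ramp1 :: "real \<Rightarrow> real \<Rightarrow> real" where "ramp1 \<kappa> u = flat \<kappa> 0 u + \<kappa> * flat \<kappa> 1 u"
definition ramp2 :: "real \<Rightarrow> real \<Rightarrow> real" where "ramp2 \<kappa> u = \<kappa>\<^sup>2 * flat \<kappa> 3 u"

lemma flat_Suc: "u * flat \<kappa> (Suc k) u = flat \<kappa> k u"
  by (simp add: flat_def)

lemma DERIV_ramp: "0 < \<kappa> \<Longrightarrow> (ramp \<kappa> has_real_derivative ramp1 \<kappa> u) (at u)"
  unfolding ramp_def[abs_def] ramp1_def
  by (rule DERIV_cong[OF DERIV_mult[OF DERIV_ident DERIV_flat]])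
    (use flat_Suc[of u \<kappa> 1] in \<open>auto simp: algebra_simps numeral_2_eq_2\<close>)

lemma DERIV_ramp1: "0 < \<kappa> \<Longrightarrow> (ramp1 \<kappa> has_real_derivative ramp2 \<kappa> u) (at u)"
  unfolding ramp1_def[abs_def] ramp2_def
  by (rule DERIV_cong[OF DERIV_add[OF DERIV_flat DERIV_cmult[OF DERIV_flat]]])
    (auto simp: algebra_simps power2_eq_square numeral_2_eq_2 numeral_3_eq_3)

lemma ramp_nonneg: "0 \<le> ramp \<kappa> u"
  by (cases "u \<le> 0") (simp_all add: ramp_def flat_nonneg)

lemma ramp1_nonneg: "0 < \<kappa> \<Longrightarrow> 0 \<le> ramp1 \<kappa> u"
  and ramp2_nonneg: "0 \<le> ramp2 \<kappa> u"
  by (simp_all add: ramp1_def ramp2_def flat_nonneg)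

lemma ramp_nonpos: "u \<le> 0 \<Longrightarrow> ramp \<kappa> u = 0" "u \<le> 0 \<Longrightarrow> ramp1 \<kappa> u = 0" "u \<le> 0 \<Longrightarrow> ramp2 \<kappa> u = 0"
  by (simp_all add: ramp_def ramp1_def ramp2_def)

text \<open>With y = \<kappa> / u the slope is exp (-y) (1 + y).\<close>

lemma ramp1_le_1: "0 < \<kappa> \<Longrightarrow> ramp1 \<kappa> u \<le> 1"
proof (cases "0 < u")
  case True
  have "1 + \<kappa> / u \<le> exp (\<kappa> / u)" by (rule exp_ge_add_one_self)
  then have "exp (- (\<kappa> / u)) * (1 + \<kappa> / u) \<le> exp (- (\<kappa> / u)) * exp (\<kappa> / u)"
    by (intro mult_left_mono) auto
  also have "\<dots> = 1" by (simp add: exp_minus)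
  finally show ?thesis using True by (simp add: ramp1_def flat_def algebra_simps)
qed (simp add: ramp_nonpos)

lemma ramp_ge: "0 < \<kappa> \<Longrightarrow> u - \<kappa> \<le> ramp \<kappa> u"
proof (cases "0 < u")
  case True
  have "1 - \<kappa> / u \<le> exp (- \<kappa> / u)" using exp_ge_add_one_self[of "- \<kappa> / u"] by simp
  then have "u * (1 - \<kappa> / u) \<le> u * exp (- \<kappa> / u)" using True by (intro mult_left_mono) auto
  then show ?thesis using True by (simp add: ramp_def flat_def algebra_simps)
qed (simp add: ramp_nonpos)

lemma jsmooth_ramp:
  assumes "0 < \<kappa>" "jsmooth f"
  shows "jsmooth (\<lambda>t x. ramp \<kappa> (f t x))" "jsmooth (\<lambda>t x. ramp1 \<kappa> (f t x))" "jsmooth (\<lambda>t x. ramp2 \<kappa> (f t x))"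
  unfolding ramp_def ramp1_def ramp2_def
  by (intro jsmooth_intros jsmooth_flat assms)+

section \<open>The smoothed power of the radius\<close>

locale radial_profile =
  fixes m p :: nat and d :: real
  assumes m1: "1 \<le> m" and mp: "m \<le> p" and even_p: "even p" and d_pos: "0 < d"
begin

text \<open>A smooth substitute for \<open>max (s\<^sup>m\<^sup>/\<^sup>2) (d\<^sup>m\<^sup>/\<^sup>2\<^sup>p)\<close>, where \<open>s\<close> stands for \<open>|x - a|\<^sup>2\<close>. Taking
  \<open>p\<close> even keeps it smooth for negative \<open>s\<close>.\<close>

definition \<Theta> :: "real \<Rightarrow> real" where "\<Theta> s = (s ^ p + d) powr (m / (2 * p))"
definition \<Theta>1 :: "real \<Rightarrow> real" where "\<Theta>1 s = m / 2 * s ^ (p - 1) * (s ^ p + d) powr (m / (2 * p) - 1)"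

lemma base_pos: "0 < s ^ p + d"
  using zero_le_even_power[OF even_p, of s] d_pos by linarith

lemma \<Theta>_pos: "0 < \<Theta> s"
  using base_pos[of s] by (simp add: \<Theta>_def)

lemma DERIV_\<Theta>: "(\<Theta> has_real_derivative \<Theta>1 s) (at s)"
proof -
  have "((\<lambda>s. s ^ p + d) has_real_derivative real p * s ^ (p - 1)) (at s)"
    by (auto intro!: derivative_eq_intros)
  from DERIV_chain2[OF has_real_derivative_powr[OF base_pos] this]
  have "(\<Theta> has_real_derivative (m / (2 * p) * (s ^ p + d) powr (m / (2 * p) - 1)) * (real p * s ^ (p - 1))) (at s)"
    unfolding \<Theta>_def[abs_def] .
  moreover have "(m / (2 * p) * (s ^ p + d) powr (m / (2 * p) - 1)) * (real p * s ^ (p - 1)) = \<Theta>1 s"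
    using m1 mp by (simp add: \<Theta>1_def)
  ultimately show ?thesis by simp
qed

lemma \<Theta>_mono: "0 \<le> s \<Longrightarrow> s \<le> t \<Longrightarrow> \<Theta> s \<le> \<Theta> t"
  unfolding \<Theta>_def using base_pos[of s] by (intro powr_mono2 add_right_mono power_mono) auto

lemma \<Theta>_ge: "0 \<le> r \<Longrightarrow> r ^ m \<le> \<Theta> (r\<^sup>2)"
proof -
  assume r: "0 \<le> r"
  have "r ^ m = ((r\<^sup>2) ^ p) powr (m / (2 * p))"
  proof (cases "r = 0")
    case False
    then have "0 < r" using r by simp
    then have "(r\<^sup>2) ^ p = r powr real (2 * p)"
      by (simp only: powr_realpow power_mult)
    then have "((r\<^sup>2) ^ p) powr (m / (2 * p)) = r powr (real (2 * p) * (m / (2 * p)))"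
      by (simp only: powr_powr)
    also have "real (2 * p) * (m / (2 * p)) = real m" using m1 mp by simp
    finally show ?thesis using \<open>0 < r\<close> by (simp add: powr_realpow)
  qed (use m1 mp in \<open>auto simp: power_0_left\<close>)
  also have "\<dots> \<le> \<Theta> (r\<^sup>2)"
    unfolding \<Theta>_def using d_pos by (intro powr_mono2) auto
  finally show ?thesis .
qed

lemma \<Theta>_unbounded: "\<exists>L>0. \<forall>s\<ge>0. W \<le> \<Theta> (s + L)"
\<comment> \<open>A radius r \<ge> 1 satisfies r \<le> r^m, so it suffices that r is also at least
  W; sqrt (1 + W^2) does both.\<close>
proof (intro exI[of _ "1 + W\<^sup>2"] conjI allI impI)
  show "0 < 1 + W\<^sup>2" by (rule add_pos_nonneg) auto
  fix s :: real assume s: "0 \<le> s"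
  let ?r = "sqrt (1 + W\<^sup>2)"
  have "1 \<le> ?r" by simp
  have "W \<le> ?r" by (rule real_le_rsqrt) simp
  also have "?r \<le> ?r ^ m" using \<open>1 \<le> ?r\<close> m1 by (intro self_le_power) auto
  also have "\<dots> \<le> \<Theta> (?r\<^sup>2)" by (intro \<Theta>_ge) (simp add: add_nonneg_nonneg)
  also have "\<dots> \<le> \<Theta> (s + (1 + W\<^sup>2))" using s by (intro \<Theta>_mono) (auto simp: add_nonneg_nonneg)
  finally show "W \<le> \<Theta> (s + (1 + W\<^sup>2))" .
qed

lemma jsmooth_\<Theta>:
  assumes "jsmooth s"
  shows "jsmooth (\<lambda>t x. \<Theta> (s t x))"
  unfolding \<Theta>_def by (intro jsmooth_powr jsmooth_intros assms base_pos)

text \<open>One rule for two uses: with r and v both moving it gives the gradients of the fields,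
  with v constant it gives the derivative in the integration variable of b. The same radial terms
  arise in both, which is why the latter can be integrated exactly.\<close>

lemma DERIV_quotient:
  assumes A: "\<And>u. (A has_real_derivative A1 u) (at u)"
    and r: "(r has_real_derivative r') (at \<tau>)" and v: "(v has_real_derivative v') (at \<tau>)"
  shows "((\<lambda>\<tau>. A (v \<tau> - \<Theta> (r \<tau>)) / \<Theta> (r \<tau>)) has_real_derivative
    A1 (v \<tau> - \<Theta> (r \<tau>)) / \<Theta> (r \<tau>) * v' - \<Theta>1 (r \<tau>) *
      (A1 (v \<tau> - \<Theta> (r \<tau>)) / \<Theta> (r \<tau>) + A (v \<tau> - \<Theta> (r \<tau>)) / (\<Theta> (r \<tau>))\<^sup>2) * r') (at \<tau>)"
proof -
  have T: "((\<lambda>\<tau>. \<Theta> (r \<tau>)) has_real_derivative \<Theta>1 (r \<tau>) * r') (at \<tau>)"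
    by (rule DERIV_chain2[OF DERIV_\<Theta> r])
  have N: "((\<lambda>\<tau>. A (v \<tau> - \<Theta> (r \<tau>))) has_real_derivative A1 (v \<tau> - \<Theta> (r \<tau>)) * (v' - \<Theta>1 (r \<tau>) * r')) (at \<tau>)"
    by (rule DERIV_chain2[OF A DERIV_diff[OF v T]])
  have nz: "\<Theta> (r \<tau>) \<noteq> 0" using \<Theta>_pos[of "r \<tau>"] by simp
  show ?thesis
    by (rule DERIV_cong[OF DERIV_divide[OF N T nz]]) (use nz in \<open>simp add: field_simps power2_eq_square\<close>)
qed

end

section \<open>The inequality obtained from the smoothed field\<close>

context minimal_current begin

lemma mass_sets: "A \<in> sets borel \<Longrightarrow> A \<subseteq> D \<Longrightarrow> A \<in> sets (mass_measure D m T)"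
  using open_D by (simp add: sets_mass sets_restrict_space_iff)

lemma mass_integrable:
  assumes "testfun D f" shows "integrable (mass_measure D m T) f"
proof (rule testfun_integrable[OF assms])
  have "f \<in> borel_measurable (restrict_space borel D)"
    using testfun_borel_measurable[OF assms] by (rule measurable_restrict_space1)
  then show "f \<in> borel_measurable (mass_measure D m T)"
    using measurable_cong_sets[OF sets_mass refl] by blast
qed (use mass_compact mass_sets in \<open>auto simp: compact_imp_closed\<close>)

text \<open>This is the first variation of the smoothed field. The weights d / (\<rho>^p + d) and
  \<rho>^p / (\<rho>^p + d) add up to 1. For large p the first is close to the indicator of the ball
  where \<rho>^p < d, so the left side is the contribution of the singularity, spread over that
  ball; the right side is a smoothed mass of the set where \<theta> < w.\<close>

lemma weighted_area_inequality:
  fixes a q :: "real^'n::{finite,linorder}" and c :: real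
  defines "\<rho> \<equiv> \<lambda>x. (norm (x - a))\<^sup>2" and "w \<equiv> \<lambda>x. c + q \<bullet> (x - a)"
  assumes K: "compact {x. norm (x - a) ^ m \<le> w x}" "{x. norm (x - a) ^ m \<le> w x} \<subseteq> D"
    and p: "m \<le> p" "even p" and d: "0 < d" and \<kappa>: "0 < \<kappa>"
  defines "\<theta> \<equiv> \<lambda>x. (\<rho> x ^ p + d) powr (m / (2 * p))"
  shows "testfun D (\<lambda>x. d / (\<rho> x ^ p + d) * (ramp \<kappa> (w x - \<theta> x) / \<theta> x))"
    and "testfun D (\<lambda>x. \<rho> x ^ p / (\<rho> x ^ p + d) * ramp1 \<kappa> (w x - \<theta> x))"
    and "(LINT x|mass_measure D m T. d / (\<rho> x ^ p + d) * (ramp \<kappa> (w x - \<theta> x) / \<theta> x))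
      \<le> (LINT x|mass_measure D m T. \<rho> x ^ p / (\<rho> x ^ p + d) * ramp1 \<kappa> (w x - \<theta> x))"
proof -
  interpret radial_profile m p d by unfold_locales (use m p d in auto)
  let ?K = "{x. norm (x - a) ^ m \<le> w x}"
  have \<theta>: "\<theta> x = \<Theta> (\<rho> x)" for x by (simp add: \<theta>_def \<Theta>_def)
  have \<rho>0: "0 \<le> \<rho> x" for x by (simp add: \<rho>_def)
  have j\<rho>: "jsmooth (\<lambda>t. \<rho>)" unfolding \<rho>_def by (rule jsmooth_norm_sq)
  have jw: "jsmooth (\<lambda>t. w)"
    unfolding w_def inner_diff_right
    by (intro jsmooth_add jsmooth_diff jsmooth_const jsmooth_linear bounded_linear_inner_right)
  \<comment> \<open>Stated for a shifted squared radius because b and h integrate over such shifts;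
    the support in \<open>?K\<close> of all five functions comes from here.\<close>
  have out: "w x - \<Theta> (\<rho> x + s) \<le> 0" if "x \<notin> ?K" "0 \<le> s" for x s
  proof -
    have "w x \<le> norm (x - a) ^ m" using that by simp
    also have "\<dots> \<le> \<Theta> (\<rho> x)" unfolding \<rho>_def by (rule \<Theta>_ge) simp
    also have "\<dots> \<le> \<Theta> (\<rho> x + s)" using that \<rho>0 by (intro \<Theta>_mono) auto
    finally show ?thesis by simp
  qed
  have out0: "w x - \<Theta> (\<rho> x) \<le> 0" if "x \<notin> ?K" for x using out[OF that, of 0] by simp
  obtain W where W: "\<And>x. x \<in> ?K \<Longrightarrow> w x \<le> W"
  proof -
    have "smooth w" using jw by (simp add: smooth_on_iff_jsmooth)
    then have "bounded (w ` ?K)"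
      by (intro compact_imp_bounded compact_continuous_image K smooth_continuous)
    then obtain B where "\<And>x. x \<in> ?K \<Longrightarrow> norm (w x) \<le> B" by (auto simp: bounded_iff)
    then show thesis by (intro that[of B]) force
  qed
  \<comment> \<open>After the shift L of the squared radius, \<Theta> is at least w everywhere, so
    the integral defining b can stop there.\<close>
  obtain L where L: "0 < L" "\<And>s. 0 \<le> s \<Longrightarrow> W \<le> \<Theta> (s + L)" using \<Theta>_unbounded[of W] by blast
  have far: "w x - \<Theta> (\<rho> x + L) \<le> 0" for x
    using W[of x] L(2)[OF \<rho>0[of x]] out[of x L] L(1) by (cases "x \<in> ?K") auto
  \<comment> \<open>The squared radius s is kept apart from x so that it can be shifted.
    \<open>F ramp\<close> at s = \<rho> is \<phi>, and \<open>F ramp1\<close>, its derivative in w,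
    is \<psi>.\<close>
  define F where "F A s x = A \<kappa> (w x - \<Theta> s) / \<Theta> s" for A :: "real \<Rightarrow> real \<Rightarrow> real" and s x
  have jF: "jsmooth (\<lambda>t x. F A (s t x) x)"
    if "jsmooth s" "\<And>f. jsmooth f \<Longrightarrow> jsmooth (\<lambda>t (x::real^'n::{finite,linorder}). A \<kappa> (f t x))"
    for A and s :: "real \<Rightarrow> real^'n::{finite,linorder} \<Rightarrow> real"
    unfolding F_def by (intro jsmooth_divide that jsmooth_diff jw jsmooth_\<Theta> \<Theta>_pos)
  note jr = jsmooth_ramp[OF \<kappa>]
  have sF: "smooth (\<lambda>x. F ramp (\<rho> x) x)" "smooth (\<lambda>x. F ramp1 (\<rho> x) x)"
    unfolding smooth_on_iff_jsmooth by (intro jF j\<rho> jr; assumption)+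
  have line: "((\<lambda>s. \<rho> (x + s *\<^sub>R axis k 1)) has_real_derivative 2 * (x - a) $ k) (at 0)"
    "((\<lambda>s. w (x + s *\<^sub>R axis k 1)) has_real_derivative q $ k) (at 0)" for x k
  proof -
    have "\<rho> (x + s *\<^sub>R axis k 1) = \<rho> x + 2 * s * (x - a) $ k + s * s" for s
      unfolding \<rho>_def power2_norm_eq_inner
      by (simp add: algebra_simps inner_axis inner_axis')
    then show "((\<lambda>s. \<rho> (x + s *\<^sub>R axis k 1)) has_real_derivative 2 * (x - a) $ k) (at 0)"
      by (auto intro!: derivative_eq_intros)
    have "w (x + s *\<^sub>R axis k 1) = w x + s * q $ k" for s
      unfolding w_def by (simp add: algebra_simps inner_axis)
    then show "((\<lambda>s. w (x + s *\<^sub>R axis k 1)) has_real_derivative q $ k) (at 0)"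
      by (auto intro!: derivative_eq_intros)
  qed
  have lineF: "((\<lambda>s. F A (\<rho> (x + s *\<^sub>R axis k 1) + e) (x + s *\<^sub>R axis k 1)) has_real_derivative
      F A1 (\<rho> x + e) x * q $ k - \<Theta>1 (\<rho> x + e) * (F A1 (\<rho> x + e) x + F A (\<rho> x + e) x / \<Theta> (\<rho> x + e)) * (2 * (x - a) $ k)) (at 0)"
    if "\<And>u. (A \<kappa> has_real_derivative A1 \<kappa> u) (at u)" for A A1 x k e
  proof -
    have "((\<lambda>s. \<rho> (x + s *\<^sub>R axis k 1) + e) has_real_derivative 2 * (x - a) $ k) (at 0)"
      by (rule DERIV_cong[OF DERIV_add[OF line(1) DERIV_const]]) simp
    from DERIV_quotient[OF that this line(2)] show ?thesis
      by (simp add: F_def power2_eq_square)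
  qed
  define G where "G x = F ramp1 (\<rho> x) x + F ramp (\<rho> x) x / \<Theta> (\<rho> x)" for x
  \<comment> \<open>The coefficient of x - a in the gradient of \<phi> is -2 \<Theta>1 G. As
    \<Theta>1 contains \<rho>^(p-1) and p \<ge> m, the weight \<rho>^(m-1) required by
    \<open>first_variation_inequality\<close> splits off and g stays smooth at a.\<close>
  define g where "g x = real m * \<rho> x ^ (p - m) * (\<rho> x ^ p + d) powr (m / (2 * p) - 1) * G x" for x
  have g_eq: "2 * \<Theta>1 (\<rho> x) * G x = g x * \<rho> x ^ (m - 1)" for x
  proof -
    have "\<rho> x ^ (p - 1) = \<rho> x ^ (p - m) * \<rho> x ^ (m - 1)"
      using m(1) p(1) by (simp add: power_add[symmetric])
    then show ?thesis by (simp add: \<Theta>1_def g_def)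
  qed
  let ?\<phi> = "\<lambda>x. F ramp (\<rho> x) x" and ?\<psi> = "\<lambda>x. F ramp1 (\<rho> x) x"
  \<comment> \<open>Half the integral of \<open>F ramp1\<close> over s from \<rho> to \<rho> + L,
    moved to a fixed interval. Without smoothing the integrand is s^(-m/2), and s = t^2 turns it
    into the integral of t^(1-m).\<close>
  define b where "b x = L / 2 * integral {0..1} (\<lambda>t. F ramp1 (\<rho> x + t * L) x)" for x
  define h where "h x = L / 2 * integral {0..1} (\<lambda>t. F ramp2 (\<rho> x + t * L) x)" for x
  have jline: "jsmooth (\<lambda>t x. \<rho> x + t * L)"
    by (intro jsmooth_add j\<rho> jsmooth_fun_of_t continuous_intros)
  have jF1: "jsmooth (\<lambda>t x. F ramp1 (\<rho> x + t * L) x)"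
    by (rule jF[OF jline]) (rule jr)
  have jF2: "jsmooth (\<lambda>t x. F ramp2 (\<rho> x + t * L) x)"
    by (rule jF[OF jline]) (rule jr)
  have sb: "smooth b" and sh: "smooth h"
    unfolding b_def h_def smooth_on_iff_jsmooth
    by (intro jsmooth_cmult jsmooth_integral(1) jF1 jF2)+
  have sG: "smooth G"
    unfolding G_def
    by (intro smooth_add sF smooth_divide \<Theta>_pos) (use jsmooth_\<Theta>[OF j\<rho>] in \<open>simp add: smooth_on_iff_jsmooth\<close>)
  have s\<rho>: "smooth \<rho>" using j\<rho> by (simp add: smooth_on_iff_jsmooth)
  have sg: "smooth g"
    unfolding g_def by (intro smooth_mult smooth_const smooth_power smooth_powr smooth_add s\<rho> sG base_pos)
  have F0: "F ramp (\<rho> x) x = 0" "F ramp1 (\<rho> x) x = 0" if "x \<notin> ?K" for x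
    using out0[OF that] by (simp_all add: F_def ramp_nonpos)
  have Ft0: "F ramp1 (\<rho> x + t * L) x = 0" "F ramp2 (\<rho> x + t * L) x = 0" if "x \<notin> ?K" "t \<in> {0..1}" for x t
    using out[OF that(1), of "t * L"] that(2) L(1) by (simp_all add: F_def ramp_nonpos)
  have tests: "testfun D ?\<phi>" "testfun D b" "testfun D g" "testfun D ?\<psi>" "testfun D h"
  proof -
    show "testfun D ?\<phi>" "testfun D ?\<psi>" by (intro testfunI[OF _ K] sF F0; assumption)+
    show "testfun D g" by (rule testfunI[OF sg K]) (simp add: g_def G_def F0)
    show "testfun D b"
    proof (rule testfunI[OF sb K])
      fix x assume x: "x \<notin> ?K"
      have "integral {0..1} (\<lambda>t. F ramp1 (\<rho> x + t * L) x) = integral {0..1} (\<lambda>t::real. 0)"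
        by (rule Henstock_Kurzweil_Integration.integral_cong) (rule Ft0(1)[OF x])
      then show "b x = 0" by (simp add: b_def)
    qed
    show "testfun D h"
    proof (rule testfunI[OF sh K])
      fix x assume x: "x \<notin> ?K"
      have "integral {0..1} (\<lambda>t. F ramp2 (\<rho> x + t * L) x) = integral {0..1} (\<lambda>t::real. 0)"
        by (rule Henstock_Kurzweil_Integration.integral_cong) (rule Ft0(2)[OF x])
      then show "h x = 0" by (simp add: h_def)
    qed
  qed
  have Fnn: "0 \<le> F ramp s x" "0 \<le> F ramp1 s x" "0 \<le> F ramp2 s x" for s x
    using \<Theta>_pos[of s] \<kappa> by (simp_all add: F_def ramp_nonneg ramp1_nonneg ramp2_nonneg)
  have g0: "0 \<le> g x" for x
    unfolding g_def G_def using \<rho>0[of x] Fnn \<Theta>_pos[of "\<rho> x"] by (intro mult_nonneg_nonneg add_nonneg_nonneg) auto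
  have int2: "(\<lambda>t. F ramp2 (\<rho> x + t * L) x) integrable_on {0..1}" for x
  proof (rule integrable_continuous_interval)
    have "continuous_on {0..1} (\<lambda>t. (t, x))" by (intro continuous_intros)
    from continuous_on_compose2[OF jsmooth_continuous[OF jF2] this]
    show "continuous_on {0..1} (\<lambda>t. F ramp2 (\<rho> x + t * L) x)" by simp
  qed
  have h0: "0 \<le> h x" for x
    unfolding h_def using L(1) Fnn
    by (intro mult_nonneg_nonneg Henstock_Kurzweil_Integration.integral_nonneg int2) auto
  have d\<phi>: "pd j ?\<phi> x = - (g x * \<rho> x ^ (m - 1)) * (x - a) $ j + ?\<psi> x * q $ j" for j x
  proof (rule pd_eq_DERIV[OF smooth_differentiable[OF sF(1)]])
    show "((\<lambda>s. F ramp (\<rho> (x + s *\<^sub>R axis j 1)) (x + s *\<^sub>R axis j 1)) has_real_derivative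
        - (g x * \<rho> x ^ (m - 1)) * (x - a) $ j + ?\<psi> x * q $ j) (at 0)"
      by (rule DERIV_cong[OF lineF[of ramp ramp1 x j 0, OF DERIV_ramp[OF \<kappa>], unfolded add_0_right]])
        (unfold g_eq[symmetric] G_def, simp add: algebra_simps)
  qed
  have db: "pd j b x = - ?\<psi> x * (x - a) $ j + h x * q $ j" for j x
  proof -
    let ?S = "\<lambda>t. \<Theta>1 (\<rho> x + t * L) * (F ramp2 (\<rho> x + t * L) x + F ramp1 (\<rho> x + t * L) x / \<Theta> (\<rho> x + t * L))"
    have pdF: "pd j (\<lambda>x. F ramp1 (\<rho> x + t * L) x) x = F ramp2 (\<rho> x + t * L) x * q $ j - ?S t * (2 * (x - a) $ j)" for t
      by (rule pd_eq_DERIV[OF jsmooth_differentiable[OF jF1] lineF[of ramp1 ramp2, OF DERIV_ramp1[OF \<kappa>]]])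
    \<comment> \<open>\<open>?S\<close> is the t-derivative of \<open>F ramp1\<close> divided by -L,
      so its integral sees only the endpoints: the upper one vanishes by \<open>far\<close>, the
      lower one is \<psi>. This is the exact relation between b and \<phi>.\<close>
    have "(?S has_integral ((- (1 / L) * F ramp1 (\<rho> x + 1 * L) x) - (- (1 / L) * F ramp1 (\<rho> x + 0 * L) x))) {0..1}"
    proof (rule fundamental_theorem_of_calculus)
      fix t :: real
      have "((\<lambda>t. \<rho> x + t * L) has_real_derivative L) (at t)" by (auto intro!: derivative_eq_intros)
      from DERIV_quotient[OF DERIV_ramp1[OF \<kappa>] this DERIV_const[of "w x"]]
      have "((\<lambda>t. F ramp1 (\<rho> x + t * L) x) has_real_derivative - (?S t * L)) (at t)"
        by (simp add: F_def power2_eq_square)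
      from DERIV_cmult[OF this, of "- (1 / L)"]
      have "((\<lambda>t. - (1 / L) * F ramp1 (\<rho> x + t * L) x) has_real_derivative ?S t) (at t)"
        using L(1) by simp
      then show "((\<lambda>t. - (1 / L) * F ramp1 (\<rho> x + t * L) x) has_vector_derivative ?S t) (at t within {0..1})"
        by (simp add: has_real_derivative_iff_has_vector_derivative has_vector_derivative_at_within)
    qed simp
    moreover have "F ramp1 (\<rho> x + L) x = 0" using far[of x] by (simp add: F_def ramp_nonpos)
    ultimately have S: "(?S has_integral ?\<psi> x / L) {0..1}" by simp
    have "((\<lambda>t. F ramp2 (\<rho> x + t * L) x) has_integral integral {0..1} (\<lambda>t. F ramp2 (\<rho> x + t * L) x)) {0..1}"
      by (rule integrable_integral[OF int2])
    then have "((\<lambda>t. F ramp2 (\<rho> x + t * L) x * q $ j - ?S t * (2 * (x - a) $ j)) has_integral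
        integral {0..1} (\<lambda>t. F ramp2 (\<rho> x + t * L) x) * q $ j - ?\<psi> x / L * (2 * (x - a) $ j)) {0..1}"
      by (intro has_integral_diff has_integral_mult_left S)
    then have "integral {0..1} (\<lambda>t. pd j (\<lambda>x. F ramp1 (\<rho> x + t * L) x) x) =
        integral {0..1} (\<lambda>t. F ramp2 (\<rho> x + t * L) x) * q $ j - ?\<psi> x / L * (2 * (x - a) $ j)"
      unfolding pdF by (rule integral_unique)
    then have "pd j b x = L / 2 * (integral  {0..1} (\<lambda>t. F ramp2 (\<rho> x + t * L) x) * q $ j - ?\<psi> x / L * (2 * (x - a) $ j))"
      using jsmooth_integral[OF jF1] unfolding b_def
      by (subst pd_cmult) (auto intro: jsmooth_differentiable)
    also have "\<dots> = - ?\<psi> x * (x - a) $ j + h x * q $ j"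
      using L(1) by (simp add: h_def right_diff_distrib del: vector_minus_component)
    finally show ?thesis .
  qed
  have "(LINT x|mass_measure D m T. real m * ?\<phi> x - g x * \<rho> x ^ m) \<le> 0"
    using first_variation_inequality[OF tests g0 h0, of a q] d\<phi> db by (simp add: \<rho>_def)
  \<comment> \<open>For \<Theta> = r^m the terms with \<phi> would cancel. The smoothing leaves the
    fraction d / (\<rho>^p + d) of \<phi>, and this remainder is what the singularity
    contributes.\<close>
  moreover have eq: "real m * ?\<phi> x - g x * \<rho> x ^ m = real m * (d / (\<rho> x ^ p + d) * (ramp \<kappa> (w x - \<theta> x) / \<theta> x)
      - \<rho> x ^ p / (\<rho> x ^ p + d) * ramp1 \<kappa> (w x - \<theta> x))" for x
  proof -
    let ?B = "\<rho> x ^ p + d"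
    have B: "0 < ?B" by (rule base_pos)
    have "\<rho> x ^ p = \<rho> x ^ (p - m) * \<rho> x ^ m" using p(1) by (simp add: power_add[symmetric])
    moreover have "?B powr (m / (2 * p) - 1) = \<theta> x / ?B" using B by (simp add: powr_diff \<theta>_def)
    ultimately have "g x * \<rho> x ^ m = real m * \<rho> x ^ p * (\<theta> x / ?B) * G x" by (simp add: g_def)
    also have "\<dots> = real m * (\<rho> x ^ p / ?B) * (\<theta> x * G x)" by simp
    also have "\<theta> x * G x = ramp1 \<kappa> (w x - \<theta> x) + ?\<phi> x"
      using \<Theta>_pos[of "\<rho> x"] by (simp add: G_def F_def \<theta> distrib_left)
    finally have *: "g x * \<rho> x ^ m = real m * (\<rho> x ^ p / ?B) * (ramp1 \<kappa> (w x - \<theta> x) + ?\<phi> x)" .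
    have split: "M * u - M * P * (A + u) = M * (e * u - P * A)" if "e + P = 1" for M u P A e :: real
    proof -
      have e: "e = 1 - P" using that by simp
      show ?thesis unfolding e by (simp add: algebra_simps)
    qed
    have "d / ?B + \<rho> x ^ p / ?B = 1" using B by (simp add: add_divide_distrib[symmetric])
    from split[OF this, of "real m" "?\<phi> x" "ramp1 \<kappa> (w x - \<theta> x)"] show ?thesis
      unfolding * by (simp only: F_def \<theta>)
  qed
  moreover show t1: "testfun D (\<lambda>x. d / (\<rho> x ^ p + d) * (ramp \<kappa> (w x - \<theta> x) / \<theta> x))"
    using testfun_mult'[OF smooth_divide[OF smooth_const smooth_add[OF smooth_power[OF s\<rho>] smooth_const] base_pos] tests(1)]
    by (simp add: F_def \<theta>)
  moreover show t2: "testfun D (\<lambda>x. \<rho> x ^ p / (\<rho> x ^ p + d) * ramp1 \<kappa> (w x - \<theta> x))"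
  proof (rule testfunI[OF _ K])
    have "smooth (\<lambda>x. \<rho> x ^ p / (\<rho> x ^ p + d) * (\<Theta> (\<rho> x) * ?\<psi> x))"
      using jsmooth_\<Theta>[OF j\<rho>]
      by (intro smooth_mult smooth_divide smooth_power smooth_add s\<rho> smooth_const base_pos sF)
        (simp add: smooth_on_iff_jsmooth)
    moreover have "\<Theta> (\<rho> x) * ?\<psi> x = ramp1 \<kappa> (w x - \<theta> x)" for x
      using \<Theta>_pos[of "\<rho> x"] by (simp add: F_def \<theta>)
    ultimately show "smooth (\<lambda>x. \<rho> x ^ p / (\<rho> x ^ p + d) * ramp1 \<kappa> (w x - \<theta> x))" by simp
    show "\<rho> x ^ p / (\<rho> x ^ p + d) * ramp1 \<kappa> (w x - \<theta> x) = 0" if "x \<notin> ?K" for x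
      using out0[OF that] by (simp add: \<theta> ramp_nonpos)
  qed
  ultimately have "real m * (LINT x|mass_measure D m T. (d / (\<rho> x ^ p + d) * (ramp \<kappa> (w x - \<theta> x) / \<theta> x)
      - \<rho> x ^ p / (\<rho> x ^ p + d) * ramp1 \<kappa> (w x - \<theta> x))) \<le> 0"
    unfolding eq by simp
  then show "(LINT x|mass_measure D m T. d / (\<rho> x ^ p + d) * (ramp \<kappa> (w x - \<theta> x) / \<theta> x))
      \<le> (LINT x|mass_measure D m T. \<rho> x ^ p / (\<rho> x ^ p + d) * ramp1 \<kappa> (w x - \<theta> x))"
    unfolding mult_le_0_iff Bochner_Integration.integral_diff[OF mass_integrable[OF t1] mass_integrable[OF t2]]
    using m(1) by (simp only: diff_le_0_iff_le of_nat_le_0_iff) linarith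
qed

section \<open>Mass of small balls\<close>

lemma compact_mass:
  assumes "compact K" "K \<subseteq> D"
  shows "K \<in> fmeasurable (mass_measure D m T)"
  using assms mass_compact[OF assms] mass_sets[of K]
  by (intro fmeasurableI) (auto simp: compact_imp_closed)

lemma ball_mass:
  assumes "cball a r \<subseteq> D"
  shows "ball a r \<in> fmeasurable (mass_measure D m T)"
  using assms mass_sets[of "ball a r"] order_trans[OF ball_subset_cball assms]
  by (intro fmeasurableI2[OF compact_mass[of "cball a r"]]) auto

text \<open>\<Theta> is levelled off around the radius \<delta> = r / l by taking d = \<delta>^(2
  p). On the ball of radius r one has \<rho>^p \<le> l^(2 p) d, so the errors from \<Theta> are
  powers of z = 1 + l^(2 p), which tends to 1 with p when l < 1.\<close>

lemma ball_mass_le_aux: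
  fixes a q :: "real^'n::{finite,linorder}" and c :: real
  defines "w \<equiv> \<lambda>x. c + q \<bullet> (x - a)"
  defines "K \<equiv> {x. norm (x - a) ^ m \<le> w x}"
  assumes K: "compact K" "K \<subseteq> D"
    and r: "0 < r" "cball a r \<subseteq> D" and l: "0 < l" and \<omega>: "\<And>x. x \<in> ball a r \<Longrightarrow> \<omega> \<le> w x"
    and p: "m \<le> p" "even p" and \<kappa>: "0 < \<kappa>"
  defines "z \<equiv> 1 + l ^ (2 * p)"
  shows "measure (mass_measure D m T) (ball a r) * (\<omega> - (r / l) ^ m * z - \<kappa>)
    \<le> z\<^sup>2 * (r / l) ^ m * measure (mass_measure D m T) K"
proof -
  let ?M = "mass_measure D m T"
  define \<delta> where "\<delta> = r / l"
  have \<delta>: "0 < \<delta>" using r l by (simp add: \<delta>_def)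
  define d where "d = \<delta> ^ (2 * p)"
  have d: "0 < d" using \<delta> by (simp add: d_def)
  have z: "1 \<le> z" using l by (simp add: z_def)
  interpret radial_profile m p d by unfold_locales (use m p d in auto)
  let ?\<rho> = "\<lambda>x. (norm (x - a))\<^sup>2"
  let ?\<theta> = "\<lambda>x. (?\<rho> x ^ p + d) powr (real m / (2 * real p))"
  let ?f = "\<lambda>x. d / (?\<rho> x ^ p + d) * (ramp \<kappa> (w x - ?\<theta> x) / ?\<theta> x)"
  let ?h = "\<lambda>x. ?\<rho> x ^ p / (?\<rho> x ^ p + d) * ramp1 \<kappa> (w x - ?\<theta> x)"
  have area: "testfun D ?f" "testfun D ?h"
    "(LINT x|mass_measure D m T. ?f x) \<le> (LINT x|mass_measure D m T. ?h x)"
    unfolding w_def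
    by - (rule weighted_area_inequality[OF K[unfolded K_def w_def] p d \<kappa>])+
  define \<nu> where "\<nu> = \<omega> - \<delta> ^ m * z - \<kappa>"
  show ?thesis
  proof (cases "0 < \<nu>")
    case False
    then have "measure ?M (ball a r) * \<nu> \<le> 0" by (simp add: mult_le_0_iff)
    also have "0 \<le> z\<^sup>2 * \<delta> ^ m * measure ?M K" using \<delta> by simp
    finally show ?thesis by (simp add: \<nu>_def \<delta>_def)
  next
    case True
    \<comment> \<open>A lower bound for the left integrand on the ball: 1 / z bounds d / (\<rho>^p +
      d), and the other factor bounds the ramp divided by \<theta>. Multiplying lower bounds needs
      \<nu> > 0; otherwise the claim is trivial.\<close>
    define c0 where "c0 = 1 / z * (\<nu> / (\<delta> ^ m * z))"
    have on_ball: "c0 \<le> ?f x" if x: "x \<in> ball a r" for x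
    proof -
      have "?\<rho> x \<le> r\<^sup>2" using x by (intro power_mono) (auto simp: dist_norm norm_minus_commute)
      then have "?\<rho> x ^ p \<le> (r\<^sup>2) ^ p" by (rule power_mono) auto
      also have "(r\<^sup>2) ^ p = l ^ (2 * p) * d"
        using l by (simp add: d_def \<delta>_def power_divide power_mult)
      finally have B: "?\<rho> x ^ p + d \<le> z * d" by (simp add: z_def algebra_simps)
      have Bp: "0 < ?\<rho> x ^ p + d" by (rule base_pos)
      have 1: "1 / z \<le> d / (?\<rho> x ^ p + d)" using B Bp z by (simp add: field_simps)
      have "?\<theta> x \<le> (z * d) powr (real m / (2 * real p))" using B Bp by (intro powr_mono2) auto
      also have "\<dots> = z powr (real m / (2 * real p)) * d powr (real m / (2 * real p))" using z d by (simp add: powr_mult)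
      also have "d powr (real m / (2 * real p)) = \<delta> ^ m"
      proof -
        have "d = \<delta> powr real (2 * p)" unfolding d_def by (rule powr_realpow[OF \<delta>, symmetric])
        then have "d powr (real m / (2 * real p)) = \<delta> powr (real (2 * p) * (real m / (2 * real p)))" by (simp only: powr_powr)
        also have "real (2 * p) * (real m / (2 * real p)) = real m" using m(1) p by simp
        finally show ?thesis using \<delta> by (simp add: powr_realpow)
      qed
      \<comment> \<open>The exponent is at most 1 and z \<ge> 1, so one factor z is enough.\<close>
      also have "z powr (real m / (2 * real p)) \<le> z powr 1"
        using z m(1) p by (intro powr_mono) (auto simp: divide_le_eq)
      finally have 2: "?\<theta> x \<le> \<delta> ^ m * z" using z \<delta> by (simp add: mult.commute)
      have "\<nu> \<le> w x - ?\<theta> x - \<kappa>" using \<omega>[OF x] 2 by (simp add: \<nu>_def)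
      also have "\<dots> \<le> ramp \<kappa> (w x - ?\<theta> x)" by (rule ramp_ge[OF \<kappa>])
      finally have 3: "\<nu> \<le> ramp \<kappa> (w x - ?\<theta> x)" .
      have "\<nu> / (\<delta> ^ m * z) \<le> ramp \<kappa> (w x - ?\<theta> x) / ?\<theta> x"
        using 2 3 Bp by (intro frac_le) (auto simp: ramp_nonneg)
      then show ?thesis unfolding c0_def
        using 1 True z \<delta> d Bp by (intro mult_mono) (auto intro!: divide_nonneg_nonneg)
    qed
    have nn: "0 \<le> ?f x" for x
      using d base_pos[of "?\<rho> x"] by (intro mult_nonneg_nonneg divide_nonneg_nonneg ramp_nonneg) auto
    have "c0 * measure ?M (ball a r) = (LINT x|?M. c0 * indicator (ball a r) x)"
      using fmeasurableD[OF ball_mass[OF r(2)]] by simp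
    also have "\<dots> \<le> (LINT x|?M. ?f x)"
    proof (rule integral_mono)
      show "integrable ?M (\<lambda>x. c0 * indicator (ball a r) x)"
        using ball_mass[OF r(2)] by (intro integrable_mult_right) (auto simp: fmeasurable_def less_top)
      show "integrable ?M ?f" by (rule mass_integrable[OF area(1)])
      show "c0 * indicator (ball a r) x \<le> ?f x" for x
        using on_ball[of x] nn[of x] by (cases "x \<in> ball a r") auto
    qed
    also have "\<dots> \<le> (LINT x|?M. ?h x)" by (rule area(3))
    also have "\<dots> \<le> (LINT x|?M. indicator K x)"
    proof (rule integral_mono)
      show "integrable ?M (indicator K :: _ \<Rightarrow> real)"
        using compact_mass[OF K] by (auto simp: fmeasurable_def less_top)
      show "integrable ?M ?h" by (rule mass_integrable[OF area(2)])
      show "?h x \<le> indicator K x" for x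
      proof (cases "x \<in> K")
        case True
        have "?\<rho> x ^ p / (?\<rho> x ^ p + d) \<le> 1" using base_pos[of "?\<rho> x"] d by (simp add: divide_le_eq)
        then have "?h x \<le> 1 * 1"
          using ramp1_le_1[OF \<kappa>] ramp1_nonneg[OF \<kappa>] by (intro mult_mono) auto
        then show ?thesis using True by simp
      next
        case False
        then have "w x < norm (x - a) ^ m" by (simp add: K_def)
        also have "\<dots> \<le> ?\<theta> x" using \<Theta>_ge[of "norm (x - a)"] by (simp add: \<Theta>_def)
        finally show ?thesis using False by (simp add: ramp_nonpos)
      qed
    qed
    also have "\<dots> = measure ?M K" using fmeasurableD[OF compact_mass[OF K]] by simp
    finally have "c0 * measure ?M (ball a r) * (z\<^sup>2 * \<delta> ^ m) \<le> measure ?M K * (z\<^sup>2 * \<delta> ^ m)"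
      using \<delta> by (intro mult_right_mono) auto
    moreover have "c0 * (z\<^sup>2 * \<delta> ^ m) = \<nu>"
      using z \<delta> by (simp add: c0_def field_simps power2_eq_square)
    ultimately have "measure ?M (ball a r) * \<nu> \<le> z\<^sup>2 * \<delta> ^ m * measure ?M K"
      by (metis (no_types, opaque_lifting) mult.assoc mult.commute)
    then show ?thesis by (simp add: \<nu>_def \<delta>_def)
  qed
qed

text \<open>The smoothing is removed in two limits. With l < 1 fixed, p tends to infinity and
  \<kappa> to 0 together, which sends l^(2 p) to 0; afterwards l tends to 1.\<close>

lemma ball_mass_le:
  fixes a q :: "real^'n::{finite,linorder}" and c :: real
  defines "K \<equiv> {x. norm (x - a) ^ m \<le> c + q \<bullet> (x - a)}"
  assumes K: "compact K" "K \<subseteq> D" and r: "0 < r" "cball a r \<subseteq> D"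
    and \<omega>: "\<And>x. x \<in> ball a r \<Longrightarrow> \<omega> \<le> c + q \<bullet> (x - a)"
  shows "measure (mass_measure D m T) (ball a r) * (\<omega> - r ^ m) \<le> r ^ m * measure (mass_measure D m T) K"
proof -
  let ?b = "measure (mass_measure D m T) (ball a r)" and ?k = "measure (mass_measure D m T) K"
  have 1: "?b * (\<omega> - (r / l) ^ m) \<le> (r / l) ^ m * ?k" if l: "0 < l" "l < 1" for l
  proof -
    \<comment> \<open>This is p = 2 (n + m), which is even and at least m, as
      \<open>radial_profile\<close> demands.\<close>
    define z where "z n = 1 + l ^ (2 * (2 * (n + m)))" for n
    have "(\<lambda>n. (l ^ 4) ^ (n + m)) \<longlonglongrightarrow> 0"
      using l by (intro LIMSEQ_ignore_initial_segment LIMSEQ_power_zero) (simp add: power_less_one_iff)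
    moreover have "(l ^ 4) ^ (n + m) = l ^ (2 * (2 * (n + m)))" for n
      by (simp add: power_mult[symmetric])
    ultimately have "z \<longlonglongrightarrow> 1 + 0" unfolding z_def by (intro tendsto_intros) simp
    then have z: "z \<longlonglongrightarrow> 1" by simp
    have \<kappa>: "(\<lambda>n. 1 / real (Suc n)) \<longlonglongrightarrow> 0"
      using LIMSEQ_inverse_real_of_nat by (simp add: inverse_eq_divide)
    have "?b * (\<omega> - (r / l) ^ m * 1 - 0) \<le> 1\<^sup>2 * (r / l) ^ m * ?k"
    proof (rule LIMSEQ_le)
      show "(\<lambda>n. ?b * (\<omega> - (r / l) ^ m * z n - 1 / real (Suc n))) \<longlonglongrightarrow> ?b * (\<omega> - (r / l) ^ m * 1 - 0)"
        by (intro tendsto_intros z \<kappa>)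
      show "(\<lambda>n. (z n)\<^sup>2 * (r / l) ^ m * ?k) \<longlonglongrightarrow> 1\<^sup>2 * (r / l) ^ m * ?k"
        by (intro tendsto_intros z)
      have "?b * (\<omega> - (r / l) ^ m * z n - 1 / real (Suc n)) \<le> (z n)\<^sup>2 * (r / l) ^ m * ?k" for n
        unfolding K_def z_def
        by (rule ball_mass_le_aux[OF K[unfolded K_def] r l(1) \<omega>]) auto
      then show "\<exists>N. \<forall>n\<ge>N. ?b * (\<omega> - (r / l) ^ m * z n - 1 / real (Suc n)) \<le> (z n)\<^sup>2 * (r / l) ^ m * ?k"
        by blast
    qed
    then show ?thesis by simp
  qed
  \<comment> \<open>Counting from n + 2 keeps l positive at n = 0.\<close>
  define l where "l n = 1 - 1 / real (Suc (Suc n))" for n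
  have l01: "0 < l n" "l n < 1" for n by (simp_all add: l_def)
  have "(\<lambda>n. 1 / real (Suc (Suc n))) \<longlonglongrightarrow> 0"
    using LIMSEQ_Suc[OF LIMSEQ_inverse_real_of_nat] by (simp add: inverse_eq_divide)
  then have "l \<longlonglongrightarrow> 1 - 0" unfolding l_def by (intro tendsto_intros)
  then have l: "l \<longlonglongrightarrow> 1" by simp
  have "?b * (\<omega> - (r / 1) ^ m) \<le> (r / 1) ^ m * ?k"
  proof (rule LIMSEQ_le)
    show "(\<lambda>n. ?b * (\<omega> - (r / l n) ^ m)) \<longlonglongrightarrow> ?b * (\<omega> - (r / 1) ^ m)"
      by (intro tendsto_intros l) auto
    show "(\<lambda>n. (r / l n) ^ m * ?k) \<longlonglongrightarrow> (r / 1) ^ m * ?k"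
      by (intro tendsto_intros l) auto
    show "\<exists>N. \<forall>n\<ge>N. ?b * (\<omega> - (r / l n) ^ m) \<le> (r / l n) ^ m * ?k"
      using 1[OF l01] by blast
  qed
  then show ?thesis by simp
qed

text \<open>The affine function is constant here. Compared with true monotonicity of the density
  quotient there is a loss of the factor 1 - (r / R)^m, which tends to 1 as r tends to 0 and so does
  not affect the limit.\<close>

lemma density_almost_monotone:
  assumes r: "0 < r" "r < R" and R: "cball a R \<subseteq> D"
  shows "measure (mass_measure D m T) (ball a r) * (R ^ m - r ^ m) \<le> r ^ m * measure (mass_measure D m T) (ball a R)"
proof -
  let ?M = "mass_measure D m T"
  have "measure ?M (ball a r) * (R ^ m - e - r ^ m) \<le> r ^ m * measure ?M (ball a R)" if e: "0 < e" for e
  proof -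
    \<comment> \<open>Subtracting e puts the closed sublevel set inside the open ball of radius
      R.\<close>
    let ?K = "{x. norm (x - a) ^ m \<le> (R ^ m - e) + 0 \<bullet> (x - a)}"
    have KR: "?K \<subseteq> ball a R"
    proof
      fix x assume "x \<in> ?K"
      then have "norm (x - a) ^ m < R ^ m" using e by simp
      then have "norm (x - a) < R" using r by (simp add: power_less_imp_less_base)
      then show "x \<in> ball a R" by (simp add: dist_norm norm_minus_commute)
    qed
    have "closed ?K" by (intro closed_Collect_le continuous_intros)
    moreover have "bounded ?K" by (rule bounded_subset[OF bounded_ball KR])
    ultimately have K: "compact ?K" by (simp add: compact_eq_bounded_closed)
    have KD: "?K \<subseteq> D" using KR R ball_subset_cball by blast
    have "cball a r \<subseteq> D" using r R by auto
    then have "measure ?M (ball a r) * (R ^ m - e - r ^ m) \<le> r ^ m * measure ?M ?K"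
      by (intro ball_mass_le K KD r) auto
    also have "\<dots> \<le> r ^ m * measure ?M (ball a R)"
      using r KR by (intro mult_left_mono measure_mono_fmeasurable ball_mass R fmeasurableD[OF compact_mass[OF K KD]]) auto
    finally show ?thesis .
  qed
  then have *: "measure ?M (ball a r) * (R ^ m - r ^ m) \<le> r ^ m * measure ?M (ball a R) + measure ?M (ball a r) * e"
    if "0 < e" for e using that by (simp add: algebra_simps)
  show ?thesis
  proof (rule field_le_epsilon)
    fix e :: real assume e: "0 < e"
    let ?b = "measure ?M (ball a r)"
    have "?b * (e / (?b + 1)) \<le> e"
    proof -
      have "?b * e \<le> (?b + 1) * e" using e by (intro mult_right_mono) auto
      then show ?thesis by (simp add: divide_le_eq mult.commute add_nonneg_pos)
    qed
    moreover have "0 < e / (?b + 1)" using e by (simp add: add_nonneg_pos)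
    ultimately show "?b * (R ^ m - r ^ m) \<le> r ^ m * measure ?M (ball a R) + e"
      using *[of "e / (?b + 1)"] by linarith
  qed
qed

text \<open>\<open>current_density\<close> is a \<open>Lim\<close>, so it is informative only once
  the limit exists. The limit is the infimum of the quotients over radii up to R0: a radius R nearly
  attaining the infimum bounds all small radii by almost monotonicity.\<close>

lemma density_exists:
  assumes "a \<in> D"
  obtains \<gamma> where "((\<lambda>r. measure (mass_measure D m T) (ball a r) / r ^ m) \<longlongrightarrow> \<gamma>) (at_right 0)" "0 \<le> \<gamma>"
proof -
  let ?M = "mass_measure D m T"
  obtain R0 where R0: "0 < R0" "cball a R0 \<subseteq> D" using open_D assms open_contains_cball by metis
  define f where "f r = measure ?M (ball a r) / r ^ m" for r
  define \<gamma> where "\<gamma> = Inf (f ` {0<..R0})"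
  have f0: "0 \<le> f r" if "0 < r" for r using that by (simp add: f_def)
  have bdd: "bdd_below (f ` {0<..R0})" by (rule bdd_belowI2[of _ 0]) (use f0 in auto)
  have ge: "\<gamma> \<le> f r" if "0 < r" "r \<le> R0" for r
    unfolding \<gamma>_def using that by (intro cInf_lower bdd) auto
  have "0 \<le> \<gamma>" unfolding \<gamma>_def using f0 R0 by (intro cInf_greatest) auto
  have mono: "f r * (1 - (r / R) ^ m) \<le> f R" if "0 < r" "r < R" "R \<le> R0" for r R
  proof -
    have "cball a R \<subseteq> D" using that R0 by auto
    from density_almost_monotone[OF that(1,2) this]
    have "measure ?M (ball a r) * (R ^ m - r ^ m) / (r ^ m * R ^ m) \<le> r ^ m * measure ?M (ball a R) / (r ^ m * R ^ m)"
      using that by (intro divide_right_mono) auto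
    then show ?thesis using that by (simp add: f_def power_divide field_simps)
  qed
  have "(f \<longlongrightarrow> \<gamma>) (at_right 0)"
  proof (rule order_tendstoI)
    fix u assume u: "u < \<gamma>"
    show "eventually (\<lambda>r. u < f r) (at_right 0)"
    proof (rule eventually_at_rightI[OF _ R0(1)])
      fix r assume "r \<in> {0<..<R0}"
      then show "u < f r" using ge[of r] u by simp
    qed
  next
    fix u assume "\<gamma> < u"
    then obtain R where R: "0 < R" "R \<le> R0" "f R < u"
      unfolding \<gamma>_def using cInf_less_iff[OF _ bdd, of u] R0(1) by auto
    have "((\<lambda>r. f R / (1 - (r / R) ^ m)) \<longlongrightarrow> f R / (1 - (0 / R) ^ m)) (at_right 0)"
      using R m(1) by (intro tendsto_intros) (auto simp: power_0_left)
    moreover have "f R / (1 - (0 / R) ^ m) < u" using R m(1) by (simp add: power_0_left)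
    ultimately have "eventually (\<lambda>r. f R / (1 - (r / R) ^ m) < u) (at_right 0)" by (rule order_tendstoD)
    moreover have "eventually (\<lambda>r. f r \<le> f R / (1 - (r / R) ^ m)) (at_right 0)"
    proof (rule eventually_at_rightI[OF _ R(1)])
      fix r assume r: "r \<in> {0<..<R}"
      then have "(r / R) ^ m < 1" using m(1) by (simp add: power_less_one_iff)
      then show "f r \<le> f R / (1 - (r / R) ^ m)" using mono[of r R] r R by (simp add: le_divide_eq)
    qed
    ultimately show "eventually (\<lambda>r. f r < u) (at_right 0)" by eventually_elim simp
  qed
  then have "((\<lambda>r. measure ?M (ball a r) / r ^ m) \<longlongrightarrow> \<gamma>) (at_right 0)" unfolding f_def .
  then show thesis using \<open>0 \<le> \<gamma>\<close> by (rule that)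
qed

end

section \<open>Reduction to affine functions\<close>

text \<open>D need not be convex, so separation is carried out over a ball only: a hyperplane
  separates the point (a, w a) from the strict epigraph there. \<open>superlevel_subset\<close>
  spreads the inequality along segments.\<close>

lemma convex_fun_on_subgradient:
  fixes w :: "'a::euclidean_space \<Rightarrow> real"
  assumes "open D" "a \<in> D" "convex_fun_on (closure D) w"
  obtains q R where "0 < R" "ball a R \<subseteq> D" "\<And>x. x \<in> ball a R \<Longrightarrow> w a + q \<bullet> (x - a) \<le> w x"
proof -
  obtain R where R: "0 < R" "ball a R \<subseteq> D" using assms open_contains_ball by metis
  let ?B = "ball a R"
  have cv: "w ((1 - t) *\<^sub>R x + t *\<^sub>R y) \<le> (1 - t) * w x + t * w y"
    if "x \<in> ?B" "y \<in> ?B" "0 \<le> t" "t \<le> 1" for x y t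
  proof -
    have "closed_segment x y \<subseteq> ?B" using that by (intro closed_segment_subset convex_ball)
    then have "closed_segment x y \<subseteq> closure D" using R closure_subset by blast
    then have "convex_on (closed_segment x y) w" using assms(3) by (simp add: convex_fun_on_def)
    then show ?thesis using that by (intro convex_onD) auto
  qed
  define S where "S = {z. fst z \<in> ?B \<and> w (fst z) < snd z}"
  have "convex S"
    unfolding convex_alt
  proof (intro ballI allI impI)
    fix z z' and t :: real assume z: "z \<in> S" "z' \<in> S" and t: "0 \<le> t \<and> t \<le> 1"
    have "(1 - t) *\<^sub>R fst z + t *\<^sub>R fst z' \<in> ?B"
      using z t convex_ball[of a R] unfolding convex_alt by (simp add: S_def)
    moreover have "w ((1 - t) *\<^sub>R fst z + t *\<^sub>R fst z') \<le> (1 - t) * w (fst z) + t * w (fst z')"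
      using z t by (intro cv) (auto simp: S_def)
    moreover have "(1 - t) * w (fst z) + t * w (fst z') < (1 - t) * snd z + t * snd z'"
    proof (cases "t = 0")
      case False
      then show ?thesis using z t by (intro add_le_less_mono mult_left_mono mult_strict_left_mono) (auto simp: S_def)
    qed (use z in \<open>simp add: S_def\<close>)
    ultimately show "(1 - t) *\<^sub>R z + t *\<^sub>R z' \<in> S" by (simp add: S_def)
  qed
  moreover have "S \<noteq> {}"
  proof -
    have "(a, w a + 1) \<in> S" using R by (simp add: S_def)
    then show ?thesis by blast
  qed
  moreover have "{(a, w a)} \<inter> S = {}" by (auto simp: S_def)
  ultimately have "\<exists>v b. v \<noteq> 0 \<and> (\<forall>z\<in>{(a, w a)}. v \<bullet> z \<le> b) \<and> (\<forall>z\<in>S. b \<le> v \<bullet> z)"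
    by (intro separating_hyperplane_sets) simp_all
  then obtain v b where v: "v \<noteq> 0" "v \<bullet> (a, w a) \<le> b" "\<And>z. z \<in> S \<Longrightarrow> b \<le> v \<bullet> z"
    by blast
  define v1 v2 where "v1 = fst v" and "v2 = snd v"
  have sep: "v1 \<bullet> a + v2 * w a \<le> v1 \<bullet> x + v2 * t" if "x \<in> ?B" "w x < t" for x t
  proof -
    have "b \<le> v \<bullet> (x, t)" using that by (intro v(3)) (simp add: S_def)
    then show ?thesis using v(2) by (simp add: v1_def v2_def inner_prod_def)
  qed
  have "0 \<le> v2" using sep[of a "w a + 1"] R by (simp add: algebra_simps)
  \<comment> \<open>A vertical hyperplane is impossible, because from a one can move in the
    direction -v1 and stay in the ball.\<close>
  moreover have "v2 \<noteq> 0"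
  proof
    assume v2: "v2 = 0"
    then have "v1 \<noteq> 0" using v(1) by (auto simp: v1_def v2_def prod_eq_iff)
    define x where "x = a - (R / (2 * norm v1)) *\<^sub>R v1"
    have "norm (x - a) = R / 2" using \<open>v1 \<noteq> 0\<close> R by (simp add: x_def)
    then have "x \<in> ?B" using R by (simp add: dist_norm norm_minus_commute)
    then have "v1 \<bullet> a \<le> v1 \<bullet> x" using sep[of x "w x + 1"] v2 by simp
    then have "R / (2 * norm v1) * (v1 \<bullet> v1) \<le> 0" by (simp add: x_def inner_diff_right)
    moreover have "0 < R / (2 * norm v1) * (v1 \<bullet> v1)" using \<open>v1 \<noteq> 0\<close> R by simp
    ultimately show False by simp
  qed
  ultimately have v2: "0 < v2" by simp
  define q where "q = (- 1 / v2) *\<^sub>R v1"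
  have "w a + q \<bullet> (x - a) \<le> w x" if x: "x \<in> ?B" for x
  proof (rule field_le_epsilon)
    fix e :: real assume "0 < e"
    then have "v1 \<bullet> a + v2 * w a \<le> v1 \<bullet> x + v2 * (w x + e)" by (intro sep x) simp
    then have "(v1 \<bullet> a + v2 * w a) / v2 \<le> (v1 \<bullet> x + v2 * (w x + e)) / v2"
      using v2 by (intro divide_right_mono) auto
    then show "w a + q \<bullet> (x - a) \<le> w x + e"
      using v2 by (simp add: q_def inner_diff_right add_divide_distrib diff_divide_distrib)
  qed
  then show thesis using that R by blast
qed

text \<open>The set below is convex, and \<open>w\<close> stays above its subgradient at \<open>a\<close> along a ray from \<open>a\<close> as long
  as the ray stays in \<open>D\<close>; so the ray cannot leave \<open>D\<close> inside this set.\<close>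

lemma superlevel_subset:
  fixes w :: "'a::euclidean_space \<Rightarrow> real"
  assumes D: "open D" "a \<in> D" and w: "convex_fun_on (closure D) w"
    and bd: "\<And>x. x \<in> frontier D \<Longrightarrow> w x = norm (x - a) ^ m" and m: "1 \<le> m" and wa: "0 < w a"
    and R: "0 < R" "\<And>x. x \<in> ball a R \<Longrightarrow> w a + q \<bullet> (x - a) \<le> w x"
  shows "{x. norm (x - a) ^ m < w a + q \<bullet> (x - a)} \<subseteq> D"
proof (rule subsetI, rule ccontr)
  fix x assume x: "x \<in> {x. norm (x - a) ^ m < w a + q \<bullet> (x - a)}" and "x \<notin> D"
  define P where "P t = a + t *\<^sub>R (x - a)" for t :: real
  define S where "S = {t \<in> {0..1}. P t \<notin> D}"
  have cP: "continuous_on A P" for A unfolding P_def by (intro continuous_intros)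
  have "closed (P -` (- D))"
    using D(1) cP[of UNIV] by (intro continuous_closed_vimage) (auto simp: continuous_on_eq_continuous_at)
  moreover have "S = {0..1} \<inter> P -` (- D)" by (auto simp: S_def)
  ultimately have "compact S" by (simp add: compact_Int_closed)
  moreover have "1 \<in> S" using \<open>x \<notin> D\<close> by (simp add: S_def P_def)
  \<comment> \<open>The first parameter at which the segment from a to x leaves D; P s is then a
    frontier point, where w is known.\<close>
  ultimately obtain s where s: "s \<in> S" "\<And>t. t \<in> S \<Longrightarrow> s \<le> t"
    using continuous_attains_inf[of S "\<lambda>t. t"] continuous_on_id by (metis empty_iff)
  have s01: "0 \<le> s" "s \<le> 1" "P s \<notin> D" using s(1) by (auto simp: S_def)
  have "s \<noteq> 0" using s01(3) D(2) by (auto simp: P_def)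
  then have s0: "0 < s" using s01 by simp
  have before: "P t \<in> D" if "0 \<le> t" "t < s" for t
    using s(2)[of t] that s01 by (auto simp: S_def)
  have cl: "P t \<in> closure D" if "0 \<le> t" "t \<le> s" for t
  proof (cases "t < s")
    case True
    then show ?thesis using before[OF that(1)] closure_subset by blast
  next
    case False
    then have t: "t = s" using that by simp
    have "P ` closure {0..<s} \<subseteq> closure D"
      by (rule image_closure_subset[OF cP closed_closure]) (use before closure_subset in force)
    moreover have "s \<in> closure {0..<s}" using s0 by simp
    ultimately show ?thesis unfolding t by blast
  qed
  have "P s \<in> frontier D"
    using cl[of s] s01 D(1) by (simp add: frontier_def interior_open)
  then have wP: "w (P s) = norm (P s - a) ^ m" by (rule bd)
  have "closed_segment a (P s) \<subseteq> closure D"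
  proof
    fix y assume "y \<in> closed_segment a (P s)"
    then obtain u where u: "0 \<le> u" "u \<le> 1" "y = (1 - u) *\<^sub>R a + u *\<^sub>R P s" by (auto simp: in_segment)
    then have "y = P (u * s)" by (simp add: P_def algebra_simps)
    then show "y \<in> closure D" using u s01 by (simp add: cl mult_left_le_one_le)
  qed
  then have cv: "convex_on (closed_segment a (P s)) w" using w by (simp add: convex_fun_on_def)
  \<comment> \<open>u shrinks the segment into the ball where the subgradient inequality holds;
    convexity then carries the inequality over to P s.\<close>
  define u where "u = min 1 (R / (2 * (norm (P s - a) + 1)))"
  have u: "0 < u" "u \<le> 1" using R(1) by (auto simp: u_def add_nonneg_pos)
  let ?y = "(1 - u) *\<^sub>R a + u *\<^sub>R P s"
  have y: "?y - a = u *\<^sub>R (P s - a)" by (simp add: algebra_simps)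
  have "norm (?y - a) < R"
  proof -
    have "norm (?y - a) = u * norm (P s - a)" unfolding y using u by simp
    also have "\<dots> \<le> R / (2 * (norm (P s - a) + 1)) * norm (P s - a)"
      by (intro mult_right_mono) (auto simp: u_def)
    also have "\<dots> \<le> R / 2 * (norm (P s - a) / (norm (P s - a) + 1))" by simp
    also have "\<dots> \<le> R / 2 * 1" using R(1) by (intro mult_left_mono) (auto simp: divide_le_eq add_nonneg_pos)
    finally show ?thesis using R(1) by simp
  qed
  then have "w a + q \<bullet> (?y - a) \<le> w ?y" by (intro R(2)) (simp add: dist_norm norm_minus_commute)
  also have "\<dots> \<le> (1 - u) * w a + u * w (P s)" using u by (intro convex_onD[OF cv]) auto
  finally have "u * (w a + q \<bullet> (P s - a)) \<le> u * w (P s)" unfolding y by (simp add: algebra_simps)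
  then have "w a + q \<bullet> (P s - a) \<le> norm (P s - a) ^ m" using u wP by simp
  \<comment> \<open>The contradiction: |P s - a|^m scales by s^m \<le> s, while the affine function
    at P s is at least s times its value at x because w a > 0.\<close>
  also have "\<dots> = s ^ m * norm (x - a) ^ m" using s01 by (simp add: P_def power_mult_distrib)
  also have "\<dots> \<le> s * norm (x - a) ^ m"
  proof (intro mult_right_mono)
    show "s ^ m \<le> s" using power_decreasing[of 1 m s] m s01 by simp
  qed simp
  also have "\<dots> < s * (w a + q \<bullet> (x - a))" using x s0 by simp
  also have "\<dots> \<le> w a + q \<bullet> (P s - a)"
    using mult_right_mono[of s 1 "w a"] s01 wa by (simp add: P_def algebra_simps)
  finally show False by simp
qed

theorem theorem6p3:
  fixes D :: "(real^'n::{finite,linorder}) set"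
    and a :: "real^'n::{finite,linorder}"
    and w :: "real^'n::{finite,linorder} \<Rightarrow> real"
    and m :: nat
    and T :: "'n supercurrent"
  assumes "smoothly_bounded_domain D"
    and "a \<in> D"
    and "convex_fun_on (closure D) w"
    and "\<And>x. x \<in> frontier D \<Longrightarrow> w x = norm (x - a) ^ m"
    and "minimal_supercurrent D m T"
  shows "emeasure (mass_measure D m T) D \<ge> ennreal (w a * current_density D m T a)"
proof -
  have D: "open D" "bounded D" using assms(1) by (auto simp: smoothly_bounded_domain_def)
  interpret minimal_current D m T by unfold_locales (rule D(1), rule assms(5))
  let ?M = "mass_measure D m T"
  obtain \<gamma> where lim: "((\<lambda>r. measure ?M (ball a r) / r ^ m) \<longlongrightarrow> \<gamma>) (at_right 0)" and \<gamma>: "0 \<le> \<gamma>"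
    using density_exists[OF assms(2)] .
  have dens: "current_density D m T a = \<gamma>"
    unfolding current_density_def by (rule tendsto_Lim[OF _ lim]) simp
  have Ds: "D \<in> sets ?M" using mass_sets[of D] D(1) by simp
  \<comment> \<open>Infinite mass and w a \<le> 0 give the claim at once. In the remaining case w a
    > 0 serves \<open>superlevel_subset\<close>, and finite mass permits real-valued
    comparisons.\<close>
  consider "emeasure ?M D = top" | "w a \<le> 0" | "emeasure ?M D < top" "0 < w a" by (fastforce simp: less_top)
  then show ?thesis
  proof cases
    case 1
    then show ?thesis by simp
  next
    case 2
    then have "w a * current_density D m T a \<le> 0" using \<gamma> by (simp add: dens mult_nonpos_nonneg)
    then show ?thesis by (simp add: ennreal_neg)
  next
    case 3
    have fin: "D \<in> fmeasurable ?M" using 3(1) Ds by (intro fmeasurableI) auto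
    obtain q R where R: "0 < R" "ball a R \<subseteq> D" "\<And>x. x \<in> ball a R \<Longrightarrow> w a + q \<bullet> (x - a) \<le> w x"
      by (rule convex_fun_on_subgradient[OF D(1) assms(2,3)]) (rule that)
    have C: "{x. norm (x - a) ^ m < w a + q \<bullet> (x - a)} \<subseteq> D"
      by (rule superlevel_subset[OF D(1) assms(2,3,4) m(1) 3(2) R(1,3)])
    have "(w a - e) * \<gamma> \<le> measure ?M D" if e: "0 < e" for e
    proof -
      \<comment> \<open>The closed set with e = 0 may touch the frontier of D; lowering the affine
        function by e gives a compact subset of D.\<close>
      let ?K = "{x. norm (x - a) ^ m \<le> (w a - e) + q \<bullet> (x - a)}"
      have KD: "?K \<subseteq> D"
      proof (rule order_trans[OF _ C], rule subsetI)
        show "x \<in> {x. norm (x - a) ^ m < w a + q \<bullet> (x - a)}" if "x \<in> ?K" for x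
          using that e by auto
      qed
      have "closed ?K" by (intro closed_Collect_le continuous_intros)
      then have K: "compact ?K"
        using bounded_subset[OF D(2) KD] by (simp add: compact_eq_bounded_closed)
      have "measure ?M (ball a r) / r ^ m * ((w a - e) - norm q * r - r ^ m) \<le> measure ?M D"
        if r: "0 < r" "r < R" for r
      proof -
        have "cball a r \<subseteq> D" using r R(2) by auto
        \<comment> \<open>The constant \<omega> for \<open>ball_mass_le\<close>; its loss
          \<open>norm q * r\<close> vanishes with r.\<close>
        moreover have "(w a - e) - norm q * r \<le> (w a - e) + q \<bullet> (x - a)" if "x \<in> ball a r" for x
        proof -
          have "- (q \<bullet> (x - a)) \<le> norm q * norm (x - a)"
            using norm_cauchy_schwarz[of "- q" "x - a"] by simp
          also have "\<dots> \<le> norm q * r"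
            using that by (intro mult_left_mono) (auto simp: dist_norm norm_minus_commute)
          finally show ?thesis by simp
        qed
        ultimately have "measure ?M (ball a r) * ((w a - e) - norm q * r - r ^ m) \<le> r ^ m * measure ?M ?K"
          by (intro ball_mass_le K KD r(1))
        also have "\<dots> \<le> r ^ m * measure ?M D"
          using r KD by (intro mult_left_mono measure_mono_fmeasurable fin fmeasurableD[OF compact_mass[OF K KD]]) auto
        finally show ?thesis using r by (simp add: divide_le_eq mult.commute)
      qed
      then have "eventually (\<lambda>r. measure ?M (ball a r) / r ^ m * ((w a - e) - norm q * r - r ^ m) \<le> measure ?M D) (at_right 0)"
        by (intro eventually_at_rightI[OF _ R(1)]) auto
      moreover have "((\<lambda>r. measure ?M (ball a r) / r ^ m * ((w a - e) - norm q * r - r ^ m)) \<longlongrightarrow>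
          \<gamma> * ((w a - e) - norm q * 0 - 0 ^ m)) (at_right 0)"
        by (intro tendsto_intros lim)
      ultimately have "\<gamma> * ((w a - e) - norm q * 0 - 0 ^ m) \<le> measure ?M D"
        by (intro tendsto_upperbound[of _ _ "at_right 0"]) auto
      then show ?thesis using m(1) by (simp add: power_0_left mult.commute)
    qed
    then have *: "w a * \<gamma> \<le> measure ?M D + e * \<gamma>" if "0 < e" for e
      using that by (metis diff_le_eq left_diff_distrib)
    have "w a * \<gamma> \<le> measure ?M D"
    proof (rule field_le_epsilon)
      fix e :: real assume e: "0 < e"
      have "e / (\<gamma> + 1) * \<gamma> \<le> e"
        using e \<gamma> by (simp add: divide_le_eq algebra_simps)
      moreover have "0 < e / (\<gamma> + 1)" using e \<gamma> by (simp add: add_nonneg_pos)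
      ultimately show "w a * \<gamma> \<le> measure ?M D + e" using *[of "e / (\<gamma> + 1)"] by linarith
    qed
    then have "ennreal (w a * \<gamma>) \<le> ennreal (measure ?M D)" by (rule ennreal_leI)
    also have "\<dots> = emeasure ?M D" using 3(1) by (simp add: emeasure_eq_ennreal_measure less_top)
    finally show ?thesis by (simp add: dens)
  qed
qed

end
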